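(* Consider the classes $\mathcal{W}$, $\mathcal{W}_+$ and $\mathcal{W}_-$ of weakly compact, tauberian and cotauberian pairs of closed subspaces of Banach spaces. Then: (i) The classes $\mathcal{W}_+$ and $\mathcal{W}_-$ are symmetric. (ii) The class $\mathcal{W}$ is transitive but not symmetric. (iii) $\mathcal{W}_+$ is left stable but not right stable under perturbation by $\mathcal{W}$. (iv) $\mathcal{W}_-$ is right stable but not left stable under perturbation by $\mathcal{W}$.
   Context: For a closed subspace $M$ of a Banach space $Z$, $J_M\colon M\to Z$ is the inclusion and $Q_M\colon Z\to Z/M$ the quotient map. A Banach space $X$ is identified with its canonical image in $X^{**}$. A bounded operator $S\colon X\to Y$ between Banach spaces is tauberian if $S^{**}(X^{**}\setminus X)\subset Y^{**}\setminus Y$, and cotauberian if its conjugate $S^*\colon Y^*\to X^*$ is tauberian. $\mathcal{W}$ (respectively $\mathcal{W}_+$, $\mathcal{W}_-$) is the class of all ordered pairs $(M,N)$ of closed subspaces of $Z$, for $Z$ any Banach space, such that the operator $Q_NJ_M\colon M\to Z/N$ is weakly compact (respectively tauberian, cotauberian). Let $\mathcal{D}$ and $\mathcal{O}$ be classes of pairs of closed subspaces of Banach spaces. In the following, $L,M,N$ range over the closed subspaces of an arbitrary common Banach space $Z$. - $\mathcal{D}$ is symmetric if $(M,N)\in\mathcal{D}$ if and only if $(N,M)\in\mathcal{D}$. - $\mathcal{D}$ is transitive if $(L,M)\in\mathcal{D}$ and $(M,N)\in\mathcal{D}$ imply $(L,N)\in\mathcal{D}$. - $\mathcal{D}$ is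 left stable under perturbation by $\mathcal{O}$ if $(L,M)\in\mathcal{O}$ and $(M,N)\in\mathcal{D}$ imply $(L,N)\in\mathcal{D}$. - $\mathcal{D}$ is right stable under perturbation by $\mathcal{O}$ if $(L,M)\in\mathcal{D}$ and $(M,N)\in\mathcal{O}$ imply $(L,N)\in\mathcal{D}$. The negative assertions mean that the corresponding implication fails for some Banach space $Z$ and some closed subspaces of it. *)

theory Defs
  imports "HOL-Analysis.Analysis"
begin

(* Closed subspaces, quotients and duals depend on terms, so they cannot be types of class banach.
   Normed spaces are therefore carried by sets. The scalars 'k are instantiated to real and to
   complex. *)

record ('k, 'a) nspace =
  ns_carrier :: "'a set"
  ns_zero :: 'a
  ns_add :: "'a \<Rightarrow> 'a \<Rightarrow> 'a"
  ns_scale :: "'k \<Rightarrow> 'a \<Rightarrow> 'a"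
  ns_norm :: "'a \<Rightarrow> real"

locale normed_space =
  fixes X :: "('k::real_normed_field, 'a) nspace"
  assumes ns_zero_closed: "ns_zero X \<in> ns_carrier X"
    and ns_add_closed: "\<lbrakk>x \<in> ns_carrier X; y \<in> ns_carrier X\<rbrakk> \<Longrightarrow> ns_add X x y \<in> ns_carrier X"
    and ns_scale_closed: "x \<in> ns_carrier X \<Longrightarrow> ns_scale X c x \<in> ns_carrier X"
    and ns_add_assoc: "\<lbrakk>x \<in> ns_carrier X; y \<in> ns_carrier X; z \<in> ns_carrier X\<rbrakk>
      \<Longrightarrow> ns_add X (ns_add X x y) z = ns_add X x (ns_add X y z)"
    and ns_add_commute: "\<lbrakk>x \<in> ns_carrier X; y \<in> ns_carrier X\<rbrakk> \<Longrightarrow> ns_add X x y = ns_add X y x"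
    and ns_add_zero: "x \<in> ns_carrier X \<Longrightarrow> ns_add X x (ns_zero X) = x"
    and ns_add_inverse: "x \<in> ns_carrier X \<Longrightarrow> \<exists>y\<in>ns_carrier X. ns_add X x y = ns_zero X"
    and ns_scale_add_right: "\<lbrakk>x \<in> ns_carrier X; y \<in> ns_carrier X\<rbrakk>
      \<Longrightarrow> ns_scale X c (ns_add X x y) = ns_add X (ns_scale X c x) (ns_scale X c y)"
    and ns_scale_add_left: "x \<in> ns_carrier X
      \<Longrightarrow> ns_scale X (c + d) x = ns_add X (ns_scale X c x) (ns_scale X d x)"
    and ns_scale_scale: "x \<in> ns_carrier X \<Longrightarrow> ns_scale X c (ns_scale X d x) = ns_scale X (c * d) x"
    and ns_scale_one: "x \<in> ns_carrier X \<Longrightarrow> ns_scale X 1 x = x"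
    and ns_norm_nonneg: "x \<in> ns_carrier X \<Longrightarrow> 0 \<le> ns_norm X x"
    and ns_norm_eq_zero: "x \<in> ns_carrier X \<Longrightarrow> ns_norm X x = 0 \<longleftrightarrow> x = ns_zero X"
    and ns_norm_scale: "x \<in> ns_carrier X \<Longrightarrow> ns_norm X (ns_scale X c x) = norm c * ns_norm X x"
    and ns_norm_triangle: "\<lbrakk>x \<in> ns_carrier X; y \<in> ns_carrier X\<rbrakk>
      \<Longrightarrow> ns_norm X (ns_add X x y) \<le> ns_norm X x + ns_norm X y"

(* The locale Metric_space requires symmetry and nonnegativity also off the carrier, hence the
   default value 0 there. *)
definition ns_dist :: "('k::real_normed_field, 'a) nspace \<Rightarrow> 'a \<Rightarrow> 'a \<Rightarrow> real" where
  "ns_dist X x y = (if x \<in> ns_carrier X \<and> y \<in> ns_carrier X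
     then ns_norm X (ns_add X x (ns_scale X (- 1) y)) else 0)"

definition banach_space :: "('k::real_normed_field, 'a) nspace \<Rightarrow> bool" where
  "banach_space X \<longleftrightarrow> normed_space X \<and> Metric_space.mcomplete (ns_carrier X) (ns_dist X)"

definition closed_subspace :: "('k::real_normed_field, 'a) nspace \<Rightarrow> 'a set \<Rightarrow> bool" where
  "closed_subspace Z M \<longleftrightarrow>
     M \<subseteq> ns_carrier Z \<and> ns_zero Z \<in> M \<and>
     (\<forall>x\<in>M. \<forall>y\<in>M. ns_add Z x y \<in> M) \<and> (\<forall>c. \<forall>x\<in>M. ns_scale Z c x \<in> M) \<and>
     closedin (Metric_space.mtopology (ns_carrier Z) (ns_dist Z)) M"

definition subspace_of :: "('k::real_normed_field, 'a) nspace \<Rightarrow> 'a set \<Rightarrow> ('k, 'a) nspace" where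
  "subspace_of Z M = Z\<lparr>ns_carrier := M\<rparr>"

definition inclusion :: "'a set \<Rightarrow> 'a \<Rightarrow> 'a" where
  "inclusion M = (\<lambda>x\<in>M. x)"

definition quotient_map :: "('k::real_normed_field, 'a) nspace \<Rightarrow> 'a set \<Rightarrow> 'a \<Rightarrow> 'a set" where
  "quotient_map Z N = (\<lambda>x\<in>ns_carrier Z. ns_add Z x ` N)"

(* The scalar multiple c A of a coset is c A + N rather than the pointwise multiple, which for
   c = 0 would be the singleton of zero and not the coset N. *)
definition quotient_space ::
  "('k::real_normed_field, 'a) nspace \<Rightarrow> 'a set \<Rightarrow> ('k, 'a set) nspace" where
  "quotient_space Z N =
     \<lparr>ns_carrier = quotient_map Z N ` ns_carrier Z,
      ns_zero = N,
      ns_add = (\<lambda>A B. {ns_add Z a b |a b. a \<in> A \<and> b \<in> B}),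
      ns_scale = (\<lambda>c A. {ns_add Z (ns_scale Z c a) n |a n. a \<in> A \<and> n \<in> N}),
      ns_norm = (\<lambda>A. INF a\<in>A. ns_norm Z a)\<rparr>"

definition bounded_operator ::
  "('k::real_normed_field, 'a) nspace \<Rightarrow> ('k, 'b) nspace \<Rightarrow> ('a \<Rightarrow> 'b) \<Rightarrow> bool" where
  "bounded_operator X Y S \<longleftrightarrow>
     S ` ns_carrier X \<subseteq> ns_carrier Y \<and>
     (\<forall>x\<in>ns_carrier X. \<forall>y\<in>ns_carrier X. S (ns_add X x y) = ns_add Y (S x) (S y)) \<and>
     (\<forall>c. \<forall>x\<in>ns_carrier X. S (ns_scale X c x) = ns_scale Y c (S x)) \<and>
     (\<exists>K. \<forall>x\<in>ns_carrier X. ns_norm Y (S x) \<le> K * ns_norm X x)"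

definition unit_ball :: "('k::real_normed_field, 'a) nspace \<Rightarrow> 'a set" where
  "unit_ball X = {x \<in> ns_carrier X. ns_norm X x \<le> 1}"

definition scalar_space :: "('k::real_normed_field, 'k) nspace" where
  "scalar_space =
     \<lparr>ns_carrier = UNIV, ns_zero = 0, ns_add = (+), ns_scale = (*), ns_norm = norm\<rparr>"

(* Functionals are extensional, so that equality of functionals is equality on the carrier. *)
definition dual :: "('k::real_normed_field, 'a) nspace \<Rightarrow> ('k, 'a \<Rightarrow> 'k) nspace" where
  "dual X =
     \<lparr>ns_carrier = {f \<in> extensional (ns_carrier X). bounded_operator X scalar_space f},
      ns_zero = (\<lambda>x\<in>ns_carrier X. 0),
      ns_add = (\<lambda>f g. \<lambda>x\<in>ns_carrier X. f x + g x),
      ns_scale = (\<lambda>c f. \<lambda>x\<in>ns_carrier X. c * f x),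
      ns_norm = (\<lambda>f. SUP x\<in>unit_ball X. norm (f x))\<rparr>"

abbreviation bidual ::
  "('k::real_normed_field, 'a) nspace \<Rightarrow> ('k, ('a \<Rightarrow> 'k) \<Rightarrow> 'k) nspace" where
  "bidual X \<equiv> dual (dual X)"

definition canonical_embedding ::
  "('k::real_normed_field, 'a) nspace \<Rightarrow> 'a \<Rightarrow> ('a \<Rightarrow> 'k) \<Rightarrow> 'k" where
  "canonical_embedding X = (\<lambda>x\<in>ns_carrier X. \<lambda>f\<in>ns_carrier (dual X). f x)"

definition conjugate ::
  "('k::real_normed_field, 'a) nspace \<Rightarrow> ('k, 'b) nspace \<Rightarrow> ('a \<Rightarrow> 'b) \<Rightarrow> ('b \<Rightarrow> 'k) \<Rightarrow> 'a \<Rightarrow> 'k" where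
  "conjugate X Y S = (\<lambda>g\<in>ns_carrier (dual Y). \<lambda>x\<in>ns_carrier X. g (S x))"

definition second_conjugate ::
  "('k::real_normed_field, 'a) nspace \<Rightarrow> ('k, 'b) nspace \<Rightarrow> ('a \<Rightarrow> 'b) \<Rightarrow>
     (('a \<Rightarrow> 'k) \<Rightarrow> 'k) \<Rightarrow> ('b \<Rightarrow> 'k) \<Rightarrow> 'k" where
  "second_conjugate X Y S = conjugate (dual Y) (dual X) (conjugate X Y S)"

definition weak_topology :: "('k::real_normed_field, 'a) nspace \<Rightarrow> 'a topology" where
  "weak_topology Y = topology_generated_by
     {{y \<in> ns_carrier Y. f y \<in> U} |f U. f \<in> ns_carrier (dual Y) \<and> open U}"

definition weakly_compact_operator ::
  "('k::real_normed_field, 'a) nspace \<Rightarrow> ('k, 'b) nspace \<Rightarrow> ('a \<Rightarrow> 'b) \<Rightarrow> bool" where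
  "weakly_compact_operator X Y S \<longleftrightarrow>
     bounded_operator X Y S \<and>
     compactin (weak_topology Y) (weak_topology Y closure_of (S ` unit_ball X))"

definition tauberian ::
  "('k::real_normed_field, 'a) nspace \<Rightarrow> ('k, 'b) nspace \<Rightarrow> ('a \<Rightarrow> 'b) \<Rightarrow> bool" where
  "tauberian X Y S \<longleftrightarrow>
     bounded_operator X Y S \<and>
     second_conjugate X Y S ` (ns_carrier (bidual X) - canonical_embedding X ` ns_carrier X)
       \<subseteq> ns_carrier (bidual Y) - canonical_embedding Y ` ns_carrier Y"

definition cotauberian ::
  "('k::real_normed_field, 'a) nspace \<Rightarrow> ('k, 'b) nspace \<Rightarrow> ('a \<Rightarrow> 'b) \<Rightarrow> bool" where
  "cotauberian X Y S \<longleftrightarrow>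
     bounded_operator X Y S \<and> tauberian (dual Y) (dual X) (conjugate X Y S)"

(* A pair (M, N) is recorded together with its ambient space Z. The type 'a bounds the size of
   the ambient spaces: their carriers are arbitrary subsets of 'a. *)
type_synonym ('k, 'a) pair_class = "(('k, 'a) nspace \<times> 'a set \<times> 'a set) set"

definition closed_pairs :: "('k::real_normed_field, 'a) pair_class" where
  "closed_pairs = {(Z, M, N). banach_space Z \<and> closed_subspace Z M \<and> closed_subspace Z N}"

definition weakly_compact_pairs :: "('k::real_normed_field, 'a) pair_class"  ("\<W>") where
  "\<W> = {(Z, M, N) \<in> closed_pairs.
     weakly_compact_operator (subspace_of Z M) (quotient_space Z N)
       (quotient_map Z N \<circ> inclusion M)}"

definition tauberian_pairs :: "('k::real_normed_field, 'a) pair_class"  ("\<W>\<^sub>+") where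
  "\<W>\<^sub>+ = {(Z, M, N) \<in> closed_pairs.
     tauberian (subspace_of Z M) (quotient_space Z N) (quotient_map Z N \<circ> inclusion M)}"

definition cotauberian_pairs :: "('k::real_normed_field, 'a) pair_class"  ("\<W>\<^sub>-") where
  "\<W>\<^sub>- = {(Z, M, N) \<in> closed_pairs.
     cotauberian (subspace_of Z M) (quotient_space Z N) (quotient_map Z N \<circ> inclusion M)}"

definition symmetric_class :: "('k::real_normed_field, 'a) pair_class \<Rightarrow> bool" where
  "symmetric_class D \<longleftrightarrow>
     (\<forall>Z M N. banach_space Z \<and> closed_subspace Z M \<and> closed_subspace Z N \<longrightarrow>
        ((Z, M, N) \<in> D \<longleftrightarrow> (Z, N, M) \<in> D))"

definition transitive_class :: "('k::real_normed_field, 'a) pair_class \<Rightarrow> bool" where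
  "transitive_class D \<longleftrightarrow>
     (\<forall>Z L M N. banach_space Z \<and>
        closed_subspace Z L \<and> closed_subspace Z M \<and> closed_subspace Z N \<longrightarrow>
        (Z, L, M) \<in> D \<and> (Z, M, N) \<in> D \<longrightarrow> (Z, L, N) \<in> D)"

definition left_stable ::
  "('k::real_normed_field, 'a) pair_class \<Rightarrow> ('k, 'a) pair_class \<Rightarrow> bool" where
  "left_stable D O' \<longleftrightarrow>
     (\<forall>Z L M N. banach_space Z \<and>
        closed_subspace Z L \<and> closed_subspace Z M \<and> closed_subspace Z N \<longrightarrow>
        (Z, L, M) \<in> O' \<and> (Z, M, N) \<in> D \<longrightarrow> (Z, L, N) \<in> D)"

definition right_stable ::
  "('k::real_normed_field, 'a) pair_class \<Rightarrow> ('k, 'a) pair_class \<Rightarrow> bool" where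
  "right_stable D O' \<longleftrightarrow>
     (\<forall>Z L M N. banach_space Z \<and>
        closed_subspace Z L \<and> closed_subspace Z M \<and> closed_subspace Z N \<longrightarrow>
        (Z, L, M) \<in> D \<and> (Z, M, N) \<in> O' \<longrightarrow> (Z, L, N) \<in> D)"

end

theory Submission
  imports Defs
begin

text \<open>Identify \<open>M\<^sup>*\<^sup>*\<close> with \<open>M\<^sup>\<bottom>\<^sup>\<bottom> \<subseteq> Z\<^sup>*\<^sup>*\<close> and \<open>(Z/N)\<^sup>*\<^sup>*\<close> with \<open>Z\<^sup>*\<^sup>*/N\<^sup>\<bottom>\<^sup>\<bottom>\<close>. Then \<open>(M, N)\<close> is
  tauberian iff \<open>M\<^sup>\<bottom>\<^sup>\<bottom> \<inter> (Z + N\<^sup>\<bottom>\<^sup>\<bottom>) \<subseteq> Z\<close>, which is symmetric in \<open>M\<close> and \<open>N\<close>, cotauberian iff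
  \<open>(N\<^sup>\<bottom>, M\<^sup>\<bottom>)\<close> is tauberian in \<open>Z\<^sup>*\<close>, and, by Gantmacher's theorem, weakly compact iff
  \<open>M\<^sup>\<bottom>\<^sup>\<bottom> \<subseteq> Z + N\<^sup>\<bottom>\<^sup>\<bottom>\<close>, a condition that passes to \<open>(N\<^sup>\<bottom>, M\<^sup>\<bottom>)\<close>. The positive assertions follow from
  these inclusions. The counterexamples are formed from the subspaces \<open>0\<close> and \<open>Z\<close> of \<open>Z
    = c\<^sub>0\<close>, since
  neither \<open>c\<^sub>0\<close> nor its dual is reflexive.\<close>

section \<open>The Hahn-Banach theorem\<close>

text \<open>The identifications are isomorphisms only: the dual of a subspace is not a set of
  functionals on Z, nor is the bidual of a quotient a quotient of Z**. Inclusions and quotient maps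
  therefore do not survive dualization. The proof replaces them by maps \<open>i\<close> and
  \<open>q\<close> in an exact sequence, with explicit norm constants, a notion that passes to
  duals; all three classes then become conditions on annihilators in iterated duals of Z. The
  condition M^perp^perp \<inter> (Z + N^perp^perp) \<subseteq> Z is symmetric because G = z + H with
  G and H in the two biannihilators can be rewritten as -H = z - G. Weak compactness concerns the
  closure of the image of the unit ball, and its link with S** needs two compactness arguments. If
  S** takes values in Y, the closure is covered by the image of the weak* compact ball of X**.
  Conversely, values of S**F at finitely many functionals are matched by a point of the closure (a
  nearest-point argument of Helly type), and the finite intersection property yields a point
  matching all of them.\<close>

text \<open>Real and complex scalars at once: the axioms are those needed to pass between a functional and
  its real part \<open>\<lambda>x. 1 \<bullet> f x\<close>.\<close>

class conj_field = real_normed_field + euclidean_space +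
  fixes conjugation :: "'a \<Rightarrow> 'a"
  assumes conjugation_add: "conjugation (a + b) = conjugation a + conjugation b"
    and conjugation_scaleR: "conjugation (r *\<^sub>R a) = r *\<^sub>R conjugation a"
    and conjugation_conjugation: "conjugation (conjugation a) = a"
    and norm_conjugation: "norm (conjugation a) = norm a"
    and inner_conjugation: "a \<bullet> b = 1 \<bullet> (conjugation a * b)"

instantiation real :: conj_field
begin
definition "conjugation (x::real) = x"
instance by standard (auto simp: conjugation_real_def)
end

instantiation complex :: conj_field
begin
definition "conjugation = cnj"
instance by standard (auto simp: conjugation_complex_def inner_complex_def scaleR_conv_of_real)
end

lemma conjugation_of_real_mult: "conjugation (of_real r * a) = of_real r * conjugation a"
  using conjugation_scaleR[of r a] by (simp add: scaleR_conv_of_real)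

lemma inner_one_le: "1 \<bullet> (a::'k::conj_field) \<le> norm a"
  using norm_cauchy_schwarz[of 1 a] by simp

section \<open>Arithmetic in a normed space carried by a set\<close>

context normed_space
begin

lemma ns_zero_add: "x \<in> ns_carrier X \<Longrightarrow> ns_add X (ns_zero X) x = x"
  using ns_add_commute[of "ns_zero X" x] ns_add_zero ns_zero_closed by simp

lemma ns_add_left_cancel:
  assumes "x \<in> ns_carrier X" "y \<in> ns_carrier X" "z \<in> ns_carrier X"
    and "ns_add X x y = ns_add X x z"
  shows "y = z"
proof -
  obtain x' where x': "x' \<in> ns_carrier X" "ns_add X x x' = ns_zero X"
    using ns_add_inverse assms(1) by blast
  then have inv: "ns_add X x' x = ns_zero X"
    using ns_add_commute assms(1) by simp
  have "ns_add X (ns_add X x' x) y = ns_add X (ns_add X x' x) z"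
    using ns_add_assoc[of x' x] assms x'(1) by simp
  then show ?thesis using inv assms ns_zero_add by simp
qed

lemma ns_scale_zero_left: "x \<in> ns_carrier X \<Longrightarrow> ns_scale X 0 x = ns_zero X"
  using ns_add_left_cancel[of "ns_scale X 0 x" "ns_scale X 0 x" "ns_zero X"]
    ns_scale_add_left[of x 0 0] ns_scale_closed[of x 0] ns_add_zero ns_zero_closed by simp

lemma ns_scale_zero_right: "ns_scale X c (ns_zero X) = ns_zero X"
  using ns_scale_scale[of "ns_zero X" c 0] ns_scale_zero_left[of "ns_zero X"] ns_zero_closed by simp

lemma ns_add_minus:
  assumes "x \<in> ns_carrier X"
  shows "ns_add X x (ns_scale X (- 1) x) = ns_zero X"
  using ns_scale_add_left[of x 1 "- 1"] ns_scale_one[of x] ns_scale_zero_left[of x] assms by simp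

lemma ns_minus_add:
  assumes "x \<in> ns_carrier X"
  shows "ns_add X (ns_scale X (- 1) x) x = ns_zero X"
  using ns_add_minus[of x] ns_add_commute[of x] ns_scale_closed assms by simp

lemma ns_minus_minus: "x \<in> ns_carrier X \<Longrightarrow> ns_scale X (- 1) (ns_scale X (- 1) x) = x"
  using ns_scale_scale[of x "- 1" "- 1"] ns_scale_one by simp

lemma ns_add_left_commute:
  assumes "x \<in> ns_carrier X" "y \<in> ns_carrier X" "z \<in> ns_carrier X"
  shows "ns_add X x (ns_add X y z) = ns_add X y (ns_add X x z)"
  using ns_add_assoc[of x y z] ns_add_assoc[of y x z] ns_add_commute[of x y] assms by simp

lemma ns_add_add:
  assumes "x \<in> ns_carrier X" "y \<in> ns_carrier X" "z \<in> ns_carrier X" "w \<in> ns_carrier X"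
  shows "ns_add X (ns_add X x y) (ns_add X z w) = ns_add X (ns_add X x z) (ns_add X y w)"
  using assms by (simp add: ns_add_assoc ns_add_left_commute[of y] ns_add_closed)

lemma ns_add_minus_cancel:
  assumes "x \<in> ns_carrier X" "y \<in> ns_carrier X"
  shows "ns_add X (ns_add X x (ns_scale X (- 1) y)) y = x"
  using assms by (simp add: ns_add_assoc ns_minus_add ns_scale_closed ns_add_zero)

lemma ns_add_minus_cancel':
  assumes "x \<in> ns_carrier X" "y \<in> ns_carrier X"
  shows "ns_add X y (ns_add X x (ns_scale X (- 1) y)) = x"
  using assms by (simp add: ns_add_left_commute[of y] ns_add_minus ns_scale_closed ns_add_zero)

lemma ns_diff_eq_zero:
  assumes "x \<in> ns_carrier X" "y \<in> ns_carrier X" "ns_add X x (ns_scale X (- 1) y) = ns_zero X"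
  shows "x = y"
  using ns_add_minus_cancel[OF assms(1,2)] assms(3) ns_zero_add[OF assms(2)] by simp

lemma ns_norm_zero: "ns_norm X (ns_zero X) = 0"
  using ns_norm_eq_zero ns_zero_closed by blast

lemma ns_norm_minus: "x \<in> ns_carrier X \<Longrightarrow> ns_norm X (ns_scale X (- 1) x) = ns_norm X x"
  using ns_norm_scale by simp

end

section \<open>Sublinear functionals and their linear minorants\<close>

definition sublinear :: "('k::real_normed_field, 'a) nspace \<Rightarrow> ('a \<Rightarrow> real) \<Rightarrow> bool" where
  "sublinear X q \<longleftrightarrow>
     (\<forall>x\<in>ns_carrier X. \<forall>y\<in>ns_carrier X. q (ns_add X x y) \<le> q x + q y) \<and>
     (\<forall>t\<ge>0. \<forall>x\<in>ns_carrier X. q (ns_scale X (of_real t) x) = t * q x)"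

lemma sublinearD:
  assumes "sublinear X q"
  shows "\<lbrakk>x \<in> ns_carrier X; y \<in> ns_carrier X\<rbrakk> \<Longrightarrow> q (ns_add X x y) \<le> q x + q y"
    and "\<lbrakk>0 \<le> t; x \<in> ns_carrier X\<rbrakk> \<Longrightarrow> q (ns_scale X (of_real t) x) = t * q x"
  using assms unfolding sublinear_def by auto

context normed_space
begin

lemma sublinear_zero: "sublinear X q \<Longrightarrow> q (ns_zero X) = 0"
  using sublinearD(2)[of X q 0 "ns_zero X"] ns_scale_zero_right ns_zero_closed by simp

lemma sublinear_minus:
  assumes "sublinear X q" "x \<in> ns_carrier X"
  shows "- q (ns_scale X (- 1) x) \<le> q x"
  using sublinearD(1)[OF assms(1), of x "ns_scale X (- 1) x"] sublinear_zero[OF assms(1)]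
    ns_add_minus ns_scale_closed assms(2) by simp

text \<open>The infimal convolution of a sublinear functional with a concave functional \<open>g\<close> on a convex
  cone. It serves twice: with a subspace to dominate a given functional, and with a ray to see that
  a minimal sublinear functional is linear.\<close>

lemma sublinear_convolution:
  assumes q: "sublinear X q"
    and C: "C \<subseteq> ns_carrier X" "ns_zero X \<in> C"
    and C_add: "\<And>c d. \<lbrakk>c \<in> C; d \<in> C\<rbrakk> \<Longrightarrow> ns_add X c d \<in> C"
    and C_scale: "\<And>t c. \<lbrakk>0 \<le> t; c \<in> C\<rbrakk> \<Longrightarrow> ns_scale X (of_real t) c \<in> C"
    and g_add: "\<And>c d. \<lbrakk>c \<in> C; d \<in> C\<rbrakk> \<Longrightarrow> g c + g d \<le> g (ns_add X c d)"
    and g_scale: "\<And>t c. \<lbrakk>0 \<le> t; c \<in> C\<rbrakk> \<Longrightarrow> g (ns_scale X (of_real t) c) = t * g c"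
    and g_le: "\<And>c. c \<in> C \<Longrightarrow> g c \<le> q c"
  obtains r where "sublinear X r" "\<And>x. x \<in> ns_carrier X \<Longrightarrow> r x \<le> q x"
    and "\<And>c. c \<in> C \<Longrightarrow> r (ns_scale X (- 1) c) \<le> - g c"
proof -
  define r where "r x = (INF c\<in>C. q (ns_add X x c) - g c)" for x
  \<comment> \<open>Finiteness of the infimum: \<open>g c \<le> q c\<close> and subadditivity of
    \<open>q\<close> bound every term by a number that does not depend on \<open>c\<close>.\<close>
  have lower: "- q (ns_scale X (- 1) x) \<le> q (ns_add X x c) - g c"
    if "x \<in> ns_carrier X" "c \<in> C" for x c
  proof -
    have c: "c \<in> ns_carrier X" using C that by auto
    have "q c \<le> q (ns_add X x c) + q (ns_scale X (- 1) x)"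
      using sublinearD(1)[OF q, of "ns_add X x c" "ns_scale X (- 1) x"] that(1) c
      by (simp add: ns_add_closed ns_scale_closed ns_add_commute[of x c] ns_add_assoc ns_add_minus
          ns_add_zero)
    then show ?thesis using g_le[OF that(2)] by simp
  qed
  have bdd: "bdd_below ((\<lambda>c. q (ns_add X x c) - g c) ` C)" if "x \<in> ns_carrier X" for x
    using lower[OF that] by (auto intro!: bdd_belowI)
  have le: "r x \<le> q (ns_add X x c) - g c" if "x \<in> ns_carrier X" "c \<in> C" for x c
    unfolding r_def using bdd that by (auto intro: cINF_lower)
  have ge: "b \<le> r x" if "\<And>c. c \<in> C \<Longrightarrow> b \<le> q (ns_add X x c) - g c" for b x
    unfolding r_def using that C(2) by (auto intro: cINF_greatest)
  have g0: "g (ns_zero X) = 0"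
    using g_scale[of 0 "ns_zero X"] C(2) by (simp add: ns_scale_zero_right)
  have "r (ns_add X x y) \<le> r x + r y" if x: "x \<in> ns_carrier X" and y: "y \<in> ns_carrier X" for x y
  proof -
    \<comment> \<open>The infima defining \<open>r x\<close> and \<open>r y\<close> have separate
      variables; \<open>c\<close> and \<open>d\<close> are kept apart here and then removed one at a
      time.\<close>
    have *: "r (ns_add X x y) \<le> (q (ns_add X x c) - g c) + (q (ns_add X y d) - g d)"
      if c: "c \<in> C" and d: "d \<in> C" for c d
    proof -
      have cd: "c \<in> ns_carrier X" "d \<in> ns_carrier X" using C c d by auto
      have "r (ns_add X x y) \<le> q (ns_add X (ns_add X x y) (ns_add X c d)) - g (ns_add X c d)"
        using le C_add c d x y ns_add_closed by simp
      also have "q (ns_add X (ns_add X x y) (ns_add X c d)) \<le> q (ns_add X x c) + q (ns_add X y d)"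
        using sublinearD(1)[OF q] ns_add_add[OF x y cd] x y cd by (simp add: ns_add_closed)
      finally show ?thesis using g_add[OF c d] by simp
    qed
    have "r (ns_add X x y) - (q (ns_add X x c) - g c) \<le> r y" if "c \<in> C" for c
      using *[OF that] by (intro ge) (simp add: algebra_simps)
    then have "r (ns_add X x y) - r y \<le> r x"
      by (intro ge) (simp add: algebra_simps)
    then show ?thesis by simp
  qed
  \<comment> \<open>For positive \<open>t\<close> one inequality suffices: the other follows by
    applying it to the vector t x with the factor \<open>1 / t\<close>.\<close>
  moreover have r_scale_le: "r (ns_scale X (of_real t) x) \<le> t * r x"
    if t: "0 < t" and x: "x \<in> ns_carrier X" for t x
  proof -
    have "r (ns_scale X (of_real t) x) / t \<le> q (ns_add X x c) - g c" if c: "c \<in> C" for c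
    proof -
      have c': "c \<in> ns_carrier X" using C c by auto
      have "r (ns_scale X (of_real t) x)
          \<le> q (ns_add X (ns_scale X (of_real t) x) (ns_scale X (of_real t) c))
            - g (ns_scale X (of_real t) c)"
        using le C_scale t x c ns_scale_closed by simp
      also have "\<dots> = t * (q (ns_add X x c) - g c)"
        using sublinearD(2)[OF q, of t "ns_add X x c"] g_scale[of t c] t c c' x
        by (simp add: ns_scale_add_right ns_add_closed algebra_simps)
      finally show ?thesis using t by (simp add: field_simps)
    qed
    then have "r (ns_scale X (of_real t) x) / t \<le> r x" by (rule ge)
    then show ?thesis using t by (simp add: field_simps)
  qed
  moreover have "r (ns_scale X (of_real t) x) = t * r x"
    if t: "0 \<le> t" and x: "x \<in> ns_carrier X" for t x
  proof (cases "t = 0")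
    case True
    have "r (ns_zero X) \<le> 0"
      using le[of "ns_zero X" "ns_zero X"] g0 sublinear_zero[OF q] C(2) ns_zero_closed ns_add_zero
      by simp
    moreover have "0 \<le> r (ns_zero X)"
      using lower[of "ns_zero X"] sublinear_zero[OF q] ns_zero_closed ns_scale_zero_right
      by (intro ge) simp
    ultimately show ?thesis using True x ns_scale_zero_left by simp
  next
    case False
    then have "0 < t" using t by simp
    moreover have "r x \<le> (1 / t) * r (ns_scale X (of_real t) x)"
      using r_scale_le[of "1 / t" "ns_scale X (of_real t) x"] \<open>0 < t\<close> x
      by (simp add: ns_scale_closed ns_scale_scale ns_scale_one flip: of_real_mult of_real_divide)
    ultimately show ?thesis using r_scale_le[of t x] x by (simp add: field_simps)
  qed
  ultimately have "sublinear X r" unfolding sublinear_def by auto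
  moreover have "r x \<le> q x" if "x \<in> ns_carrier X" for x
    using le[OF that C(2)] g0 that ns_add_zero by simp
  \<comment> \<open>The competitor in the infimum is \<open>c\<close> itself, since -c + c =
    0.\<close>
  moreover have "r (ns_scale X (- 1) c) \<le> - g c" if "c \<in> C" for c
    using le[of "ns_scale X (- 1) c" c] C that ns_minus_add sublinear_zero[OF q] ns_scale_closed
    by auto
  ultimately show thesis by (rule that)
qed

text \<open>Zorn's lemma for the reversed pointwise order. The pointwise infimum of a chain is
  finite because every member is bounded below at x by minus the value of \<open>q0\<close> at -x,
  and it is subadditive because of two members of a chain one lies below the other
  everywhere.\<close>

lemma minimal_sublinear:
  assumes q0: "sublinear X q0"
  obtains q where "sublinear X q" "\<And>x. x \<in> ns_carrier X \<Longrightarrow> q x \<le> q0 x"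
    and "\<And>r x. \<lbrakk>sublinear X r; \<And>x. x \<in> ns_carrier X \<Longrightarrow> r x \<le> q x; x \<in> ns_carrier X\<rbrakk>
           \<Longrightarrow> r x = q x"
proof -
  \<comment> \<open>Extensional functions make the pointwise order on the carrier
    antisymmetric.\<close>
  define S where "S = {q \<in> extensional (ns_carrier X). sublinear X q \<and> (\<forall>x\<in>ns_carrier X. q x
    \<le> q0 x)}"
  define P :: "('a \<Rightarrow> real) \<Rightarrow> ('a \<Rightarrow> real) \<Rightarrow> bool"
    where "P f g \<longleftrightarrow> (\<forall>x\<in>ns_carrier X. g x \<le> f x)" for f g
  have restrict: "sublinear X (restrict q (ns_carrier X))" if "sublinear X q" for q
    using that unfolding sublinear_def by (simp add: ns_add_closed ns_scale_closed)
  have "\<exists>m\<in>S. \<forall>a\<in>S. P m a \<longrightarrow> a = m"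
  proof (rule predicate_Zorn)
    show "partial_order_on S (relation_of P S)"
      by (rule partial_order_on_relation_ofI)
        (auto simp: P_def S_def intro: order.trans intro!: extensionalityI[of _ "ns_carrier X"] order.antisym[of "x :: real" for x])
  next
    fix C assume C: "C \<in> Chains (relation_of P S)"
    then have C_S: "C \<subseteq> S" and
      chain: "\<And>q r. \<lbrakk>q \<in> C; r \<in> C\<rbrakk> \<Longrightarrow> P q r \<or> P r q"
      by (auto simp: Chains_def relation_of_def)
    show "\<exists>u\<in>S. \<forall>a\<in>C. P a u"
    proof (cases "C = {}")
      case True
      have "restrict q0 (ns_carrier X) \<in> S" using q0 restrict unfolding S_def by simp
      then show ?thesis using True by blast
    next
      case False
      define u where "u x = (INF q\<in>C. q x)" for x
      have sub: "sublinear X q" "\<And>x. x \<in> ns_carrier X \<Longrightarrow> q x \<le> q0 x" if "q \<in> C" for q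
        using that C_S unfolding S_def by auto
      have bdd: "bdd_below ((\<lambda>q. q x) ` C)" if x: "x \<in> ns_carrier X" for x
      proof (rule bdd_belowI2)
        fix q assume "q \<in> C"
        then show "- q0 (ns_scale X (- 1) x) \<le> q x"
          using sublinear_minus[OF sub(1) x, of q] sub(2)[of q "ns_scale X (- 1) x"]
            ns_scale_closed[OF x, of "- 1"] by linarith
      qed
      have le: "u x \<le> q x" if "x \<in> ns_carrier X" "q \<in> C" for x q
        unfolding u_def using bdd that by (auto intro: cINF_lower)
      have ge: "b \<le> u x" if "\<And>q. q \<in> C \<Longrightarrow> b \<le> q x" for b x
        unfolding u_def using that False by (auto intro: cINF_greatest)
      have "u (ns_add X x y) \<le> u x + u y" if x: "x \<in> ns_carrier X" and y: "y \<in> ns_carrier X" for x y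
      proof -
        have *: "u (ns_add X x y) \<le> q x + r y" if q: "q \<in> C" and r: "r \<in> C" for q r
        proof -
          obtain s where s: "s \<in> C" "s x \<le> q x" "s y \<le> r y"
            using chain[OF q r] q r x y unfolding P_def by blast
          have "u (ns_add X x y) \<le> s (ns_add X x y)" using le s(1) x y ns_add_closed by simp
          also have "\<dots> \<le> s x + s y" using sublinearD(1)[OF sub(1)[OF s(1)] x y] .
          finally show ?thesis using s by simp
        qed
        have "u (ns_add X x y) - q x \<le> u y" if "q \<in> C" for q
          using *[OF that] by (intro ge) (simp add: algebra_simps)
        then have "u (ns_add X x y) - u y \<le> u x"
          by (intro ge) (simp add: algebra_simps)
        then show ?thesis by simp
      qed
      moreover have "u (ns_scale X (of_real t) x) = t * u x"
        if t: "0 \<le> t" and x: "x \<in> ns_carrier X" for t x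
      proof (cases "t = 0")
        case True
        obtain q where "q \<in> C" using False by blast
        have "(\<lambda>q. q (ns_zero X)) ` C = {0}"
          using False sublinear_zero[OF sub(1)] by (auto simp: image_iff)
        then show ?thesis using True x ns_scale_zero_left unfolding u_def by simp
      next
        case False
        have scale: "q (ns_scale X (of_real t) x) = t * q x" if "q \<in> C" for q
          using sublinearD(2)[OF sub(1)[OF that] t x] .
        have "u (ns_scale X (of_real t) x) / t \<le> u x"
          using le[of "ns_scale X (of_real t) x"] scale x t False
          by (intro ge) (simp add: ns_scale_closed field_simps)
        moreover have "t * u x \<le> u (ns_scale X (of_real t) x)"
        proof (rule ge)
          fix q assume "q \<in> C"
          then show "t * u x \<le> q (ns_scale X (of_real t) x)"
            unfolding scale[OF \<open>q \<in> C\<close>] using le[OF x] t by (intro mult_left_mono)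
        qed
        ultimately show ?thesis using t False by (simp add: field_simps)
      qed
      ultimately have "sublinear X u" unfolding sublinear_def by auto
      moreover have "u x \<le> q0 x" if "x \<in> ns_carrier X" for x
        using False le[OF that] sub(2)[OF _ that] by (meson all_not_in_conv order.trans)
      ultimately have "restrict u (ns_carrier X) \<in> S" using restrict unfolding S_def by simp
      then show ?thesis using le unfolding P_def by (intro bexI) auto
    qed
  qed
  then obtain q where q: "q \<in> S" and min: "\<And>r. \<lbrakk>r \<in> S; P q r\<rbrakk> \<Longrightarrow> r = q" by blast
  show thesis
  proof (rule that)
    show "sublinear X q" "\<And>x. x \<in> ns_carrier X \<Longrightarrow> q x \<le> q0 x" using q unfolding S_def by auto
    fix r x assume r: "sublinear X r" "\<And>x. x \<in> ns_carrier X \<Longrightarrow> r x \<le> q x" and x: "x \<in> ns_carrier X"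
    have "restrict r (ns_carrier X) \<in> S"
      using r q restrict unfolding S_def by (auto intro: order.trans)
    then have "restrict r (ns_carrier X) = q" using r(2) by (intro min) (simp_all add: P_def)
    then show "r x = q x" using x by auto
  qed
qed

text \<open>A minimal sublinear functional is odd, hence additive: otherwise its convolution with the
  ray through \<open>y\<close> would be strictly smaller at \<open>-y\<close>.\<close>

lemma linear_below_sublinear:
  assumes q0: "sublinear X q0"
  obtains u where "\<And>x. x \<in> ns_carrier X \<Longrightarrow> u x \<le> q0 x"
    and "\<And>x y. \<lbrakk>x \<in> ns_carrier X; y \<in> ns_carrier X\<rbrakk> \<Longrightarrow> u (ns_add X x y) = u x + u y"
    and "\<And>t x. x \<in> ns_carrier X \<Longrightarrow> u (ns_scale X (of_real t) x) = t * u x"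
proof -
  obtain q where q: "sublinear X q" "\<And>x. x \<in> ns_carrier X \<Longrightarrow> q x \<le> q0 x"
    and min: "\<And>r x. \<lbrakk>sublinear X r; \<And>x. x \<in> ns_carrier X \<Longrightarrow> r x \<le> q x; x \<in> ns_carrier X\<rbrakk>
           \<Longrightarrow> r x = q x"
    using minimal_sublinear[OF q0] by blast
  have odd: "q (ns_scale X (- 1) y) = - q y" if y: "y \<in> ns_carrier X" for y
  proof -
    \<comment> \<open>On a ray \<open>q\<close> is additive, so it may itself serve as the concave
      functional of the convolution; the generator t = 1 then yields the estimate at -y.\<close>
    define C where "C = (\<lambda>t. ns_scale X (of_real t) y) ` {0..}"
    obtain r where r: "sublinear X r" "\<And>x. x \<in> ns_carrier X \<Longrightarrow> r x \<le> q x"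
      "\<And>c. c \<in> C \<Longrightarrow> r (ns_scale X (- 1) c) \<le> - q c"
    proof (rule sublinear_convolution[OF q(1), of C q])
      show "C \<subseteq> ns_carrier X" unfolding C_def using y ns_scale_closed by auto
      have "ns_scale X (of_real 0) y \<in> C" unfolding C_def by (rule imageI) simp
      then show "ns_zero X \<in> C" using y ns_scale_zero_left by simp
      show "ns_add X c d \<in> C" "q c + q d \<le> q (ns_add X c d)" if C: "c \<in> C" "d \<in> C" for c d
      proof -
        obtain s t where st: "0 \<le> s" "0 \<le> t"
          "c = ns_scale X (of_real s) y" "d = ns_scale X (of_real t) y"
          using C unfolding C_def by auto
        have cd: "ns_add X c d = ns_scale X (of_real (s + t)) y"
          using st y ns_scale_add_left by simp
        show "ns_add X c d \<in> C" unfolding cd C_def using st by (intro imageI) simp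
        show "q c + q d \<le> q (ns_add X c d)"
          unfolding cd
            using st sublinearD(2)[OF q(1) _ y] by (simp add: algebra_simps del: of_real_add)
      qed
      show "ns_scale X (of_real t) c \<in> C" "q (ns_scale X (of_real t) c) = t * q c"
        if C: "0 \<le> t" "c \<in> C" for t c
      proof -
        obtain s where s: "0 \<le> s" "c = ns_scale X (of_real s) y" using C unfolding C_def by auto
        have "ns_scale X (of_real t) c = ns_scale X (of_real (t * s)) y"
          using s y ns_scale_scale by simp
        then show "ns_scale X (of_real t) c \<in> C" unfolding C_def
          using s C(1) by (intro image_eqI[of _ _ "t * s"]) auto
        show "q (ns_scale X (of_real t) c) = t * q c"
          using sublinearD(2)[OF q(1)] C(1) s y ns_scale_closed by simp
      qed
    qed auto
    have "ns_scale X (of_real 1) y \<in> C" unfolding C_def by (rule imageI) simp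
    then have "r (ns_scale X (- 1) y) \<le> - q y" using r(3) y ns_scale_one by simp
    moreover have "r (ns_scale X (- 1) y) = q (ns_scale X (- 1) y)"
      using min r(1,2) y ns_scale_closed by blast
    ultimately show ?thesis using sublinear_minus[OF q(1) y] by simp
  qed
  show thesis
  proof (rule that)
    show "q x \<le> q0 x" if "x \<in> ns_carrier X" for x using q(2) that .
    show "q (ns_add X x y) = q x + q y" if "x \<in> ns_carrier X" "y \<in> ns_carrier X" for x y
    proof -
      have "q x \<le> q (ns_add X x y) + q (ns_scale X (- 1) y)"
        using sublinearD(1)[OF q(1), of "ns_add X x y" "ns_scale X (- 1) y"] that
        by (simp add: ns_add_assoc ns_add_closed ns_scale_closed ns_add_minus ns_add_zero)
      then show ?thesis using sublinearD(1)[OF q(1) that] odd[OF that(2)] by simp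
    qed
    show "q (ns_scale X (of_real t) x) = t * q x" if x: "x \<in> ns_carrier X" for t x
    proof (cases "0 \<le> t")
      case True
      then show ?thesis using sublinearD(2)[OF q(1) _ x] by simp
    next
      case False
      then have "q (ns_scale X (of_real (- t)) x) = - t * q x"
        using sublinearD(2)[OF q(1), of "- t" x] x by simp
      moreover have "q (ns_scale X (of_real t) x) = - q (ns_scale X (of_real (- t)) x)"
        using odd[of "ns_scale X (of_real (- t)) x"] x by (simp add: ns_scale_closed ns_scale_scale)
      ultimately show ?thesis by simp
    qed
  qed
qed

end

section \<open>The dual space and its norm\<close>

lemma scalar_space_simps [simp]:
  "ns_carrier scalar_space = UNIV" "ns_zero scalar_space = 0" "ns_add scalar_space = (+)"
  "ns_scale scalar_space = (*)" "ns_norm scalar_space = norm"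
  unfolding scalar_space_def by simp_all

lemma normed_space_scalar_space: "normed_space (scalar_space :: ('k::real_normed_field, 'k) nspace)"
proof
  show "\<exists>y\<in>ns_carrier scalar_space. ns_add scalar_space x y = ns_zero scalar_space" for x :: 'k
    by (intro bexI[of _ "- x"]) auto
qed (auto simp: algebra_simps norm_mult norm_triangle_ineq)

lemma bounded_operator_scalar_iff:
  "bounded_operator X scalar_space f \<longleftrightarrow>
     (\<forall>x\<in>ns_carrier X. \<forall>y\<in>ns_carrier X. f (ns_add X x y) = f x + f y) \<and>
     (\<forall>c. \<forall>x\<in>ns_carrier X. f (ns_scale X c x) = c * f x) \<and>
     (\<exists>K. \<forall>x\<in>ns_carrier X. norm (f x) \<le> K * ns_norm X x)"
  unfolding bounded_operator_def by simp

lemma dual_simps [simp]: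
  "ns_zero (dual X) = (\<lambda>x\<in>ns_carrier X. 0)"
  "ns_add (dual X) f g = (\<lambda>x\<in>ns_carrier X. f x + g x)"
  "ns_scale (dual X) c f = (\<lambda>x\<in>ns_carrier X. c * f x)"
  unfolding dual_def by simp_all

lemma dualI:
  assumes "\<And>x. x \<notin> ns_carrier X \<Longrightarrow> f x = undefined"
    and "\<And>x y. \<lbrakk>x \<in> ns_carrier X; y \<in> ns_carrier X\<rbrakk> \<Longrightarrow> f (ns_add X x y) = f x + f y"
    and "\<And>c x. x \<in> ns_carrier X \<Longrightarrow> f (ns_scale X c x) = c * f x"
    and "\<And>x. x \<in> ns_carrier X \<Longrightarrow> norm (f x) \<le> K * ns_norm X x"
  shows "f \<in> ns_carrier (dual X)"
  using assms unfolding dual_def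
    by (auto simp: bounded_operator_scalar_iff extensional_def intro!: exI[of _ K])

lemma dualD:
  assumes "f \<in> ns_carrier (dual X)"
  shows "\<lbrakk>x \<in> ns_carrier X; y \<in> ns_carrier X\<rbrakk> \<Longrightarrow> f (ns_add X x y) = f x + f y"
    and "x \<in> ns_carrier X \<Longrightarrow> f (ns_scale X c x) = c * f x"
    and "f \<in> extensional (ns_carrier X)"
  using assms unfolding dual_def by (auto simp: bounded_operator_scalar_iff)

lemma dual_eqI:
  assumes "f \<in> ns_carrier (dual X)" "g \<in> ns_carrier (dual X)"
    and "\<And>x. x \<in> ns_carrier X \<Longrightarrow> f x = g x"
  shows "f = g"
  using assms dualD(3) by (blast intro: extensionalityI)

context normed_space
begin

lemma dual_diff:
  assumes "f \<in> ns_carrier (dual X)" "x \<in> ns_carrier X" "y \<in> ns_carrier X"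
  shows "f (ns_add X x (ns_scale X (- 1) y)) = f x - f y"
  using dualD(1)[OF assms(1,2) ns_scale_closed[OF assms(3)]] dualD(2)[OF assms(1,3)] by simp

lemma dual_zero: "f \<in> ns_carrier (dual X) \<Longrightarrow> f (ns_zero X) = 0"
  using dualD(2)[of f X "ns_zero X" 0] ns_scale_zero_right ns_zero_closed by simp

lemma dual_norm_bdd:
  assumes "f \<in> ns_carrier (dual X)"
  shows "bdd_above ((\<lambda>x. norm (f x)) ` unit_ball X)"
proof -
  obtain K where K: "\<And>x. x \<in> ns_carrier X \<Longrightarrow> norm (f x) \<le> K * ns_norm X x"
    using assms unfolding dual_def bounded_operator_scalar_iff by fastforce
  \<comment> \<open>The constant of a bounded operator may be negative, hence the absolute
    value.\<close>
  have "norm (f x) \<le> \<bar>K\<bar>" if "x \<in> unit_ball X" for x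
  proof -
    have x: "x \<in> ns_carrier X" "ns_norm X x \<le> 1" using that unfolding unit_ball_def by auto
    have "norm (f x) \<le> K * ns_norm X x" using K x by blast
    also have "\<dots> \<le> \<bar>K\<bar> * 1" using x ns_norm_nonneg by (intro mult_mono) auto
    finally show ?thesis by simp
  qed
  then show ?thesis by (rule bdd_aboveI2)
qed

lemma zero_in_unit_ball: "ns_zero X \<in> unit_ball X"
  unfolding unit_ball_def using ns_zero_closed ns_norm_zero by simp

lemma dual_norm_nonneg:
  assumes "f \<in> ns_carrier (dual X)"
  shows "0 \<le> ns_norm (dual X) f"
  using cSUP_upper2[OF dual_norm_bdd[OF assms] zero_in_unit_ball norm_ge_zero]
  unfolding dual_def by simp

lemma unit_vector:
  assumes "x \<in> ns_carrier X" "x \<noteq> ns_zero X"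
  obtains e where "e \<in> unit_ball X" "x = ns_scale X (of_real (ns_norm X x)) e"
proof
  have pos: "ns_norm X x > 0" using assms ns_norm_nonneg ns_norm_eq_zero by force
  let ?e = "ns_scale X (of_real (1 / ns_norm X x)) x"
  show "?e \<in> unit_ball X"
    unfolding unit_ball_def
      using assms pos ns_scale_closed ns_norm_scale by (simp del: of_real_divide)
  show "x = ns_scale X (of_real (ns_norm X x)) ?e"
    using assms pos ns_scale_one by (simp add: ns_scale_scale)
qed

lemma dual_bound:
  assumes f: "f \<in> ns_carrier (dual X)" and x: "x \<in> ns_carrier X"
  shows "norm (f x) \<le> ns_norm (dual X) f * ns_norm X x"
proof (cases "x = ns_zero X")
  case True
  then show ?thesis using dual_zero[OF f] ns_norm_zero by simp
next
  case False
  then obtain e where e: "e \<in> unit_ball X" "x = ns_scale X (of_real (ns_norm X x)) e"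
    using unit_vector x by blast
  have "f x = of_real (ns_norm X x) * f e"
    using e dualD(2)[OF f, of e "of_real (ns_norm X x)"] unfolding unit_ball_def by simp
  moreover have "norm (f e) \<le> ns_norm (dual X) f"
    unfolding dual_def using cSUP_upper[OF e(1) dual_norm_bdd[OF f]] by simp
  ultimately show ?thesis
    using ns_norm_nonneg[OF x] by (simp add: norm_mult mult_left_mono mult.commute)
qed

lemma dual_bound_unit_ball:
  assumes "f \<in> ns_carrier (dual X)" "x \<in> unit_ball X"
  shows "norm (f x) \<le> ns_norm (dual X) f"
  unfolding dual_def using cSUP_upper[OF assms(2) dual_norm_bdd[OF assms(1)]] by simp

lemma dual_norm_le:
  assumes "\<And>x. x \<in> ns_carrier X \<Longrightarrow> norm (f x) \<le> K * ns_norm X x" "0 \<le> K"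
  shows "ns_norm (dual X) f \<le> K"
proof -
  have "norm (f x) \<le> K" if "x \<in> unit_ball X" for x
    using assms(1)[of x] that mult_left_le[OF _ assms(2), of "ns_norm X x"]
    unfolding unit_ball_def by force
  then have "(SUP x\<in>unit_ball X. norm (f x)) \<le> K"
    using zero_in_unit_ball by (intro cSUP_least) auto
  then show ?thesis unfolding dual_def by simp
qed

lemma dual_zero_closed: "(\<lambda>x\<in>ns_carrier X. 0) \<in> ns_carrier (dual X)"
  by (rule dualI[where K = 0]) (auto simp: ns_add_closed ns_scale_closed)

lemma dual_add_closed:
  assumes f: "f \<in> ns_carrier (dual X)" and g: "g \<in> ns_carrier (dual X)"
  shows "(\<lambda>x\<in>ns_carrier X. f x + g x) \<in> ns_carrier (dual X)"
proof (rule dualI)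
  fix x assume x: "x \<in> ns_carrier X"
  have "norm (f x + g x) \<le> norm (f x) + norm (g x)" by (rule norm_triangle_ineq)
  also have "\<dots> \<le> (ns_norm (dual X) f + ns_norm (dual X) g) * ns_norm X x"
    using dual_bound[OF f x] dual_bound[OF g x] by (simp add: algebra_simps)
  finally show "norm ((\<lambda>x\<in>ns_carrier X. f x + g x) x)
      \<le> (ns_norm (dual X) f + ns_norm (dual X) g) * ns_norm X x"
    using x by simp
qed (use dualD(1,2)[OF f] dualD(1,2)[OF g] in \<open>auto simp: ns_add_closed ns_scale_closed algebra_simps\<close>)

lemma dual_scale_closed:
  assumes f: "f \<in> ns_carrier (dual X)"
  shows "(\<lambda>x\<in>ns_carrier X. c * f x) \<in> ns_carrier (dual X)"
proof (rule dualI)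
  fix x assume x: "x \<in> ns_carrier X"
  show "norm ((\<lambda>x\<in>ns_carrier X. c * f x) x) \<le> (norm c * ns_norm (dual X) f) * ns_norm X x"
    using dual_bound[OF f x] x by (simp add: norm_mult mult.assoc mult_left_mono)
qed (use dualD(1,2)[OF f] in \<open>auto simp: ns_add_closed ns_scale_closed algebra_simps\<close>)

lemma normed_space_dual: "normed_space (dual X)"
proof (unfold_locales)
  fix f g :: "'a \<Rightarrow> 'k" and c d :: 'k
  assume f: "f \<in> ns_carrier (dual X)"
  note ext = dualD(3)[OF f]
  show "ns_norm (dual X) f = 0 \<longleftrightarrow> f = ns_zero (dual X)"
  proof
    assume "ns_norm (dual X) f = 0"
    then have "f x = 0" if "x \<in> ns_carrier X" for x using dual_bound[OF f that] by simp
    then show "f = ns_zero (dual X)" using f dual_zero_closed by (auto intro: dual_eqI)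
  next
    assume "f = ns_zero (dual X)"
    then have "ns_norm (dual X) f \<le> 0" by (intro dual_norm_le) auto
    then show "ns_norm (dual X) f = 0" using dual_norm_nonneg[OF f] by simp
  qed
  show "\<exists>g\<in>ns_carrier (dual X). ns_add (dual X) f g = ns_zero (dual X)"
    using dual_scale_closed[OF f, of "- 1"] by (intro bexI) (auto intro!: restrict_ext)
  show le: "ns_norm (dual X) (ns_scale (dual X) c f) = norm c * ns_norm (dual X) f"
  proof (rule antisym)
    have le: "ns_norm (dual X) (\<lambda>x\<in>ns_carrier X. c * f x) \<le> norm c * ns_norm (dual X) f"
      if "f \<in> ns_carrier (dual X)" for f c
      using dual_bound[OF that] dual_norm_nonneg[OF that]
      by (intro dual_norm_le) (simp_all add: norm_mult mult.assoc mult_left_mono)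
    then show "ns_norm (dual X) (ns_scale (dual X) c f) \<le> norm c * ns_norm (dual X) f"
      using f by simp
    show "norm c * ns_norm (dual X) f \<le> ns_norm (dual X) (ns_scale (dual X) c f)"
    proof (cases "c = 0")
      case True
      then show ?thesis using dual_norm_nonneg[OF dual_scale_closed[OF f, of c]] by simp
    next
      case False
      \<comment> \<open>The reverse inequality is the one just proved, applied to c f and the scalar
        \<open>1 / c\<close>.\<close>
      let ?g = "\<lambda>x\<in>ns_carrier X. c * f x"
      have "f = (\<lambda>x\<in>ns_carrier X. (1 / c) * ?g x)"
        using False ext by (intro extensionalityI[of _ "ns_carrier X"]) auto
      then have "ns_norm (dual X) f \<le> norm (1 / c) * ns_norm (dual X) ?g"
        using le[OF dual_scale_closed[OF f, of c], of "1 / c"] by simp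
      then show ?thesis using False by (simp add: norm_divide field_simps)
    qed
  qed
  assume g: "g \<in> ns_carrier (dual X)"
  show "ns_norm (dual X) (ns_add (dual X) f g) \<le> ns_norm (dual X) f + ns_norm (dual X) g"
  proof (rule dual_norm_le)
    fix x assume x: "x \<in> ns_carrier X"
    have "norm (f x + g x) \<le> norm (f x) + norm (g x)" by (rule norm_triangle_ineq)
    also have "\<dots> \<le> (ns_norm (dual X) f + ns_norm (dual X) g) * ns_norm X x"
      using dual_bound[OF f x] dual_bound[OF g x] by (simp add: algebra_simps)
    finally show "norm (ns_add (dual X) f g x)
        \<le> (ns_norm (dual X) f + ns_norm (dual X) g) * ns_norm X x"
      using x by simp
  qed (use dual_norm_nonneg f g in simp)
qed (auto simp: dual_zero_closed dual_add_closed dual_scale_closed dual_norm_nonneg algebra_simps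
    dest: dualD(3) intro!: extensionalityI[of _ "ns_carrier X"])

end

section \<open>The canonical embedding and extension of functionals\<close>

lemma canonical_embedding_apply [simp]:
  "\<lbrakk>x \<in> ns_carrier X; f \<in> ns_carrier (dual X)\<rbrakk> \<Longrightarrow> canonical_embedding X x f = f x"
  unfolding canonical_embedding_def by simp

lemma canonical_embedding_closed:
  assumes "normed_space X" "x \<in> ns_carrier X"
  shows "canonical_embedding X x \<in> ns_carrier (bidual X)"
proof -
  interpret normed_space X by fact
  show ?thesis
    by (rule dualI[where K = "ns_norm X x"])
      (use assms dual_bound in \<open>auto simp: canonical_embedding_def dual_add_closed dual_scale_closed
        mult.commute[of "ns_norm X x"]\<close>)
qed

lemma bidual_eq_canonical_iff:
  assumes "normed_space X" "G \<in> ns_carrier (bidual X)" "x \<in> ns_carrier X"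
  shows "G = canonical_embedding X x \<longleftrightarrow> (\<forall>f\<in>ns_carrier (dual X). G f = f x)"
  using dual_eqI[OF assms(2) canonical_embedding_closed[OF assms(1,3)]] assms(3) by auto

lemma bidual_in_canonical_iff:
  assumes "normed_space X" "G \<in> ns_carrier (bidual X)"
  shows "G \<in> canonical_embedding X ` ns_carrier X \<longleftrightarrow>
     (\<exists>x\<in>ns_carrier X. \<forall>f\<in>ns_carrier (dual X). G f = f x)"
  using bidual_eq_canonical_iff[OF assms] by (auto simp: image_iff)

text \<open>A functional over \<open>'k\<close> is recovered from its real part \<open>u\<close> by the formula
  \<open>a \<bullet> f z = u (conjugation a \<cdot> z)\<close>.\<close>

lemma hahn_banach:
  fixes X :: "('k::conj_field, 'a) nspace" and Z :: "('k, 'b) nspace"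
  assumes "normed_space X" "normed_space Z"
    and i: "i ` ns_carrier X \<subseteq> ns_carrier Z"
    and i_add: "\<And>x y. \<lbrakk>x \<in> ns_carrier X; y \<in> ns_carrier X\<rbrakk> \<Longrightarrow> i (ns_add X x y)
      = ns_add Z (i x) (i y)"
    and i_scale: "\<And>a x. x \<in> ns_carrier X \<Longrightarrow> i (ns_scale X a x) = ns_scale Z a (i x)"
    and g_add: "\<And>x y. \<lbrakk>x \<in> ns_carrier X; y \<in> ns_carrier X\<rbrakk> \<Longrightarrow> g (ns_add X x y) = g x + g y"
    and g_scale: "\<And>a x. x \<in> ns_carrier X \<Longrightarrow> g (ns_scale X a x) = a * g x"
    and g_le: "\<And>x. x \<in> ns_carrier X \<Longrightarrow> norm (g x) \<le> c * ns_norm Z (i x)"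
    and c: "0 \<le> c"
  obtains f where "f \<in> ns_carrier (dual Z)" "\<And>x. x \<in> ns_carrier X \<Longrightarrow> f (i x) = g x"
    "ns_norm (dual Z) f \<le> c"
proof -
  interpret X: normed_space X by fact
  interpret Z: normed_space Z by fact
  define p where "p z = c * ns_norm Z z" for z
  have p: "sublinear Z p"
    unfolding sublinear_def p_def
    using Z.ns_norm_triangle c
      by (auto simp: Z.ns_norm_scale mult_left_mono simp flip: distrib_left)
  define C where "C = i ` ns_carrier X"
  \<comment> \<open>The real part of \<open>g\<close>, carried over to the range of \<open>i\<close>
    by choosing a preimage. The bound on \<open>g\<close> forces equal values at preimages of the
    same point, as \<open>i_eq\<close> records.\<close>
  define h where "h z = 1 \<bullet> g (SOME x. x \<in> ns_carrier X \<and> i x = z)" for z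
  have i_closed: "i x \<in> ns_carrier Z" if "x \<in> ns_carrier X" for x using i that by auto
  have i_eq: "g x = g y" if "x \<in> ns_carrier X" "y \<in> ns_carrier X" "i x = i y" for x y
  proof -
    let ?d = "ns_add X x (ns_scale X (- 1) y)"
    have "i ?d = ns_zero Z"
      using that i_closed by (simp add: i_add i_scale X.ns_scale_closed Z.ns_add_minus)
    then have "norm (g ?d) \<le> 0"
      using g_le[of ?d] that by (simp add: X.ns_add_closed X.ns_scale_closed Z.ns_norm_zero)
    then show ?thesis using that by (simp add: g_add g_scale X.ns_scale_closed)
  qed
  have h: "h (i x) = 1 \<bullet> g x" if "x \<in> ns_carrier X" for x
  proof -
    have "\<exists>y. y \<in> ns_carrier X \<and> i y = i x" using that by blast
    from someI_ex[OF this] show ?thesis unfolding h_def using i_eq that by metis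
  qed
  obtain r where r: "sublinear Z r" "\<And>x. x \<in> ns_carrier Z \<Longrightarrow> r x \<le> p x"
    "\<And>y. y \<in> C \<Longrightarrow> r (ns_scale Z (- 1) y) \<le> - h y"
  proof (rule Z.sublinear_convolution[OF p, of C h])
    show "C \<subseteq> ns_carrier Z" using i unfolding C_def .
    have "i (ns_zero X) = ns_zero Z"
      using i_scale[of "ns_zero X" 0] X.ns_zero_closed i_closed
      by (simp add: X.ns_scale_zero_left Z.ns_scale_zero_left)
    then show "ns_zero Z \<in> C" unfolding C_def using X.ns_zero_closed by force
    fix y z assume "y \<in> C" "z \<in> C"
    then obtain x x' where x: "x \<in> ns_carrier X" "x' \<in> ns_carrier X" "y = i x" "z = i x'"
      unfolding C_def by auto
    have yz: "ns_add Z y z = i (ns_add X x x')" using x i_add by simp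
    show "ns_add Z y z \<in> C" unfolding yz C_def using x X.ns_add_closed by simp
    show "h y + h z \<le> h (ns_add Z y z)"
      unfolding yz using x h X.ns_add_closed g_add by (simp add: inner_add_right)
  next
    fix t :: real and y assume "0 \<le> t" "y \<in> C"
    then obtain x where x: "x \<in> ns_carrier X" "y = i x" unfolding C_def by auto
    have ty: "ns_scale Z (of_real t) y = i (ns_scale X (of_real t) x)" using x i_scale by simp
    show "ns_scale Z (of_real t) y \<in> C" unfolding ty C_def using x X.ns_scale_closed by simp
    show "h (ns_scale Z (of_real t) y) = t * h y"
      unfolding ty using x h X.ns_scale_closed g_scale by (simp flip: scaleR_conv_of_real)
  next
    fix y assume "y \<in> C"
    then obtain x where x: "x \<in> ns_carrier X" "y = i x" unfolding C_def by auto
    show "h y \<le> p y" using h g_le[of x] inner_one_le[of "g x"] x unfolding p_def by simp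
  qed auto
  obtain u where u_le: "\<And>z. z \<in> ns_carrier Z \<Longrightarrow> u z \<le> r z"
    and u_add: "\<And>z w. \<lbrakk>z \<in> ns_carrier Z; w \<in> ns_carrier Z\<rbrakk> \<Longrightarrow> u (ns_add Z z w) = u z + u w"
    and u_scale: "\<And>t z. z \<in> ns_carrier Z \<Longrightarrow> u (ns_scale Z (of_real t) z) = t * u z"
    using Z.linear_below_sublinear[OF r(1)] by blast
  have u_minus: "u (ns_scale Z (- 1) z) = - u z" if "z \<in> ns_carrier Z" for z
    using u_scale[OF that, of "- 1"] by simp
  \<comment> \<open>The convolution controls \<open>u\<close> from above at the negative of
    \<open>i x\<close>, hence from below at \<open>i x\<close>. Applied to -x as well, this gives
    equality.\<close>
  have u_ge: "1 \<bullet> g x \<le> u (i x)" if "x \<in> ns_carrier X" for x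
  proof -
    have "u (ns_scale Z (- 1) (i x)) \<le> - h (i x)"
      using u_le[of "ns_scale Z (- 1) (i x)"] r(3)[of "i x"] that i_closed Z.ns_scale_closed
      unfolding C_def by (auto intro: order.trans)
    then show ?thesis using h that u_minus i_closed by simp
  qed
  have u_eq: "u (i x) = 1 \<bullet> g x" if x: "x \<in> ns_carrier X" for x
    using u_ge[OF x] u_ge[of "ns_scale X (- 1) x"] X.ns_scale_closed[OF x] u_minus i_closed[OF x]
    by (simp add: i_scale[OF x] g_scale[OF x])
  \<comment> \<open>The components of \<open>f z\<close> along the real basis are prescribed by
    \<open>u\<close>; \<open>inner_f\<close> extends the formula from basis vectors to all
    \<open>a\<close>.\<close>
  define f where "f = (\<lambda>z\<in>ns_carrier Z. \<Sum>b\<in>Basis. u (ns_scale Z (conjugation b) z) *\<^sub>R b)"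
  have conj_zero: "conjugation (0::'k) = 0"
    using conjugation_scaleR[of 0 "0::'k"] by simp
  have conj_sum: "conjugation (sum s A) = (\<Sum>a\<in>A. conjugation (s a))" for s :: "'k \<Rightarrow> 'k" and A
    by (induction A rule: infinite_finite_induct) (auto simp: conj_zero conjugation_add)
  have u_sum: "u (ns_scale Z (sum s A) z) = (\<Sum>a\<in>A. u (ns_scale Z (s a) z))"
    if z: "z \<in> ns_carrier Z" for z and s :: "'k \<Rightarrow> 'k" and A
  proof (induction A rule: infinite_finite_induct)
    case (insert a A)
    then show ?case using z u_add by (simp add: Z.ns_scale_add_left Z.ns_scale_closed)
  qed (use z u_scale[of z 0] in simp_all)
  have inner_f: "a \<bullet> f z = u (ns_scale Z (conjugation a) z)" if z: "z \<in> ns_carrier Z" for a z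
  proof -
    have "a \<bullet> f z = (\<Sum>b\<in>Basis. (a \<bullet> b) * u (ns_scale Z (conjugation b) z))"
      unfolding f_def using z by (simp add: inner_sum_right mult.commute)
    also have "\<dots> = (\<Sum>b\<in>Basis. u (ns_scale Z (conjugation ((a \<bullet> b) *\<^sub>R b)) z))"
    proof (rule sum.cong)
      fix b :: 'k
      show "(a \<bullet> b) * u (ns_scale Z (conjugation b) z)
          = u (ns_scale Z (conjugation ((a \<bullet> b) *\<^sub>R b)) z)"
        using z u_scale[of "ns_scale Z (conjugation b) z" "a \<bullet> b"]
        by (simp add: Z.ns_scale_closed Z.ns_scale_scale conjugation_of_real_mult
            scaleR_conv_of_real)
    qed simp
    also have "\<dots> = u (ns_scale Z (conjugation (\<Sum>b\<in>Basis. (a \<bullet> b) *\<^sub>R b)) z)"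
      unfolding conj_sum by (simp add: u_sum[OF z])
    finally show ?thesis by (simp add: euclidean_representation)
  qed
  \<comment> \<open>With a = \<open>f z\<close> in \<open>inner_f\<close> the left side is the
    square of the norm and one factor cancels, so no constant is lost over the complex
    scalars.\<close>
  have f_le: "norm (f z) \<le> c * ns_norm Z z" if z: "z \<in> ns_carrier Z" for z
  proof -
    have "norm (f z) * norm (f z) = f z \<bullet> f z" by (simp add: dot_square_norm power2_eq_square)
    also have "\<dots> = u (ns_scale Z (conjugation (f z)) z)" using inner_f[OF z] .
    also have "\<dots> \<le> c * (norm (f z) * ns_norm Z z)"
      using u_le[of "ns_scale Z (conjugation (f z)) z"] r(2)[of "ns_scale Z (conjugation (f z)) z"] z
      unfolding p_def by (simp add: Z.ns_scale_closed Z.ns_norm_scale norm_conjugation)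
    finally have "norm (f z) * norm (f z) \<le> norm (f z) * (c * ns_norm Z z)"
      by (simp add: mult.left_commute)
    then show ?thesis
      using c Z.ns_norm_nonneg[OF z] by (cases "f z = 0") simp_all
  qed
  show thesis
  proof (rule that)
    show "f \<in> ns_carrier (dual Z)"
    proof (rule dualI)
      show "f (ns_add Z z w) = f z + f w" if "z \<in> ns_carrier Z" "w \<in> ns_carrier Z" for z w
        using that unfolding f_def
        by (simp add: Z.ns_add_closed Z.ns_scale_add_right u_add Z.ns_scale_closed scaleR_add_left
            sum.distrib)
      \<comment> \<open>The factor \<open>a\<close> passes to the other side of the inner product as
        its conjugate, and \<open>inner_f\<close> turns it into scaling of \<open>z\<close>: real
        linearity of \<open>u\<close> becomes homogeneity over all scalars.\<close>
      show "f (ns_scale Z a z) = a * f z" if z: "z \<in> ns_carrier Z" for a z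
      proof (rule euclidean_eqI)
        fix b :: 'k
        have "b \<bullet> (a * f z) = conjugation (conjugation b * a) \<bullet> f z"
          by (simp add: inner_conjugation[of b] inner_conjugation[of "conjugation _"]
              conjugation_conjugation mult.assoc)
        also have "\<dots> = b \<bullet> f (ns_scale Z a z)"
          using z by (simp add: inner_f Z.ns_scale_closed conjugation_conjugation Z.ns_scale_scale)
        finally show "f (ns_scale Z a z) \<bullet> b = (a * f z) \<bullet> b" by (simp add: inner_commute)
      qed
    qed (use f_le in \<open>auto simp: f_def\<close>)
    show "f (i x) = g x" if x: "x \<in> ns_carrier X" for x
    proof (rule euclidean_eqI)
      fix b :: 'k
      have "b \<bullet> f (i x) = 1 \<bullet> g (ns_scale X (conjugation b) x)"
        using x i_closed X.ns_scale_closed by (simp add: inner_f u_eq flip: i_scale)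
      then show "f (i x) \<bullet> b = g x \<bullet> b"
        using x g_scale by (simp add: inner_commute inner_conjugation[of b])
    qed
    show "ns_norm (dual Z) f \<le> c" using f_le c by (rule Z.dual_norm_le)
  qed
qed

text \<open>Hahn-Banach on the line through a nonzero \<open>y\<close>: sending the multiple a y to
  a is bounded with constant \<open>1 / ns_norm Y y\<close>, and the extension has the value 1 at
  \<open>y\<close>.\<close>

lemma dual_separates_points:
  fixes Y :: "('k::conj_field, 'a) nspace"
  assumes "normed_space Y" "y \<in> ns_carrier Y" "\<And>f. f \<in> ns_carrier (dual Y) \<Longrightarrow> f y = 0"
  shows "y = ns_zero Y"
proof (rule ccontr)
  assume "y \<noteq> ns_zero Y"
  interpret normed_space Y by fact
  have pos: "ns_norm Y y > 0"
    using \<open>y \<noteq> ns_zero Y\<close> assms(2) ns_norm_nonneg ns_norm_eq_zero by force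
  obtain f where "f \<in> ns_carrier (dual Y)" "\<And>a. f (ns_scale Y a y) = a"
    by (rule hahn_banach[OF normed_space_scalar_space assms(1), of "\<lambda>a. ns_scale Y a y" "\<lambda>a. a"
          "1 / ns_norm Y y"])
      (use assms(2) pos in \<open>auto simp: ns_scale_closed ns_scale_add_left ns_scale_scale ns_norm_scale\<close>)
  then show False using assms(3)[of f] ns_scale_one assms(2) by (metis zero_neq_one)
qed

section \<open>Duality of short exact sequences\<close>

lemma bounded_operatorD:
  assumes "bounded_operator X Y S"
  shows "x \<in> ns_carrier X \<Longrightarrow> S x \<in> ns_carrier Y"
    and "\<lbrakk>x \<in> ns_carrier X; y \<in> ns_carrier X\<rbrakk> \<Longrightarrow> S (ns_add X x y) = ns_add Y (S x) (S y)"
    and "x \<in> ns_carrier X \<Longrightarrow> S (ns_scale X c x) = ns_scale Y c (S x)"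
  using assms unfolding bounded_operator_def by auto

lemma bounded_operator_bound:
  assumes "normed_space X" "bounded_operator X Y S"
  obtains K where "0 \<le> K" "\<And>x. x \<in> ns_carrier X \<Longrightarrow> ns_norm Y (S x) \<le> K * ns_norm X x"
proof -
  interpret normed_space X by fact
  obtain K where K: "\<And>x. x \<in> ns_carrier X \<Longrightarrow> ns_norm Y (S x) \<le> K * ns_norm X x"
    using assms(2) unfolding bounded_operator_def by blast
  have "ns_norm Y (S x) \<le> \<bar>K\<bar> * ns_norm X x" if "x \<in> ns_carrier X" for x
    using K[OF that] ns_norm_nonneg[OF that] by (meson abs_ge_self mult_right_mono order.trans)
  then show thesis using that[of "\<bar>K\<bar>"] by simp
qed

lemma bounded_operator_comp:
  assumes "normed_space X" "normed_space Z" "bounded_operator X Z S" "bounded_operator Z Y T"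
  shows "bounded_operator X Y (T \<circ> S)"
proof -
  note S = bounded_operatorD[OF assms(3)] and T = bounded_operatorD[OF assms(4)]
  obtain K where K: "0 \<le> K" "\<And>x. x \<in> ns_carrier X \<Longrightarrow> ns_norm Z (S x) \<le> K * ns_norm X x"
    using bounded_operator_bound[OF assms(1,3)] by blast
  obtain L where L: "0 \<le> L" "\<And>z. z \<in> ns_carrier Z \<Longrightarrow> ns_norm Y (T z) \<le> L * ns_norm Z z"
    using bounded_operator_bound[OF assms(2,4)] by blast
  have "ns_norm Y (T (S x)) \<le> (L * K) * ns_norm X x" if x: "x \<in> ns_carrier X" for x
    using L(2)[OF S(1)[OF x]] mult_left_mono[OF K(2)[OF x] L(1)] by simp
  then show ?thesis using S T unfolding bounded_operator_def by (auto intro!: exI[of _ "L * K"])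
qed

lemma conjugate_apply [simp]:
  "\<lbrakk>g \<in> ns_carrier (dual Y); x \<in> ns_carrier X\<rbrakk> \<Longrightarrow> conjugate X Y S g x = g (S x)"
  unfolding conjugate_def by simp

lemma conjugate_closed:
  assumes "normed_space X" "normed_space Y" "bounded_operator X Y S" "g \<in> ns_carrier (dual Y)"
  shows "conjugate X Y S g \<in> ns_carrier (dual X)"
proof -
  interpret X: normed_space X by fact
  interpret Y: normed_space Y by fact
  note S = bounded_operatorD[OF assms(3)] and g = dualD[OF assms(4)]
  obtain K where K: "0 \<le> K" "\<And>x. x \<in> ns_carrier X \<Longrightarrow> ns_norm Y (S x) \<le> K * ns_norm X x"
    using bounded_operator_bound[OF assms(1,3)] by blast
  show ?thesis
  proof (rule dualI[where K = "ns_norm (dual Y) g * K"])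
    fix x assume x: "x \<in> ns_carrier X"
    have "norm (g (S x)) \<le> ns_norm (dual Y) g * ns_norm Y (S x)"
      using Y.dual_bound[OF assms(4) S(1)[OF x]] .
    also have "\<dots> \<le> ns_norm (dual Y) g * (K * ns_norm X x)"
      using K(2)[OF x] Y.dual_norm_nonneg[OF assms(4)] by (rule mult_left_mono)
    finally show "norm (conjugate X Y S g x) \<le> ns_norm (dual Y) g * K * ns_norm X x"
      using x assms(4) by simp
  qed (use assms(4) S g in \<open>auto simp: conjugate_def X.ns_add_closed X.ns_scale_closed\<close>)
qed

lemma bounded_operator_conjugate:
  assumes "normed_space X" "normed_space Y" "bounded_operator X Y S"
  shows "bounded_operator (dual Y) (dual X) (conjugate X Y S)"
proof -
  interpret X: normed_space X by fact
  interpret Y: normed_space Y by fact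
  note S = bounded_operatorD[OF assms(3)]
  obtain K where K: "0 \<le> K" "\<And>x. x \<in> ns_carrier X \<Longrightarrow> ns_norm Y (S x) \<le> K * ns_norm X x"
    using bounded_operator_bound[OF assms(1,3)] by blast
  have "ns_norm (dual X) (conjugate X Y S g) \<le> K * ns_norm (dual Y) g"
    if g: "g \<in> ns_carrier (dual Y)" for g
  proof (rule X.dual_norm_le)
    fix x assume x: "x \<in> ns_carrier X"
    have "norm (g (S x)) \<le> ns_norm (dual Y) g * ns_norm Y (S x)"
      using Y.dual_bound[OF g S(1)[OF x]] .
    also have "\<dots> \<le> ns_norm (dual Y) g * (K * ns_norm X x)"
      using K(2)[OF x] Y.dual_norm_nonneg[OF g] by (rule mult_left_mono)
    finally show "norm (conjugate X Y S g x) \<le> K * ns_norm (dual Y) g * ns_norm X x"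
      using x g by (simp add: ac_simps)
  qed (use K(1) Y.dual_norm_nonneg[OF g] in simp)
  moreover have "conjugate X Y S (ns_add (dual Y) g h)
      = ns_add (dual X) (conjugate X Y S g) (conjugate X Y S h)"
    if "g \<in> ns_carrier (dual Y)" "h \<in> ns_carrier (dual Y)" for g h
    using that Y.dual_add_closed[OF that] S(1) unfolding conjugate_def
      by (auto intro!: restrict_ext)
  moreover have "conjugate X Y S (ns_scale (dual Y) c g) = ns_scale (dual X) c (conjugate X Y S g)"
    if "g \<in> ns_carrier (dual Y)" for c g
    using that Y.dual_scale_closed[OF that, of c] S(1) unfolding conjugate_def
    by (auto intro!: restrict_ext)
  ultimately show ?thesis
    using conjugate_closed[OF assms] unfolding bounded_operator_def by blast
qed

lemma conjugate_comp:
  assumes "normed_space X" "normed_space Z" "normed_space Y"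
    and "bounded_operator X Z i" "bounded_operator Z Y q" "g \<in> ns_carrier (dual Y)"
  shows "conjugate X Y (q \<circ> i) g = conjugate X Z i (conjugate Z Y q g)"
  using conjugate_closed[OF assms(2,3,5,6)] assms(6) bounded_operatorD(1)[OF assms(4)]
  unfolding conjugate_def[of X] by (auto intro!: restrict_ext)

lemma second_conjugate_apply:
  assumes "F \<in> ns_carrier (bidual X)" "g \<in> ns_carrier (dual Y)"
  shows "second_conjugate X Y S F g = F (conjugate X Y S g)"
  using assms unfolding second_conjugate_def by simp

lemma second_conjugate_closed:
  assumes "normed_space X" "normed_space Y" "bounded_operator X Y S" "F \<in> ns_carrier (bidual X)"
  shows "second_conjugate X Y S F \<in> ns_carrier (bidual Y)"
  unfolding second_conjugate_def
  by (intro conjugate_closed normed_space.normed_space_dual bounded_operator_conjugate assms)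

lemma bounded_operator_cong:
  assumes "normed_space X" "\<And>x. x \<in> ns_carrier X \<Longrightarrow> S x = T x"
  shows "bounded_operator X Y S = bounded_operator X Y T"
proof -
  interpret normed_space X by fact
  show ?thesis
    unfolding bounded_operator_def
    by (simp add: assms(2) ns_add_closed ns_scale_closed image_subset_iff cong: ball_cong)
qed

text \<open>Operators are plain functions, and the conjugate of a composition is known to equal the
  composition of the conjugates on the carrier only. This lemma lets \<open>cotauberian_iff\<close>
  exchange the two.\<close>

lemma tauberian_cong:
  assumes "normed_space X" "normed_space Y" "\<And>x. x \<in> ns_carrier X \<Longrightarrow> S x = T x"
  shows "tauberian X Y S = tauberian X Y T"
proof -
  have "conjugate X Y S = conjugate X Y T"
    unfolding conjugate_def using assms(3) by (auto intro!: restrict_ext)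
  then show ?thesis
    unfolding tauberian_def second_conjugate_def using bounded_operator_cong[OF assms(1,3)] by simp
qed

section \<open>Annihilators and exact sequences\<close>

definition annihilator :: "('k::real_normed_field, 'a) nspace \<Rightarrow> 'a set \<Rightarrow> ('a \<Rightarrow> 'k) set" where
  "annihilator Z M = {f \<in> ns_carrier (dual Z). \<forall>x\<in>M. f x = 0}"

abbreviation biannihilator ::
  "('k::real_normed_field, 'a) nspace \<Rightarrow> 'a set \<Rightarrow> (('a \<Rightarrow> 'k) \<Rightarrow> 'k) set" where
  "biannihilator Z M \<equiv> annihilator (dual Z) (annihilator Z M)"

text \<open>\<open>X\<close> is a subspace of \<open>Z\<close> and \<open>Y\<close> the quotient, up to isomorphism. Unlike inclusions and
  quotient maps this notion is self-dual.\<close>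

locale short_exact = X: normed_space X + Z: normed_space Z + Y: normed_space Y
  for X :: "('k::conj_field, 'a) nspace" and Z :: "('k, 'b) nspace" and Y :: "('k, 'c) nspace" +
  fixes i :: "'a \<Rightarrow> 'b" and q :: "'b \<Rightarrow> 'c"
  assumes bounded_i: "bounded_operator X Z i"
    and bounded_q: "bounded_operator Z Y q"
    and bounded_below_i: "\<exists>c\<ge>0. \<forall>x\<in>ns_carrier X. ns_norm X x \<le> c * ns_norm Z (i x)"
    and bounded_lift_q: "\<exists>c\<ge>0. \<forall>y\<in>ns_carrier Y. \<exists>z\<in>ns_carrier Z. q z = y \<and> ns_norm Z z
      \<le> c * ns_norm Y y"
    and exact: "i ` ns_carrier X = {z \<in> ns_carrier Z. q z = ns_zero Y}"
begin

text \<open>Hahn-Banach along \<open>i\<close>, whose lower bound supplies the constant. In the dual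
  sequence this becomes the bounded lifting property of \<open>conjugate X Z i\<close>.\<close>

lemma bounded_extension:
  "\<exists>c\<ge>0. \<forall>g\<in>ns_carrier (dual X). \<exists>f\<in>ns_carrier (dual Z).
     conjugate X Z i f = g \<and> ns_norm (dual Z) f \<le> c * ns_norm (dual X) g"
proof -
  obtain c where c: "0 \<le> c" "\<And>x. x \<in> ns_carrier X \<Longrightarrow> ns_norm X x \<le> c * ns_norm Z (i x)"
    using bounded_below_i by blast
  have "\<exists>f\<in>ns_carrier (dual Z). conjugate X Z i f = g \<and> ns_norm (dual Z) f \<le> c * ns_norm (dual X) g"
    if g: "g \<in> ns_carrier (dual X)" for g
  proof -
    have le: "norm (g x) \<le> c * ns_norm (dual X) g * ns_norm Z (i x)" if "x \<in> ns_carrier X" for x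
      using X.dual_bound[OF g that] mult_left_mono[OF c(2)[OF that] X.dual_norm_nonneg[OF g]]
      by (simp add: ac_simps)
    obtain f where f: "f \<in> ns_carrier (dual Z)" "\<And>x. x \<in> ns_carrier X \<Longrightarrow> f (i x) = g x"
      "ns_norm (dual Z) f \<le> c * ns_norm (dual X) g"
      by (rule hahn_banach[OF X.normed_space_axioms Z.normed_space_axioms, of i g
            "c * ns_norm (dual X) g"])
        (use bounded_operatorD[OF bounded_i] dualD[OF g] le c(1) X.dual_norm_nonneg[OF g] in auto)
    moreover have "conjugate X Z i f = g"
      using f(1,2) by (intro dual_eqI[OF conjugate_closed[OF X.normed_space_axioms
            Z.normed_space_axioms bounded_i f(1)] g]) simp
    ultimately show ?thesis by blast
  qed
  then show ?thesis using c(1) by blast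
qed

text \<open>A functional that vanishes on the kernel of \<open>q\<close> factors through
  \<open>q\<close>, and bounded lifting of vectors makes the factor bounded. Classically, (Z/M)* is
  M^perp.\<close>

lemma range_conjugate: "conjugate Z Y q ` ns_carrier (dual Y) = annihilator Z (i ` ns_carrier X)"
proof (intro subset_antisym subsetI)
  fix f assume "f \<in> conjugate Z Y q ` ns_carrier (dual Y)"
  then obtain h where h: "h \<in> ns_carrier (dual Y)" "f = conjugate Z Y q h" by blast
  have "f z = 0" if "z \<in> i ` ns_carrier X" for z
    using that h Y.dual_zero[OF h(1)] unfolding exact by simp
  then show "f \<in> annihilator Z (i ` ns_carrier X)"
    unfolding annihilator_def h(2)
    using conjugate_closed[OF Z.normed_space_axioms Y.normed_space_axioms bounded_q h(1)] h by auto
next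
  fix f assume "f \<in> annihilator Z (i ` ns_carrier X)"
  then have f: "f \<in> ns_carrier (dual Z)"
    and f_zero: "\<And>z. \<lbrakk>z \<in> ns_carrier Z; q z = ns_zero Y\<rbrakk> \<Longrightarrow> f z = 0"
    unfolding annihilator_def exact by auto
  note q = bounded_operatorD[OF bounded_q]
  obtain c where c: "0 \<le> c"
    and lift: "\<And>y. y \<in> ns_carrier Y \<Longrightarrow> \<exists>z. z \<in> ns_carrier Z \<and> q z = y \<and> ns_norm Z z
      \<le> c * ns_norm Y y"
    using bounded_lift_q by blast
  \<comment> \<open>A bounded choice of preimages, not a linear one: linearity of \<open>h\<close>
    comes from \<open>f z\<close> depending only on \<open>q z\<close>.\<close>
  then obtain s where s: "\<And>y. y \<in> ns_carrier Y \<Longrightarrow> s y \<in> ns_carrier Z \<and> q (s y) = y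
    \<and> ns_norm Z (s y) \<le> c * ns_norm Y y"
    by metis
  define h where "h = (\<lambda>y\<in>ns_carrier Y. f (s y))"
  have f_eq: "f z = f w" if "z \<in> ns_carrier Z" "w \<in> ns_carrier Z" "q z = q w" for z w
    using f_zero[of "ns_add Z z (ns_scale Z (- 1) w)"] that
    by (simp add: Z.dual_diff[OF f] q Z.ns_add_closed Z.ns_scale_closed Y.ns_add_minus)
  have hq: "h (q z) = f z" if "z \<in> ns_carrier Z" for z
    using f_eq[of "s (q z)" z] s[of "q z"] that q(1) unfolding h_def by simp
  have "h \<in> ns_carrier (dual Y)"
  proof (rule dualI)
    show "h (ns_add Y y w) = h y + h w" if "y \<in> ns_carrier Y" "w \<in> ns_carrier Y" for y w
      using hq[of "ns_add Z (s y) (s w)"] hq[of "s y"] hq[of "s w"] s[OF that(1)] s[OF that(2)]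
      by (simp add: q Z.ns_add_closed dualD(1)[OF f])
    show "h (ns_scale Y a y) = a * h y" if "y \<in> ns_carrier Y" for a y
      using hq[of "ns_scale Z a (s y)"] hq[of "s y"] s[OF that]
      by (simp add: q Z.ns_scale_closed dualD(2)[OF f])
    show "norm (h y) \<le> ns_norm (dual Z) f * c * ns_norm Y y" if y: "y \<in> ns_carrier Y" for y
    proof -
      have "norm (f (s y)) \<le> ns_norm (dual Z) f * ns_norm Z (s y)"
        using Z.dual_bound[OF f] s[OF y] by blast
      also have "\<dots> \<le> ns_norm (dual Z) f * (c * ns_norm Y y)"
        using s[OF y] Z.dual_norm_nonneg[OF f] by (intro mult_left_mono) auto
      finally show ?thesis using y unfolding h_def by simp
    qed
  qed (simp add: h_def)
  moreover from this have "f = conjugate Z Y q h"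
    using f hq conjugate_closed[OF Z.normed_space_axioms Y.normed_space_axioms bounded_q]
    by (intro dual_eqI[OF f]) auto
  ultimately show "f \<in> conjugate Z Y q ` ns_carrier (dual Y)" by blast
qed

text \<open>The properties trade places: lifting along \<open>q\<close> bounds
  \<open>conjugate Z Y q\<close> from below, extension along \<open>i\<close> is lifting along
  \<open>conjugate X Z i\<close>, and exactness is \<open>range_conjugate\<close>, because the
  kernel of \<open>conjugate X Z i\<close> is the annihilator of the range of
  \<open>i\<close>.\<close>

lemma short_exact_dual:
  "short_exact (dual Y) (dual Z) (dual X) (conjugate Z Y q) (conjugate X Z i)"
proof -
  interpret X': normed_space "dual X" by (rule X.normed_space_dual)
  interpret Z': normed_space "dual Z" by (rule Z.normed_space_dual)
  interpret Y': normed_space "dual Y" by (rule Y.normed_space_dual)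
  obtain c where c: "0 \<le> c"
    and lift: "\<And>y. y \<in> ns_carrier Y \<Longrightarrow> \<exists>z. z \<in> ns_carrier Z \<and> q z = y \<and> ns_norm Z z
      \<le> c * ns_norm Y y"
    using bounded_lift_q by blast
  have below: "ns_norm (dual Y) h \<le> c * ns_norm (dual Z) (conjugate Z Y q h)"
    if h: "h \<in> ns_carrier (dual Y)" for h
  proof (rule Y.dual_norm_le)
    note h' = conjugate_closed[OF Z.normed_space_axioms Y.normed_space_axioms bounded_q h]
    show "0 \<le> c * ns_norm (dual Z) (conjugate Z Y q h)"
      using c Z.dual_norm_nonneg[OF h'] by simp
    fix y assume "y \<in> ns_carrier Y"
    then obtain z where z: "z \<in> ns_carrier Z" "q z = y" "ns_norm Z z \<le> c * ns_norm Y y"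
      using lift by blast
    have "norm (h y) \<le> ns_norm (dual Z) (conjugate Z Y q h) * ns_norm Z z"
      using Z.dual_bound[OF h' z(1)] z h by simp
    also have "\<dots> \<le> ns_norm (dual Z) (conjugate Z Y q h) * (c * ns_norm Y y)"
      using z(3) Z.dual_norm_nonneg[OF h'] by (rule mult_left_mono)
    finally show "norm (h y) \<le> c * ns_norm (dual Z) (conjugate Z Y q h) * ns_norm Y y"
      by (simp add: ac_simps)
  qed
  have kernel: "annihilator Z (i ` ns_carrier X)
      = {f \<in> ns_carrier (dual Z). conjugate X Z i f = ns_zero (dual X)}"
    unfolding annihilator_def conjugate_def by (auto simp: fun_eq_iff restrict_def split: if_splits)
  show ?thesis
  proof unfold_locales
    show "bounded_operator (dual Y) (dual Z) (conjugate Z Y q)"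
      by (rule bounded_operator_conjugate[OF Z.normed_space_axioms Y.normed_space_axioms bounded_q])
    show "bounded_operator (dual Z) (dual X) (conjugate X Z i)"
      by (rule bounded_operator_conjugate[OF X.normed_space_axioms Z.normed_space_axioms bounded_i])
  qed (use below c bounded_extension range_conjugate kernel in blast)+
qed

text \<open>Two uses of \<open>range_conjugate\<close>, for the dual sequence and for the given one.
  This is the identification of M** with M^perp^perp.\<close>

lemma range_second_conjugate:
  "second_conjugate X Z i ` ns_carrier (bidual X) = biannihilator Z (i ` ns_carrier X)"
  using short_exact.range_conjugate[OF short_exact_dual] range_conjugate
  unfolding second_conjugate_def by simp

text \<open>In essence M^perp^perp \<inter> Z = M. A point \<open>z\<close> that represents an
  element of the biannihilator is killed by every functional pulled back along \<open>q\<close>;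
  hence \<open>q z\<close> is zero by Hahn-Banach, and exactness puts \<open>z\<close> in the range
  of \<open>i\<close>.\<close>

lemma second_conjugate_in_canonical_iff:
  assumes F: "F \<in> ns_carrier (bidual X)"
  shows "second_conjugate X Z i F \<in> canonical_embedding Z ` ns_carrier Z
    \<longleftrightarrow> F \<in> canonical_embedding X ` ns_carrier X"
proof
  assume "F \<in> canonical_embedding X ` ns_carrier X"
  then obtain x where x: "x \<in> ns_carrier X" "\<And>g. g \<in> ns_carrier (dual X) \<Longrightarrow> F g = g x"
    using bidual_in_canonical_iff[OF X.normed_space_axioms F] by blast
  have "second_conjugate X Z i F f = f (i x)" if "f \<in> ns_carrier (dual Z)" for f
    using that x conjugate_closed[OF X.normed_space_axioms Z.normed_space_axioms bounded_i that]
    by (simp add: second_conjugate_apply[OF F])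
  then show "second_conjugate X Z i F \<in> canonical_embedding Z ` ns_carrier Z"
    using bidual_in_canonical_iff[OF Z.normed_space_axioms
        second_conjugate_closed[OF X.normed_space_axioms Z.normed_space_axioms bounded_i F]]
      bounded_operatorD(1)[OF bounded_i x(1)] by blast
next
  assume "second_conjugate X Z i F \<in> canonical_embedding Z ` ns_carrier Z"
  then obtain z where z: "z \<in> ns_carrier Z"
    "\<And>f. f \<in> ns_carrier (dual Z) \<Longrightarrow> F (conjugate X Z i f) = f z"
    using bidual_in_canonical_iff[OF Z.normed_space_axioms
        second_conjugate_closed[OF X.normed_space_axioms Z.normed_space_axioms bounded_i F]]
    by (auto simp: second_conjugate_apply[OF F])
  have "h (q z) = 0" if h: "h \<in> ns_carrier (dual Y)" for h
  proof -
    have f: "conjugate Z Y q h \<in> annihilator Z (i ` ns_carrier X)"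
      using range_conjugate h by blast
    then have "conjugate X Z i (conjugate Z Y q h) = ns_zero (dual X)"
      unfolding annihilator_def conjugate_def[of X] by (auto intro!: restrict_ext)
    then have "conjugate Z Y q h z = 0"
      using z(2)[of "conjugate Z Y q h"] f normed_space.dual_zero[OF X.normed_space_dual F]
      unfolding annihilator_def by simp
    then show ?thesis using h z(1) by simp
  qed
  then have "q z = ns_zero Y"
    using dual_separates_points[OF Y.normed_space_axioms] bounded_operatorD(1)[OF bounded_q z(1)]
    by blast
  then obtain x where x: "x \<in> ns_carrier X" "z = i x" using exact z(1) by blast
  have "F g = g x" if g: "g \<in> ns_carrier (dual X)" for g
  proof -
    obtain f where "f \<in> ns_carrier (dual Z)" "conjugate X Z i f = g"
      using bounded_extension g by blast
    then show ?thesis using z(2)[of f] x by auto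
  qed
  then show "F \<in> canonical_embedding X ` ns_carrier X"
    using bidual_in_canonical_iff[OF X.normed_space_axioms F] x(1) by blast
qed

end

text \<open>With \<open>M\<^sup>\<bottom>\<^sup>\<bottom>\<close> for the biannihilator and \<open>Z\<close> viewed as a subspace of \<open>Z\<^sup>*\<^sup>*\<close>, the two criteria
  read \<open>M\<^sup>\<bottom>\<^sup>\<bottom> \<inter> (Z + N\<^sup>\<bottom>\<^sup>\<bottom>) \<subseteq> Z\<close> and \<open>M\<^sup>\<bottom>\<^sup>\<bottom> \<subseteq> Z + N\<^sup>\<bottom>\<^sup>\<bottom>\<close>.\<close>

definition tauberian_criterion ::
  "('k::real_normed_field, 'a) nspace \<Rightarrow> 'a set \<Rightarrow> 'a set \<Rightarrow> bool" where
  "tauberian_criterion Z M N \<longleftrightarrow>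
     (\<forall>G\<in>biannihilator Z M. \<forall>z\<in>ns_carrier Z. (\<forall>f\<in>annihilator Z N. G f = f z) \<longrightarrow>
        G \<in> canonical_embedding Z ` ns_carrier Z)"

definition weakly_compact_criterion ::
  "('k::real_normed_field, 'a) nspace \<Rightarrow> 'a set \<Rightarrow> 'a set \<Rightarrow> bool" where
  "weakly_compact_criterion Z M N \<longleftrightarrow>
     (\<forall>G\<in>biannihilator Z M. \<exists>z\<in>ns_carrier Z. \<forall>f\<in>annihilator Z N. G f = f z)"

text \<open>Two exact sequences with the same middle space. With M and N the ranges of
  \<open>i\<close> and \<open>i'\<close>, the operator \<open>q' \<circ> i\<close> is Q_N J_M up to
  isomorphism.\<close>

locale short_exact_pair =
  A: short_exact X Z Y i q + B: short_exact X' Z Y' i' q'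
  for X :: "('k::conj_field, 'a) nspace" and Z :: "('k, 'b) nspace" and Y :: "('k, 'c) nspace"
    and i q and X' :: "('k, 'd) nspace" and Y' :: "('k, 'e) nspace" and i' q'
begin

lemma bounded_comp: "bounded_operator X Y' (q' \<circ> i)"
  by (rule bounded_operator_comp[OF A.X.normed_space_axioms A.Z.normed_space_axioms A.bounded_i B.bounded_q])

text \<open>By \<open>range_conjugate\<close> the functionals on \<open>Y'\<close> are those on Z
  that annihilate N, and every point of \<open>Y'\<close> is some \<open>q' z\<close>. So lying in
  \<open>Y'\<close> means agreeing with a point of Z on N^perp, that is, lying in Z +
  N^perp^perp.\<close>

lemma second_conjugate_comp_in_canonical_iff:
  assumes F: "F \<in> ns_carrier (bidual X)"
  shows "second_conjugate X Y' (q' \<circ> i) F \<in> canonical_embedding Y' ` ns_carrier Y' \<longleftrightarrow>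
     (\<exists>z\<in>ns_carrier Z. \<forall>f\<in>annihilator Z (i' ` ns_carrier X'). second_conjugate X Z i F f = f z)"
proof -
  have eq: "(\<forall>h\<in>ns_carrier (dual Y'). second_conjugate X Y' (q' \<circ> i) F h = h (q' z)) \<longleftrightarrow>
      (\<forall>f\<in>annihilator Z (i' ` ns_carrier X'). second_conjugate X Z i F f = f z)"
    if z: "z \<in> ns_carrier Z" for z
  proof -
    have "second_conjugate X Y' (q' \<circ> i) F h = second_conjugate X Z i F (conjugate Z Y' q' h)"
      if h: "h \<in> ns_carrier (dual Y')" for h
      using conjugate_comp[OF A.X.normed_space_axioms A.Z.normed_space_axioms
          B.Y.normed_space_axioms A.bounded_i B.bounded_q h]
        conjugate_closed[OF A.Z.normed_space_axioms B.Y.normed_space_axioms B.bounded_q h] h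
      by (simp add: second_conjugate_apply[OF F])
    then show ?thesis using z unfolding B.range_conjugate[symmetric] by simp
  qed
  have "\<exists>z\<in>ns_carrier Z. y = q' z" if "y \<in> ns_carrier Y'" for y
    using B.bounded_lift_q that by metis
  then have "ns_carrier Y' = q' ` ns_carrier Z"
    using bounded_operatorD(1)[OF B.bounded_q] by blast
  then show ?thesis
    using bidual_in_canonical_iff[OF B.Y.normed_space_axioms second_conjugate_closed[OF
          A.X.normed_space_axioms B.Y.normed_space_axioms bounded_comp F]] eq by simp
qed

lemma tauberian_iff:
  "tauberian X Y' (q' \<circ> i) \<longleftrightarrow> tauberian_criterion Z (i ` ns_carrier X) (i' ` ns_carrier X')"
proof -
  have "tauberian X Y' (q' \<circ> i) \<longleftrightarrow> (\<forall>F\<in>ns_carrier (bidual X).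
      second_conjugate X Y' (q' \<circ> i) F \<in> canonical_embedding Y' ` ns_carrier Y' \<longrightarrow>
      F \<in> canonical_embedding X ` ns_carrier X)"
    unfolding tauberian_def image_subset_iff
    using bounded_comp second_conjugate_closed[OF A.X.normed_space_axioms B.Y.normed_space_axioms
        bounded_comp] by blast
  also have "\<dots> \<longleftrightarrow> tauberian_criterion Z (i ` ns_carrier X) (i' ` ns_carrier X')"
    unfolding tauberian_criterion_def A.range_second_conjugate[symmetric]
    by (auto simp: second_conjugate_comp_in_canonical_iff A.second_conjugate_in_canonical_iff)
  finally show ?thesis .
qed

lemma second_conjugate_range_iff:
  "second_conjugate X Y' (q' \<circ> i) ` ns_carrier (bidual X) \<subseteq> canonical_embedding Y' ` ns_carrier Y'
    \<longleftrightarrow> weakly_compact_criterion Z (i ` ns_carrier X) (i' ` ns_carrier X')"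
  unfolding weakly_compact_criterion_def A.range_second_conjugate[symmetric] image_subset_iff
  by (auto simp: second_conjugate_comp_in_canonical_iff)

text \<open>The conjugate of Q_N J_M is \<open>conjugate X Z i \<circ> conjugate Z Y' q'\<close>, an
  operator of the same kind for the two dual sequences, now belonging to the pair (N^perp, M^perp).
  So \<open>tauberian_iff\<close> applies to it.\<close>

lemma cotauberian_iff:
  "cotauberian X Y' (q' \<circ> i) \<longleftrightarrow>
     tauberian_criterion (dual Z) (annihilator Z (i' ` ns_carrier X')) (annihilator Z (i ` ns_carrier X))"
proof -
  interpret D: short_exact_pair "dual Y'" "dual Z" "dual X'" "conjugate Z Y' q'" "conjugate X' Z i'"
      "dual Y" "dual X" "conjugate Z Y q" "conjugate X Z i"
    by (intro short_exact_pair.intro A.short_exact_dual B.short_exact_dual)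
  have "tauberian (dual Y') (dual X) (conjugate X Y' (q' \<circ> i))
      \<longleftrightarrow> tauberian (dual Y') (dual X) (conjugate X Z i \<circ> conjugate Z Y' q')"
    using conjugate_comp[OF A.X.normed_space_axioms A.Z.normed_space_axioms
          B.Y.normed_space_axioms A.bounded_i B.bounded_q]
    by (intro tauberian_cong A.X.normed_space_dual B.Y.normed_space_dual) simp
  then show ?thesis
    unfolding cotauberian_def using bounded_comp D.tauberian_iff A.range_conjugate B.range_conjugate
    by simp
qed

end

text \<open>Reflection: if G lies in N^perp^perp and agrees with z on M^perp, then H = z - G lies in
  M^perp^perp and agrees with z on N^perp. The hypothesis puts H in Z, and with it G = z -
  H.\<close>

lemma tauberian_criterion_sym:
  assumes "normed_space Z" "tauberian_criterion Z M N"
  shows "tauberian_criterion Z N M"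
  unfolding tauberian_criterion_def
proof (intro ballI impI)
  interpret normed_space Z by fact
  interpret D: normed_space "dual Z" by (rule normed_space_dual)
  interpret DD: normed_space "bidual Z" by (rule D.normed_space_dual)
  fix G z assume G: "G \<in> biannihilator Z N" and z: "z \<in> ns_carrier Z"
    and eq: "\<forall>f\<in>annihilator Z M. G f = f z"
  have G': "G \<in> ns_carrier (bidual Z)" using G unfolding annihilator_def by simp
  define H where "H = ns_add (bidual Z) (canonical_embedding Z z) (ns_scale (bidual Z) (- 1) G)"
  have H: "H \<in> ns_carrier (bidual Z)"
    unfolding H_def using canonical_embedding_closed[OF assms(1) z] G'
    by (intro DD.ns_add_closed DD.ns_scale_closed)
  have H_apply: "H f = f z - G f" if "f \<in> ns_carrier (dual Z)" for f
    using that z unfolding H_def by simp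
  have "H \<in> biannihilator Z M"
    using H H_apply eq unfolding annihilator_def by auto
  moreover have "\<forall>f\<in>annihilator Z N. H f = f z"
    using H_apply G unfolding annihilator_def by auto
  ultimately have "H \<in> canonical_embedding Z ` ns_carrier Z"
    using assms(2) z unfolding tauberian_criterion_def by blast
  then obtain w where w: "w \<in> ns_carrier Z" "\<And>f. f \<in> ns_carrier (dual Z) \<Longrightarrow> H f = f w"
    using bidual_in_canonical_iff[OF assms(1) H] by blast
  have "G f = f (ns_add Z z (ns_scale Z (- 1) w))" if "f \<in> ns_carrier (dual Z)" for f
    unfolding dual_diff[OF that z w(1)] w(2)[OF that, symmetric] H_apply[OF that] by simp
  then show "G \<in> canonical_embedding Z ` ns_carrier Z"
    using bidual_in_canonical_iff[OF assms(1) G'] z w(1) ns_add_closed ns_scale_closed by blast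
qed

text \<open>The common step of transitivity and left stability: \<open>G \<in> L\<^sup>\<bottom>\<^sup>\<bottom>\<close> is moved by an element of
  \<open>Z\<close> into \<open>M\<^sup>\<bottom>\<^sup>\<bottom>\<close>.\<close>

lemma weakly_compact_criterion_shift:
  assumes "normed_space Z" "weakly_compact_criterion Z L M" "G \<in> biannihilator Z L"
  obtains z H where "z \<in> ns_carrier Z" "H \<in> biannihilator Z M"
    "\<And>f. f \<in> ns_carrier (dual Z) \<Longrightarrow> G f = f z + H f"
proof -
  interpret normed_space Z by fact
  interpret D: normed_space "dual Z" by (rule normed_space_dual)
  interpret DD: normed_space "bidual Z" by (rule D.normed_space_dual)
  obtain z where z: "z \<in> ns_carrier Z" "\<And>f. f \<in> annihilator Z M \<Longrightarrow> G f = f z"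
    using assms(2,3) unfolding weakly_compact_criterion_def by blast
  have G: "G \<in> ns_carrier (bidual Z)" using assms(3) unfolding annihilator_def by simp
  define H where "H = ns_add (bidual Z) G (ns_scale (bidual Z) (- 1) (canonical_embedding Z z))"
  have H: "H \<in> ns_carrier (bidual Z)"
    unfolding H_def using canonical_embedding_closed[OF assms(1) z(1)] G
    by (intro DD.ns_add_closed DD.ns_scale_closed)
  have H_apply: "G f = f z + H f" if "f \<in> ns_carrier (dual Z)" for f
    using that z(1) unfolding H_def by simp
  moreover have "H \<in> biannihilator Z M"
    using H H_apply z(2) unfolding annihilator_def by auto
  ultimately show thesis using that z(1) by blast
qed

text \<open>The two shifts by points of Z add up.\<close>

lemma weakly_compact_criterion_trans:
  assumes "normed_space Z" "weakly_compact_criterion Z L M" "weakly_compact_criterion Z M N"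
  shows "weakly_compact_criterion Z L N"
  unfolding weakly_compact_criterion_def
proof
  interpret normed_space Z by fact
  fix G assume "G \<in> biannihilator Z L"
  then obtain z H where z: "z \<in> ns_carrier Z" "H \<in> biannihilator Z M"
    "\<And>f. f \<in> ns_carrier (dual Z) \<Longrightarrow> G f = f z + H f"
    using weakly_compact_criterion_shift[OF assms(1,2)] by blast
  obtain w where w: "w \<in> ns_carrier Z" "\<And>f. f \<in> annihilator Z N \<Longrightarrow> H f = f w"
    using assms(3) z(2) unfolding weakly_compact_criterion_def by blast
  have "G f = f (ns_add Z z w)" if "f \<in> annihilator Z N" for f
    using z w that dualD(1)[of f Z z w] unfolding annihilator_def by simp
  then show "\<exists>z\<in>ns_carrier Z. \<forall>f\<in>annihilator Z N. G f = f z"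
    using ns_add_closed[OF z(1) w(1)] by blast
qed

text \<open>The shifted element H agrees with the point w - z on N^perp, so the hypothesis on (M, N)
  puts H in Z; G differs from H by a point of Z.\<close>

lemma tauberian_criterion_left_stable:
  assumes "normed_space Z" "weakly_compact_criterion Z L M" "tauberian_criterion Z M N"
  shows "tauberian_criterion Z L N"
  unfolding tauberian_criterion_def
proof (intro ballI impI)
  interpret normed_space Z by fact
  fix G w assume G: "G \<in> biannihilator Z L" and w: "w \<in> ns_carrier Z"
    and eq: "\<forall>f\<in>annihilator Z N. G f = f w"
  obtain z H where z: "z \<in> ns_carrier Z" "H \<in> biannihilator Z M"
    "\<And>f. f \<in> ns_carrier (dual Z) \<Longrightarrow> G f = f z + H f"
    using weakly_compact_criterion_shift[OF assms(1,2) G] by blast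
  have "H f = f (ns_add Z w (ns_scale Z (- 1) z))" if "f \<in> annihilator Z N" for f
  proof -
    have f: "f \<in> ns_carrier (dual Z)" using that unfolding annihilator_def by simp
    have "f w = f z + H f" using eq that z(3)[OF f] by simp
    then show ?thesis by (simp add: dual_diff[OF f w z(1)])
  qed
  then have "H \<in> canonical_embedding Z ` ns_carrier Z"
    using assms(3) z(2) ns_add_closed[OF w ns_scale_closed[OF z(1)]]
    unfolding tauberian_criterion_def by blast
  moreover have "H \<in> ns_carrier (bidual Z)" using z(2) unfolding annihilator_def by simp
  ultimately obtain v where v: "v \<in> ns_carrier Z" "\<And>f. f \<in> ns_carrier (dual Z) \<Longrightarrow> H f = f v"
    using bidual_in_canonical_iff[OF assms(1)] by blast
  have "G f = f (ns_add Z z v)" if "f \<in> ns_carrier (dual Z)" for f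
    using z(3)[OF that] v(2)[OF that] dualD(1)[OF that z(1) v(1)] by simp
  moreover have "G \<in> ns_carrier (bidual Z)" using G unfolding annihilator_def by simp
  ultimately show "G \<in> canonical_embedding Z ` ns_carrier Z"
    using bidual_in_canonical_iff[OF assms(1)] ns_add_closed[OF z(1) v(1)] by blast
qed

text \<open>Passage to the conjugate operator, done with annihilators instead of compactness. A
  functional P on Z** that vanishes on N^perp^perp is compared with its restriction f to Z: each G
  in M^perp^perp is a point of Z plus an element of N^perp^perp, and on both summands P is
  evaluation at f.\<close>

lemma weakly_compact_criterion_dual:
  assumes "normed_space Z" "N \<subseteq> ns_carrier Z" "weakly_compact_criterion Z M N"
  shows "weakly_compact_criterion (dual Z) (annihilator Z N) (annihilator Z M)"
  unfolding weakly_compact_criterion_def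
proof
  interpret normed_space Z by fact
  fix P assume P: "P \<in> biannihilator (dual Z) (annihilator Z N)"
  then have P': "P \<in> ns_carrier (dual (bidual Z))" unfolding annihilator_def by simp
  note P_diff = normed_space.dual_diff[OF normed_space.normed_space_dual[OF normed_space_dual] P']
  define f where "f = (\<lambda>z\<in>ns_carrier Z. P (canonical_embedding Z z))"
  have add: "canonical_embedding Z (ns_add Z x y)
      = ns_add (bidual Z) (canonical_embedding Z x) (canonical_embedding Z y)"
    if "x \<in> ns_carrier Z" "y \<in> ns_carrier Z" for x y
    using that ns_add_closed[OF that] dualD(1) unfolding canonical_embedding_def
    by (auto intro!: restrict_ext)
  have scale: "canonical_embedding Z (ns_scale Z c x)
      = ns_scale (bidual Z) c (canonical_embedding Z x)" if "x \<in> ns_carrier Z" for c x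
    using that ns_scale_closed[OF that] dualD(2) unfolding canonical_embedding_def
    by (auto intro!: restrict_ext)
  have f: "f \<in> ns_carrier (dual Z)"
  proof (rule dualI)
    fix z assume z: "z \<in> ns_carrier Z"
    have "ns_norm (bidual Z) (canonical_embedding Z z) \<le> ns_norm Z z"
      using dual_bound[OF _ z] z ns_norm_nonneg[OF z]
      by (intro normed_space.dual_norm_le[OF normed_space_dual]) (auto simp: mult.commute)
    then show "norm (f z) \<le> ns_norm (dual (bidual Z)) P * ns_norm Z z"
      using normed_space.dual_bound[OF normed_space.normed_space_dual[OF normed_space_dual] P'
          canonical_embedding_closed[OF assms(1) z]]
        normed_space.dual_norm_nonneg[OF normed_space.normed_space_dual[OF normed_space_dual] P'] z
      unfolding f_def by (auto intro: order.trans mult_left_mono)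
  qed (use dualD[OF P'] canonical_embedding_closed[OF assms(1)] in
      \<open>auto simp: f_def add scale ns_add_closed ns_scale_closed simp del: dual_simps\<close>)
  have "canonical_embedding Z x \<in> biannihilator Z N" if "x \<in> N" for x
    using that assms(2) canonical_embedding_closed[OF assms(1)] unfolding annihilator_def by auto
  then have f_N: "f \<in> annihilator Z N"
    using f P assms(2) unfolding annihilator_def f_def by auto
  have "P G = G f" if G: "G \<in> biannihilator Z M" for G
  proof -
    obtain z H where z: "z \<in> ns_carrier Z" "H \<in> biannihilator Z N"
      "\<And>f. f \<in> ns_carrier (dual Z) \<Longrightarrow> G f = f z + H f"
      using weakly_compact_criterion_shift[OF assms(1,3) G] by blast
    have mem: "G \<in> ns_carrier (bidual Z)" "H \<in> ns_carrier (bidual Z)"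
      using G z(2) unfolding annihilator_def by auto
    have "G = ns_add (bidual Z) (canonical_embedding Z z) H"
      using normed_space.ns_add_closed[OF normed_space.normed_space_dual[OF normed_space_dual]
          canonical_embedding_closed[OF assms(1) z(1)] mem(2)] mem(1) z
      by (intro dual_eqI) auto
    then have "P G = P (canonical_embedding Z z) + P H"
      using dualD(1)[OF P' canonical_embedding_closed[OF assms(1) z(1)] mem(2)] by simp
    also have "\<dots> = f z" using P z(1,2) unfolding annihilator_def f_def by simp
    also have "\<dots> = G f" using z f_N f unfolding annihilator_def by auto
    finally show ?thesis .
  qed
  then show "\<exists>g\<in>ns_carrier (dual Z). \<forall>G\<in>biannihilator Z M. P G = G g" using f by blast
qed

section \<open>Gantmacher's theorem\<close>

context normed_space
begin

lemma topspace_weak_topology: "topspace (weak_topology X) = ns_carrier X"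
  unfolding weak_topology_def topology_generated_by_topspace
  using dual_zero_closed by (auto intro!: exI[of _ UNIV] exI[of _ "ns_carrier X"])

lemma continuous_map_dual:
  assumes "f \<in> ns_carrier (dual X)"
  shows "continuous_map (weak_topology X) euclidean f"
proof (subst continuous_map_def, intro conjI allI impI)
  fix U :: "'k set" assume "openin euclidean U"
  then have "openin (weak_topology X) {x \<in> ns_carrier X. f x \<in> U}"
    unfolding weak_topology_def using assms by (intro topology_generated_by_Basis) auto
  then show "openin (weak_topology X) {x \<in> topspace (weak_topology X). f x \<in> U}"
    unfolding topspace_weak_topology .
qed auto

lemma continuous_map_into_weak_topology:
  assumes "p ` topspace T \<subseteq> ns_carrier X"
    and "\<And>f. f \<in> ns_carrier (dual X) \<Longrightarrow> continuous_map T euclidean (\<lambda>t. f (p t))"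
  shows "continuous_map T (weak_topology X) p"
  unfolding weak_topology_def
proof (rule continuous_on_generated_topo)
  show "p ` topspace T \<subseteq> \<Union> {{y \<in> ns_carrier X. f y \<in> U} |f U. f \<in> ns_carrier (dual X) \<and> open U}"
    using assms(1) topspace_weak_topology unfolding weak_topology_def by simp
  fix V assume "V \<in> {{y \<in> ns_carrier X. f y \<in> U} |f U. f \<in> ns_carrier (dual X) \<and> open U}"
  then obtain f U where fU: "f \<in> ns_carrier (dual X)" "open U"
    and V: "V = {y \<in> ns_carrier X. f y \<in> U}" by blast
  have "p -` V \<inter> topspace T = {t \<in> topspace T. f (p t) \<in> U}"
    unfolding V using assms(1) by auto
  then show "openin T (p -` V \<inter> topspace T)"
    using assms(2)[OF fU(1)] fU(2) unfolding continuous_map_def by simp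
qed

lemma closedin_weak_topology_eq:
  assumes "f \<in> ns_carrier (dual X)"
  shows "closedin (weak_topology X) {x \<in> ns_carrier X. f x = a}"
  using closedin_continuous_map_preimage[OF continuous_map_dual[OF assms], of "{a}"]
  unfolding topspace_weak_topology by simp

end

lemma Hausdorff_space_weak_topology:
  fixes X :: "('k::conj_field, 'a) nspace"
  assumes "normed_space X"
  shows "Hausdorff_space (weak_topology X)"
  unfolding Hausdorff_space_def
proof clarify
  interpret normed_space X by fact
  fix x y assume "x \<in> topspace (weak_topology X)" "y \<in> topspace (weak_topology X)" "x \<noteq> y"
  then have x: "x \<in> ns_carrier X" and y: "y \<in> ns_carrier X"
    unfolding topspace_weak_topology by auto
  have "\<exists>f\<in>ns_carrier (dual X). f x \<noteq> f y"
  proof (rule ccontr)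
    assume "\<not> (\<exists>f\<in>ns_carrier (dual X). f x \<noteq> f y)"
    then have "ns_add X x (ns_scale X (- 1) y) = ns_zero X"
      using x y by (intro dual_separates_points[OF assms])
        (auto simp: dual_diff ns_add_closed ns_scale_closed)
    then show False using ns_diff_eq_zero x y \<open>x \<noteq> y\<close> by blast
  qed
  then obtain f where f: "f \<in> ns_carrier (dual X)" "f x \<noteq> f y" by blast
  then obtain U V where UV: "open U" "open V" "f x \<in> U" "f y \<in> V" "U \<inter> V = {}"
    using hausdorff by metis
  have "openin (weak_topology X) {z \<in> ns_carrier X. f z \<in> W}" if "open W" for W
    using openin_continuous_map_preimage[OF continuous_map_dual[OF f(1)], of W] that
    unfolding topspace_weak_topology by simp
  then show "\<exists>U V. openin (weak_topology X) U \<and> openin (weak_topology X) V \<and> x \<in> U \<and> y \<in> V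
    \<and> disjnt U V"
    using UV x y
    by (intro exI[of _ "{z \<in> ns_carrier X. f z \<in> U}"] exI[of _ "{z \<in> ns_carrier X. f z \<in> V}"])
      (auto simp: disjnt_def)
qed

text \<open>The Banach-Alaoglu theorem for the ball of X**: by Tychonoff a product of closed balls
  is compact, and additivity and homogeneity are closed conditions, each involving finitely many
  coordinates.\<close>

lemma compactin_bidual_ball:
  fixes X :: "('k::conj_field, 'a) nspace"
  assumes "normed_space X"
  shows "compactin (product_topology (\<lambda>_. euclidean) (ns_carrier (dual X)))
    {F \<in> ns_carrier (bidual X). \<forall>f\<in>ns_carrier (dual X). norm (F f) \<le> ns_norm (dual X) f}"
    (is "compactin ?T ?B")
proof -
  interpret normed_space X by fact
  interpret D: normed_space "dual X" by (rule normed_space_dual)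
  let ?D = "ns_carrier (dual X)"
  define P where "P = PiE ?D (\<lambda>f. cball (0::'k) (ns_norm (dual X) f))"
  define A where "A f g
    = {F \<in> topspace ?T. F (ns_add (dual X) f g) - (F f + F g) \<in> {0::'k}}" for f g
  define H where "H c f = {F \<in> topspace ?T. F (ns_scale (dual X) c f) - c * F f \<in> {0::'k}}" for c f
  have P: "compactin ?T P" unfolding P_def by (subst compactin_PiE) auto
  have coord: "continuous_map ?T euclidean (\<lambda>F. F f)" if "f \<in> ?D" for f
    using continuous_map_product_projection[OF that, of "\<lambda>_. euclidean"] .
  have A: "closedin ?T (A f g)" if "f \<in> ?D" "g \<in> ?D" for f g
    unfolding A_def using that D.ns_add_closed
    by (intro closedin_continuous_map_preimage[where Y = euclidean] continuous_map_diff
        continuous_map_add coord) auto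
  have H: "closedin ?T (H c f)" if "f \<in> ?D" for c f
  proof -
    have "continuous_map euclidean euclidean ((*) c)" by (simp add: continuous_on_mult_left)
    from continuous_map_compose[OF coord[OF that] this]
    have "continuous_map ?T euclidean (\<lambda>F. c * F f)" by (simp add: o_def)
    then show ?thesis
      unfolding H_def using that D.ns_scale_closed
      by (intro closedin_continuous_map_preimage[where Y
        = euclidean] continuous_map_diff coord) auto
  qed
  define K where "K = insert P ({A f g |f g. f \<in> ?D \<and> g \<in> ?D} \<union> {H c f |c f. f \<in> ?D})"
  have Hausdorff: "Hausdorff_space ?T" by (simp add: Hausdorff_space_product_topology)
  have "compactin ?T (\<Inter>K)"
    using A H compactin_imp_closedin[OF Hausdorff P] unfolding K_def
    by (intro closed_compactin_Inter[OF P]) auto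
  also have "\<Inter>K = ?B"
  proof (intro subset_antisym subsetI)
    fix F assume F: "F \<in> \<Inter>K"
    have P: "F \<in> P" by (rule InterD[OF F]) (simp add: K_def)
    have A: "F \<in> A f g" if "f \<in> ?D" "g \<in> ?D" for f g
      by (rule InterD[OF F]) (use that in \<open>auto simp: K_def\<close>)
    have H: "F \<in> H c f" if "f \<in> ?D" for c f
      by (rule InterD[OF F]) (use that in \<open>auto simp: K_def\<close>)
    have le: "norm (F f) \<le> ns_norm (dual X) f" if "f \<in> ?D" for f
      using P that unfolding P_def by (auto simp: PiE_iff)
    have "F \<in> ns_carrier (bidual X)"
    proof (rule dualI[where K = 1])
      show "F f = undefined" if "f \<notin> ?D" for f using P that unfolding P_def by auto
      show "F (ns_add (dual X) f g) = F f + F g" if "f \<in> ?D" "g \<in> ?D" for f g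
        using A[OF that] unfolding A_def by (simp del: dual_simps)
      show "F (ns_scale (dual X) c f) = c * F f" if "f \<in> ?D" for c f
        using H[OF that, of c] unfolding H_def by (simp del: dual_simps)
    qed (use le in simp)
    then show "F \<in> ?B" using le by blast
  next
    fix F assume F: "F \<in> ?B"
    then have "F \<in> ns_carrier (bidual X)" by blast
    note F_lin = dualD[OF this]
    have "F \<in> P" using F F_lin(3) unfolding P_def by (auto simp: PiE_iff)
    moreover have "F \<in> topspace ?T" using F_lin(3) by (simp add: PiE_UNIV_domain PiE_def)
    ultimately show "F \<in> \<Inter>K" unfolding K_def A_def H_def
      using F_lin(1,2) by (auto simp del: dual_simps)
  qed
  finally show ?thesis .
qed

text \<open>Evaluates a bidual element at the linear combination that serves as test functional in
  \<open>weak_closure_interpolation\<close>.\<close>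

lemma bidual_sum:
  fixes Y :: "('k::conj_field, 'a) nspace"
  assumes "normed_space Y" "F \<in> ns_carrier (bidual Y)" "finite H" "H \<subseteq> ns_carrier (dual Y)"
  shows "(\<lambda>y\<in>ns_carrier Y. \<Sum>h\<in>H. c h * h y) \<in> ns_carrier (dual Y) \<and>
    F (\<lambda>y\<in>ns_carrier Y. \<Sum>h\<in>H. c h * h y) = (\<Sum>h\<in>H. c h * F h)"
  using assms(3,4)
proof (induction H)
  case empty
  interpret normed_space Y by fact
  show ?case
    using dual_zero_closed normed_space.dual_zero[OF normed_space_dual assms(2)]
    by (simp add: restrict_def)
next
  case (insert h H)
  interpret normed_space Y by fact
  let ?g = "\<lambda>y\<in>ns_carrier Y. \<Sum>h\<in>H. c h * h y"
  have g: "?g \<in> ns_carrier (dual Y)" "F ?g = (\<Sum>h\<in>H. c h * F h)"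
    using insert.IH insert.prems by blast+
  have h: "h \<in> ns_carrier (dual Y)" using insert.prems by simp
  have ch: "ns_scale (dual Y) (c h) h \<in> ns_carrier (dual Y)" using dual_scale_closed[OF h] by simp
  have eq: "(\<lambda>y\<in>ns_carrier Y. \<Sum>h\<in>insert h H. c h * h y)
    = ns_add (dual Y) (ns_scale (dual Y) (c h) h) ?g"
    using insert.hyps by (auto intro!: restrict_ext)
  show ?case
    unfolding eq using dual_add_closed[OF ch g(1)] dualD(1)[OF assms(2) ch g(1)] g(2)
      dualD(2)[OF assms(2) h, of "c h"] insert.hyps by (simp del: dual_simps) simp
qed

text \<open>Divide by \<open>t\<close> and let it tend to 0: only the first-order term survives.
  This leads from minimality to the variational inequality.\<close>

lemma small_parameter_nonpos:
  fixes a b :: real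
  assumes "\<And>t. \<lbrakk>0 < t; t \<le> 1\<rbrakk> \<Longrightarrow> 2 * t * a \<le> t\<^sup>2 * b"
  shows "a \<le> 0"
proof (rule ccontr)
  assume "\<not> a \<le> 0"
  then have a: "a > 0" by simp
  \<comment> \<open>Small enough that \<open>t * b \<le> a\<close>, whereas the hypothesis gives
    \<open>2 * a \<le> t * b\<close>.\<close>
  define t where "t = min 1 (a / (\<bar>b\<bar> + 1))"
  have t: "0 < t" "t \<le> 1" unfolding t_def using a by auto
  have "2 * a \<le> t * b"
    using assms[OF t] t(1) by (simp add: power2_eq_square)
  also have "\<dots> \<le> t * (\<bar>b\<bar> + 1)" using t by (intro mult_left_mono) auto
  also have "\<dots> \<le> a"
  proof -
    have "t \<le> a / (\<bar>b\<bar> + 1)" unfolding t_def by simp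
    then show ?thesis by (simp add: field_simps)
  qed
  finally show False using a by simp
qed

text \<open>A form of Helly's theorem. The point of the weak closure of \<open>S(B\<^sub>X)\<close> that is nearest to \<open>F\<close>
  with respect to the finitely many functionals \<open>H\<close> is at distance zero: otherwise the variational
  inequality at that point gives a functional on which \<open>F\<close> exceeds its norm.\<close>

lemma weak_closure_interpolation:
  fixes X :: "('k::conj_field, 'a) nspace" and Y :: "('k, 'b) nspace"
  assumes "normed_space X" "normed_space Y" and S: "bounded_operator X Y S"
    and K: "K = weak_topology Y closure_of (S ` unit_ball X)"
    and comp: "compactin (weak_topology Y) K"
    and F: "F \<in> ns_carrier (bidual X)"
    and F_le: "\<And>g. g \<in> ns_carrier (dual X) \<Longrightarrow> norm (F g) \<le> ns_norm (dual X) g"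
    and H: "finite H" "H \<subseteq> ns_carrier (dual Y)"
  obtains y where "y \<in> K" "\<And>h. h \<in> H \<Longrightarrow> h y = second_conjugate X Y S F h"
proof -
  interpret X: normed_space X by fact
  interpret Y: normed_space Y by fact
  note S' = bounded_operatorD[OF S]
  define a where "a = second_conjugate X Y S F"
  have a: "a \<in> ns_carrier (bidual Y)"
    unfolding a_def using second_conjugate_closed[OF assms(1,2) S F] .
  have K_carrier: "y \<in> ns_carrier Y" if "y \<in> K" for y
    using that K closure_of_subset_topspace[of "weak_topology Y"] Y.topspace_weak_topology by blast
  have S_ball: "S ` unit_ball X \<subseteq> ns_carrier Y" using S'(1) unfolding unit_ball_def by auto
  then have S_K: "S ` unit_ball X \<subseteq> K"
    unfolding K using closure_of_subset Y.topspace_weak_topology by metis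
  \<comment> \<open>The squared distance to \<open>a\<close> as seen by the functionals in
    \<open>H\<close>. It is weakly continuous and so attains a minimum on the compact set
    \<open>K\<close>.\<close>
  define \<phi> where "\<phi> y = (\<Sum>h\<in>H. (norm (a h - h y))\<^sup>2)" for y
  have "continuous_map (weak_topology Y) euclideanreal \<phi>"
    unfolding \<phi>_def using H Y.continuous_map_dual
    by (intro continuous_map_sum continuous_map_real_pow continuous_map_norm continuous_map_diff) auto
  from image_compactin[OF comp this] have "compact (\<phi> ` K)" by simp
  moreover have "\<phi> ` K \<noteq> {}" using S_K X.zero_in_unit_ball by blast
  ultimately obtain m where "m \<in> \<phi> ` K" "\<forall>s\<in>\<phi> ` K. m \<le> s"
    using compact_attains_inf by blast
  then obtain y0 where y0: "y0 \<in> K" and min: "\<And>y. y \<in> K \<Longrightarrow> \<phi> y0 \<le> \<phi> y"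
    by blast
  have y0': "y0 \<in> ns_carrier Y" using K_carrier y0 .
  define d where "d h = a h - h y0" for h
  have variation: "(\<Sum>h\<in>H. d h \<bullet> h (S x)) \<le> (\<Sum>h\<in>H. d h \<bullet> h y0)" if x: "x \<in> unit_ball X" for x
  proof -
    have x': "x \<in> ns_carrier X" "ns_norm X x \<le> 1" using x unfolding unit_ball_def by auto
    define e where "e h = h (S x) - h y0" for h :: "'b \<Rightarrow> 'k"
    have "2 * t * (\<Sum>h\<in>H. d h \<bullet> e h) \<le> t\<^sup>2 * (\<Sum>h\<in>H. (norm (e h))\<^sup>2)" if t: "0 < t" "t
      \<le> 1" for t :: real
    proof -
      \<comment> \<open>The point moved from \<open>y0\<close> towards \<open>S x\<close> stays in
        \<open>K\<close>: by convexity \<open>p\<close> maps the image of the ball into itself, and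
        being weakly continuous it maps the closure into itself.\<close>
      define p where "p y
        = ns_add Y (ns_scale Y (of_real (1 - t)) y) (ns_scale Y (of_real t) (S x))" for y
      have p_carrier: "p y \<in> ns_carrier Y" if "y \<in> ns_carrier Y" for y
        unfolding p_def using that S'(1)[OF x'(1)] Y.ns_add_closed Y.ns_scale_closed by simp
      have h_p: "h (p y) = of_real (1 - t) * h y + of_real t * h (S x)"
        if "h \<in> ns_carrier (dual Y)" "y \<in> ns_carrier Y" for h y
        unfolding p_def using that S'(1)[OF x'(1)]
        by (simp add: dualD(1)[OF that(1)] dualD(2)[OF that(1)] Y.ns_scale_closed)
      have cont: "continuous_map (weak_topology Y) (weak_topology Y) p"
      proof (rule Y.continuous_map_into_weak_topology)
        show "p ` topspace (weak_topology Y) \<subseteq> ns_carrier Y"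
          unfolding Y.topspace_weak_topology using p_carrier by blast
        fix h assume h: "h \<in> ns_carrier (dual Y)"
        have "continuous_map euclidean euclidean (\<lambda>v. of_real (1 - t) * v + of_real t * h (S x))"
          by (simp add: continuous_intros)
        from continuous_map_compose[OF Y.continuous_map_dual[OF h] this]
        show "continuous_map (weak_topology Y) euclidean (\<lambda>y. h (p y))"
          by (rule continuous_map_eq) (simp add: Y.topspace_weak_topology h_p[OF h])
      qed
      have "p (S x1) \<in> S ` unit_ball X" if "x1 \<in> unit_ball X" for x1
      proof -
        have x1: "x1 \<in> ns_carrier X" "ns_norm X x1 \<le> 1" using that unfolding unit_ball_def by auto
        let ?x = "ns_add X (ns_scale X (of_real (1 - t)) x1) (ns_scale X (of_real t) x)"
        have "ns_norm X ?x
          \<le> norm (of_real (1 - t) :: 'k) * ns_norm X x1 + norm (of_real t :: 'k) * ns_norm X x"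
          using X.ns_norm_triangle[of "ns_scale X (of_real (1 - t)) x1" "ns_scale X (of_real t) x"]
            x1 x' X.ns_scale_closed by (simp only: X.ns_norm_scale)
        also have "\<dots> \<le> (1 - t) * 1 + t * 1"
          unfolding norm_of_real
            using t x1 x' by (intro add_mono mult_mono) (auto simp: X.ns_norm_nonneg)
        finally have "?x \<in> unit_ball X"
          unfolding unit_ball_def using x1 x' X.ns_add_closed X.ns_scale_closed by simp
        moreover have "p (S x1) = S ?x"
          unfolding p_def using x1 x' S' X.ns_scale_closed by simp
        ultimately show ?thesis by blast
      qed
      then have "p ` S ` unit_ball X \<subseteq> S ` unit_ball X" by blast
      then have "weak_topology Y closure_of (p ` S ` unit_ball X) \<subseteq> K"
        unfolding K by (rule closure_of_mono)
      then have "p y0 \<in> K"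
        using continuous_map_image_closure_subset[OF cont, of "S ` unit_ball X"] y0 unfolding K
          by blast
      then have "\<phi> y0 \<le> \<phi> (p y0)" by (rule min)
      also have "\<phi> (p y0) = (\<Sum>h\<in>H. (norm (d h - t *\<^sub>R e h))\<^sup>2)"
        unfolding \<phi>_def
      proof (rule sum.cong)
        fix h assume "h \<in> H"
        then have "a h - h (p y0) = d h - t *\<^sub>R e h"
          using h_p[of h y0] H y0' unfolding d_def e_def
          by (auto simp: scaleR_conv_of_real algebra_simps)
        then show "(norm (a h - h (p y0)))\<^sup>2 = (norm (d h - t *\<^sub>R e h))\<^sup>2" by simp
      qed simp
      also have "\<dots>
        = (\<Sum>h\<in>H. (norm (d h))\<^sup>2) - 2 * t * (\<Sum>h\<in>H. d h \<bullet> e h) + t\<^sup>2 * (\<Sum>h\<in>H. (norm (e h))\<^sup>2)"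
      proof -
        have "(norm (d h - t *\<^sub>R e h))\<^sup>2
          = (norm (d h))\<^sup>2 - 2 * t * (d h \<bullet> e h) + t\<^sup>2 * (norm (e h))\<^sup>2" for h
          unfolding power2_norm_eq_inner
          by (simp add: inner_diff_left inner_diff_right inner_commute algebra_simps power2_eq_square)
        then show ?thesis by (simp add: sum.distrib sum_subtractf sum_distrib_left mult.assoc)
      qed
      finally show ?thesis unfolding \<phi>_def d_def by simp
    qed
    then have "(\<Sum>h\<in>H. d h \<bullet> e h) \<le> 0" by (rule small_parameter_nonpos)
    then show ?thesis unfolding e_def by (simp add: inner_diff_right sum_subtractf)
  qed
  \<comment> \<open>Chosen so that the real part of \<open>g y\<close> is the sum of the
    \<open>d h \<bullet> h y\<close>, the linear form in the variational inequality.\<close>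
  define g where "g = (\<lambda>y\<in>ns_carrier Y. \<Sum>h\<in>H. conjugation (d h) * h y)"
  have g: "g \<in> ns_carrier (dual Y)" "a g = (\<Sum>h\<in>H. conjugation (d h) * a h)"
    unfolding g_def using bidual_sum[OF assms(2) a H, of "\<lambda>h. conjugation (d h)"] by blast+
  have re_g: "1 \<bullet> g y = (\<Sum>h\<in>H. d h \<bullet> h y)" if "y \<in> ns_carrier Y" for y
    unfolding g_def using that by (simp add: inner_sum_right flip: inner_conjugation)
  define R where "R = (\<Sum>h\<in>H. d h \<bullet> h y0)"
  have g_le: "norm (g (S x)) \<le> R" if x: "x \<in> unit_ball X" for x
  proof (cases "g (S x) = 0")
    case True
    then show ?thesis
      using variation[OF x] re_g[of "S x"] x S_ball unfolding R_def by auto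
  next
    case False
    \<comment> \<open>A scalar of modulus 1 that turns \<open>g (S x)\<close> into its modulus. The
      ball is invariant under it, so the bound on real parts becomes a bound on norms.\<close>
    define w where "w = conjugation (g (S x)) / of_real (norm (g (S x)))"
    have w: "norm w = 1" unfolding w_def using False by (simp add: norm_divide norm_conjugation)
    have x': "x \<in> ns_carrier X" using x unfolding unit_ball_def by simp
    have wx: "ns_scale X w x \<in> unit_ball X"
      using x w unfolding unit_ball_def by (simp add: X.ns_scale_closed X.ns_norm_scale)
    have "1 \<bullet> (w * g (S x)) = norm (g (S x))"
    proof -
      have "w * g (S x) = (1 / norm (g (S x))) *\<^sub>R (conjugation (g (S x)) * g (S x))"
        unfolding w_def by (simp add: scaleR_conv_of_real divide_inverse ac_simps)
      then have "1 \<bullet> (w * g (S x)) = (1 / norm (g (S x))) * (g (S x) \<bullet> g (S x))"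
        by (simp flip: inner_conjugation)
      then show ?thesis using False by (simp add: dot_square_norm power2_eq_square)
    qed
    moreover have "g (S (ns_scale X w x)) = w * g (S x)"
      using x' S' dualD(2)[OF g(1)] by simp
    ultimately show ?thesis
      using variation[OF wx] re_g[of "S (ns_scale X w x)"] wx S_ball unfolding R_def by auto
  qed
  have Sg: "conjugate X Y S g \<in> ns_carrier (dual X)" using conjugate_closed[OF assms(1,2) S g(1)] .
  have "ns_norm (dual X) (conjugate X Y S g) = (SUP x\<in>unit_ball X. norm (conjugate X Y S g x))"
    unfolding dual_def[of X] by simp
  also have "\<dots> \<le> R"
    using g_le g(1) X.zero_in_unit_ball by (intro cSUP_least) (auto simp: unit_ball_def)
  \<comment> \<open>As \<open>F\<close> lies in the unit ball of the bidual, \<open>a g\<close>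
    cannot exceed the bound \<open>R\<close> for \<open>g\<close> on the image of the ball.
    Inserting this makes the sum of the squared norms of the \<open>d h\<close> nonpositive.\<close>
  finally have "norm (a g) \<le> R"
    using F_le[OF Sg] second_conjugate_apply[OF F g(1)] unfolding a_def by simp
  then have "1 \<bullet> a g \<le> R" using inner_one_le[of "a g"] by linarith
  then have "(\<Sum>h\<in>H. d h \<bullet> a h) \<le> (\<Sum>h\<in>H. d h \<bullet> h y0)"
    unfolding g(2) R_def by (simp add: inner_sum_right flip: inner_conjugation)
  then have "(\<Sum>h\<in>H. d h \<bullet> d h) \<le> 0"
    unfolding d_def[of "_ :: 'b \<Rightarrow> 'k"] by (simp add: inner_diff_right sum_subtractf)
  then have "(\<Sum>h\<in>H. d h \<bullet> d h) = 0" by (simp add: antisym sum_nonneg)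
  then have "d h = 0" if "h \<in> H" for h
    using that H(1) by (simp add: sum_nonneg_eq_0_iff)
  then have "h y0 = second_conjugate X Y S F h" if "h \<in> H" for h
    using that unfolding d_def a_def by simp
  then show thesis using that y0 by blast
qed

text \<open>With \<open>F\<close> rescaled into the unit ball, the points at which a given
  functional has the value prescribed by S**F form a weakly closed set. By
  \<open>weak_closure_interpolation\<close> any finitely many of these sets meet in
  \<open>K\<close>, hence all of them do by compactness.\<close>

lemma weakly_compact_operator_imp_range:
  fixes X :: "('k::conj_field, 'a) nspace" and Y :: "('k, 'b) nspace"
  assumes "normed_space X" "normed_space Y" "weakly_compact_operator X Y S"
  shows "second_conjugate X Y S ` ns_carrier (bidual X) \<subseteq> canonical_embedding Y ` ns_carrier Y"
proof
  fix G assume "G \<in> second_conjugate X Y S ` ns_carrier (bidual X)"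
  then obtain F where F: "F \<in> ns_carrier (bidual X)" and G: "G = second_conjugate X Y S F" by blast
  interpret X: normed_space X by fact
  interpret Y: normed_space Y by fact
  interpret X': normed_space "dual X" by (rule X.normed_space_dual)
  interpret X'': normed_space "bidual X" by (rule X'.normed_space_dual)
  define K where "K = weak_topology Y closure_of (S ` unit_ball X)"
  have S: "bounded_operator X Y S" and K: "compactin (weak_topology Y) K"
    using assms(3) unfolding weakly_compact_operator_def K_def by auto
  have K_carrier: "K \<subseteq> ns_carrier Y"
    using compactin_subset_topspace[OF K] Y.topspace_weak_topology by simp
  \<comment> \<open>The summand 1 keeps \<open>c\<close> positive even when \<open>F\<close> is
    zero.\<close>
  define c where "c = ns_norm (bidual X) F + 1"
  have c: "c > 0" unfolding c_def using X''.ns_norm_nonneg[OF F] by simp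
  define F1 where "F1 = ns_scale (bidual X) (of_real (1 / c)) F"
  have F1: "F1 \<in> ns_carrier (bidual X)" unfolding F1_def using F by (rule X''.ns_scale_closed)
  have F_F1: "F g = of_real c * F1 g" if "g \<in> ns_carrier (dual X)" for g
    unfolding F1_def using c that by simp
  have F1_le: "norm (F1 g) \<le> ns_norm (dual X) g" if g: "g \<in> ns_carrier (dual X)" for g
  proof -
    have "c * norm (F1 g) = norm (F g)" using F_F1[OF g] c by (simp add: norm_mult)
    also have "\<dots> \<le> c * ns_norm (dual X) g"
      using X'.dual_bound[OF F g] X'.ns_norm_nonneg[OF g] unfolding c_def
        by (simp add: algebra_simps)
    finally show ?thesis using c by simp
  qed
  define C where "C h = {y \<in> ns_carrier Y. h y = second_conjugate X Y S F1 h}" for h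
  have "K \<inter> \<Inter>(C ` ns_carrier (dual Y)) \<noteq> {}"
  proof -
    have "K \<inter> \<Inter>U \<noteq> {}" if U: "finite U" "U \<subseteq> C ` ns_carrier (dual Y)" for U
    proof -
      obtain H where H: "H \<subseteq> ns_carrier (dual Y)" "finite H" "U = C ` H"
        using finite_subset_image[OF U] by blast
      obtain y where "y \<in> K" "\<And>h. h \<in> H \<Longrightarrow> h y = second_conjugate X Y S F1 h"
        using weak_closure_interpolation[OF assms(1,2) S K_def K F1 F1_le H(2,1)] by blast
      then show ?thesis using K_carrier unfolding H(3) C_def by blast
    qed
    moreover have "closedin (weak_topology Y) (C h)" if "h \<in> ns_carrier (dual Y)" for h
      unfolding C_def using Y.closedin_weak_topology_eq[OF that] .
    ultimately show ?thesis
      using K[unfolded compactin_fip, THEN conjunct2, rule_format, of "C ` ns_carrier (dual Y)"]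
      by blast
  qed
  then obtain y where y: "y \<in> ns_carrier Y"
    "\<And>h. h \<in> ns_carrier (dual Y) \<Longrightarrow> h y = second_conjugate X Y S F1 h"
    using K_carrier unfolding C_def by blast
  have "G h = h (ns_scale Y (of_real c) y)" if h: "h \<in> ns_carrier (dual Y)" for h
    unfolding G using y(2)[OF h] dualD(2)[OF h y(1)] h F_F1[OF conjugate_closed[OF assms(1,2) S h]]
    by (simp add: second_conjugate_apply F F1)
  then show "G \<in> canonical_embedding Y ` ns_carrier Y"
    using bidual_in_canonical_iff[OF assms(2) second_conjugate_closed[OF assms(1,2) S F]]
      Y.ns_scale_closed[OF y(1)] unfolding G by blast
qed

text \<open>Here \<open>p\<close> is S** regarded as a map into Y. It is continuous from the
  topology of pointwise convergence to the weak topology, so it maps the ball of X** onto a compact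
  set. This set contains the image of the unit ball under \<open>S\<close> and, being closed, also
  the closure.\<close>

lemma range_imp_weakly_compact_operator:
  fixes X :: "('k::conj_field, 'a) nspace" and Y :: "('k, 'b) nspace"
  assumes "normed_space X" "normed_space Y" and S: "bounded_operator X Y S"
    and range: "second_conjugate X Y S ` ns_carrier (bidual X) \<subseteq> canonical_embedding Y ` ns_carrier Y"
  shows "weakly_compact_operator X Y S"
proof -
  interpret X: normed_space X by fact
  interpret Y: normed_space Y by fact
  define T where "T = product_topology (\<lambda>_. euclidean :: 'k topology) (ns_carrier (dual X))"
  define B where "B = {F \<in> ns_carrier (bidual X). \<forall>f\<in>ns_carrier (dual X). norm (F f)
    \<le> ns_norm (dual X) f}"
  have B: "compactin T B" unfolding T_def B_def by (rule compactin_bidual_ball[OF assms(1)])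
  have "\<forall>F\<in>ns_carrier (bidual X). \<exists>y\<in>ns_carrier Y. \<forall>h\<in>ns_carrier (dual Y). second_conjugate X Y S F h = h y"
    using range bidual_in_canonical_iff[OF assms(2) second_conjugate_closed[OF assms(1,2) S]]
      by blast
  then have "\<exists>p. \<forall>F\<in>ns_carrier (bidual X). p F \<in> ns_carrier Y \<and>
      (\<forall>h\<in>ns_carrier (dual Y). second_conjugate X Y S F h = h (p F))"
    unfolding Bex_def by (rule bchoice)
  then obtain p where p: "\<forall>F\<in>ns_carrier (bidual X). p F \<in> ns_carrier Y \<and>
      (\<forall>h\<in>ns_carrier (dual Y). second_conjugate X Y S F h = h (p F))"
    by blast
  then have p: "\<And>F. F \<in> ns_carrier (bidual X) \<Longrightarrow> p F \<in> ns_carrier Y"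
    "\<And>F h. \<lbrakk>F \<in> ns_carrier (bidual X); h \<in> ns_carrier (dual Y)\<rbrakk> \<Longrightarrow> h (p F) = F (conjugate X Y S h)"
    using second_conjugate_apply by metis+
  have B_bidual: "B \<subseteq> ns_carrier (bidual X)" unfolding B_def by blast
  have "continuous_map (subtopology T B) (weak_topology Y) p"
  proof (rule Y.continuous_map_into_weak_topology)
    show "p ` topspace (subtopology T B) \<subseteq> ns_carrier Y" using p(1) B_bidual by auto
    fix h assume h: "h \<in> ns_carrier (dual Y)"
    \<comment> \<open>Composed with \<open>h\<close>, the map \<open>p\<close> is evaluation at
      \<open>conjugate X Y S h\<close>, a coordinate projection of the product.\<close>
    have "continuous_map T euclidean (\<lambda>F. F (conjugate X Y S h))"
      unfolding T_def
      using continuous_map_product_projection[OF conjugate_closed[OF assms(1,2) S h], of "\<lambda>_. euclidean"] .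
    then have "continuous_map (subtopology T B) euclidean (\<lambda>F. F (conjugate X Y S h))"
      by (rule continuous_map_from_subtopology)
    then show "continuous_map (subtopology T B) euclidean (\<lambda>F. h (p F))"
      by (rule continuous_map_eq) (use p(2)[OF _ h] B_bidual in auto)
  qed
  moreover have "compactin (subtopology T B) B" using B by (simp add: compactin_subtopology)
  ultimately have pB: "compactin (weak_topology Y) (p ` B)" by (metis image_compactin)
  have "S x \<in> p ` B" if x: "x \<in> unit_ball X" for x
  proof
    have x': "x \<in> ns_carrier X" using x unfolding unit_ball_def by simp
    note Jx = canonical_embedding_closed[OF assms(1) x']
    show "canonical_embedding X x \<in> B"
      unfolding B_def using Jx X.dual_bound_unit_ball[OF _ x] x' by simp
    have "ns_add Y (S x) (ns_scale Y (- 1) (p (canonical_embedding X x))) = ns_zero Y"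
    proof (rule dual_separates_points[OF assms(2)])
      show "ns_add Y (S x) (ns_scale Y (- 1) (p (canonical_embedding X x))) \<in> ns_carrier Y"
        using bounded_operatorD(1)[OF S x'] p(1)[OF Jx] Y.ns_add_closed Y.ns_scale_closed by blast
      fix h assume h: "h \<in> ns_carrier (dual Y)"
      show "h (ns_add Y (S x) (ns_scale Y (- 1) (p (canonical_embedding X x)))) = 0"
        using Y.dual_diff[OF h bounded_operatorD(1)[OF S x'] p(1)[OF Jx]] p(2)[OF Jx h] x' h
          conjugate_closed[OF assms(1,2) S h] by simp
    qed
    then show "S x = p (canonical_embedding X x)"
      using Y.ns_diff_eq_zero bounded_operatorD(1)[OF S x'] p(1)[OF Jx] by blast
  qed
  then have "weak_topology Y closure_of (S ` unit_ball X) \<subseteq> p ` B"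
    using compactin_imp_closedin[OF Hausdorff_space_weak_topology[OF assms(2)] pB]
    by (intro closure_of_minimal) auto
  then show ?thesis
    unfolding weakly_compact_operator_def using S closed_compactin[OF pB] by simp
qed

lemma gantmacher:
  fixes X :: "('k::conj_field, 'a) nspace" and Y :: "('k, 'b) nspace"
  assumes "normed_space X" "normed_space Y" "bounded_operator X Y S"
  shows "weakly_compact_operator X Y S \<longleftrightarrow>
    second_conjugate X Y S ` ns_carrier (bidual X) \<subseteq> canonical_embedding Y ` ns_carrier Y"
  using weakly_compact_operator_imp_range[OF assms(1,2)] range_imp_weakly_compact_operator[OF assms]
  by blast

section \<open>Subspaces and quotients\<close>

text \<open>Kept apart from \<open>closed_subspace\<close> for \<open>limit_functional\<close>,
  where the subspace of the dual is given by a convergence condition.\<close>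

definition linear_subspace :: "('k::real_normed_field, 'a) nspace \<Rightarrow> 'a set \<Rightarrow> bool" where
  "linear_subspace Z M \<longleftrightarrow> M \<subseteq> ns_carrier Z \<and> ns_zero Z \<in> M \<and>
     (\<forall>x\<in>M. \<forall>y\<in>M. ns_add Z x y \<in> M) \<and> (\<forall>c. \<forall>x\<in>M. ns_scale Z c x \<in> M)"

lemma linear_subspaceD:
  assumes "linear_subspace Z M"
  shows "M \<subseteq> ns_carrier Z" "ns_zero Z \<in> M"
    and "\<lbrakk>x \<in> M; y \<in> M\<rbrakk> \<Longrightarrow> ns_add Z x y \<in> M" "x \<in> M \<Longrightarrow> ns_scale Z c x \<in> M"
  using assms unfolding linear_subspace_def by auto

lemma closed_subspace_linear: "closed_subspace Z M \<Longrightarrow> linear_subspace Z M"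
  unfolding closed_subspace_def linear_subspace_def by blast

lemma subspace_of_simps [simp]:
  "ns_carrier (subspace_of Z M) = M" "ns_zero (subspace_of Z M) = ns_zero Z"
  "ns_add (subspace_of Z M) = ns_add Z" "ns_scale (subspace_of Z M) = ns_scale Z"
  "ns_norm (subspace_of Z M) = ns_norm Z"
  unfolding subspace_of_def by simp_all

context normed_space
begin

lemma Metric_space_dist: "Metric_space (ns_carrier X) (ns_dist X)"
proof
  show "0 \<le> ns_dist X x y" for x y
    unfolding ns_dist_def by (simp add: ns_norm_nonneg ns_add_closed ns_scale_closed)
  show "ns_dist X x y = ns_dist X y x" for x y
  proof (cases "x \<in> ns_carrier X \<and> y \<in> ns_carrier X")
    case True
    then have "ns_scale X (- 1) (ns_add X x (ns_scale X (- 1) y)) = ns_add X y (ns_scale X (- 1) x)"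
      by (simp add: ns_scale_add_right ns_scale_closed ns_minus_minus ns_add_commute)
    then show ?thesis
      using True ns_norm_minus[of "ns_add X x (ns_scale X (- 1) y)"]
      unfolding ns_dist_def by (simp add: ns_add_closed ns_scale_closed)
  qed (auto simp: ns_dist_def)
  show "ns_dist X x y = 0 \<longleftrightarrow> x = y" if "x \<in> ns_carrier X" "y \<in> ns_carrier X" for x y
    using that ns_diff_eq_zero[OF that] ns_add_minus[of y]
    unfolding ns_dist_def by (auto simp: ns_norm_eq_zero ns_add_closed ns_scale_closed)
  show "ns_dist X x z \<le> ns_dist X x y + ns_dist X y z"
    if "x \<in> ns_carrier X" "y \<in> ns_carrier X" "z \<in> ns_carrier X" for x y z
  proof -
    have "ns_add X x (ns_scale X (- 1) z)
        = ns_add X (ns_add X x (ns_scale X (- 1) y)) (ns_add X y (ns_scale X (- 1) z))"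
      using that ns_add_assoc[of "ns_add X x (ns_scale X (- 1) y)" y "ns_scale X (- 1) z"]
      by (simp add: ns_add_minus_cancel ns_add_closed ns_scale_closed)
    then show ?thesis
      using that ns_norm_triangle[of "ns_add X x (ns_scale X (- 1) y)" "ns_add X y (ns_scale X (- 1) z)"]
      unfolding ns_dist_def by (simp add: ns_add_closed ns_scale_closed)
  qed
qed

lemma normed_space_subspace_of:
  assumes "linear_subspace X M"
  shows "normed_space (subspace_of X M)"
proof
  fix x assume "x \<in> ns_carrier (subspace_of X M)"
  then show "\<exists>y\<in>ns_carrier (subspace_of X M). ns_add (subspace_of X M) x y
    = ns_zero (subspace_of X M)"
    using linear_subspaceD[OF assms] ns_add_minus by (intro bexI[of _ "ns_scale X (- 1) x"]) auto
qed (use linear_subspaceD[OF assms] in \<open>auto intro: ns_add_commute simp: ns_add_assoc ns_add_zero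
      ns_scale_add_right ns_scale_add_left ns_scale_scale ns_scale_one ns_norm_nonneg ns_norm_scale
      ns_norm_eq_zero ns_norm_triangle subset_iff\<close>)

lemma closed_subspace_carrier: "closed_subspace X (ns_carrier X)"
  unfolding closed_subspace_def
  using ns_zero_closed ns_add_closed ns_scale_closed
    closedin_topspace[of "Metric_space.mtopology (ns_carrier X) (ns_dist X)"]
  by (simp add: Metric_space.topspace_mtopology[OF Metric_space_dist])

lemma closed_subspace_zero: "closed_subspace X {ns_zero X}"
  unfolding closed_subspace_def
  using ns_zero_closed ns_scale_zero_right ns_add_zero
    closedin_Hausdorff_singleton[OF Metric_space.Hausdorff_space_mtopology[OF Metric_space_dist]]
  by (simp add: Metric_space.topspace_mtopology[OF Metric_space_dist])

end

section \<open>Cosets and the quotient norm\<close>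

locale quotient = normed_space Z for Z :: "('k::real_normed_field, 'a) nspace" +
  fixes N
  assumes closed: "closed_subspace Z N"
begin

abbreviation "q \<equiv> quotient_map Z N"

lemmas N_carrier = linear_subspaceD(1)[OF closed_subspace_linear[OF closed]]
  and N_zero = linear_subspaceD(2)[OF closed_subspace_linear[OF closed]]
  and N_add = linear_subspaceD(3)[OF closed_subspace_linear[OF closed]]
  and N_scale = linear_subspaceD(4)[OF closed_subspace_linear[OF closed]]

lemma q_eq: "x \<in> ns_carrier Z \<Longrightarrow> q x = ns_add Z x ` N"
  unfolding quotient_map_def by simp

lemma q_shift:
  assumes "x \<in> ns_carrier Z" "n \<in> N"
  shows "q (ns_add Z x n) = q x"
proof -
  have n: "n \<in> ns_carrier Z" using assms N_carrier by blast
  have "ns_add Z (ns_add Z x n) ` N = ns_add Z x ` N"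
  proof (intro subset_antisym image_subsetI)
    fix m assume m: "m \<in> N"
    then have "m \<in> ns_carrier Z" using N_carrier by blast
    then show "ns_add Z (ns_add Z x n) m \<in> ns_add Z x ` N"
      using assms n m N_add by (simp add: ns_add_assoc)
    have "ns_add Z x m = ns_add Z (ns_add Z x n) (ns_add Z m (ns_scale Z (- 1) n))"
      using assms(1) n \<open>m \<in> ns_carrier Z\<close>
      by (simp add: ns_add_assoc ns_add_minus_cancel' ns_add_closed ns_scale_closed)
    then show "ns_add Z x m \<in> ns_add Z (ns_add Z x n) ` N"
      using m assms N_add N_scale by blast
  qed
  then show ?thesis using assms n ns_add_closed by (simp add: q_eq)
qed

lemma self_in_q: "x \<in> ns_carrier Z \<Longrightarrow> x \<in> q x"
  using N_zero ns_add_zero[of x] by (force simp: q_eq)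

lemma q_carrier: "x \<in> ns_carrier Z \<Longrightarrow> q x \<subseteq> ns_carrier Z"
  using N_carrier ns_add_closed by (auto simp: q_eq)

lemma q_memberD:
  assumes "x \<in> ns_carrier Z" "a \<in> q x"
  shows "q a = q x" "a \<in> ns_carrier Z"
proof -
  show "q a = q x" using assms q_shift by (auto simp: q_eq[of x])
  show "a \<in> ns_carrier Z" using assms q_carrier by blast
qed

lemma q_zero: "q (ns_zero Z) = N"
  using N_carrier ns_zero_add ns_zero_closed by (force simp: q_eq)

lemma q_eq_N_iff:
  assumes "x \<in> ns_carrier Z"
  shows "q x = N \<longleftrightarrow> x \<in> N"
proof
  show "q x = N \<Longrightarrow> x \<in> N" using self_in_q[OF assms] by simp
  show "x \<in> N \<Longrightarrow> q x = N"
    using q_shift[OF ns_zero_closed, of x] q_zero ns_zero_add[OF assms] by simp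
qed

lemma quotient_space_simps [simp]:
  "ns_carrier (quotient_space Z N) = q ` ns_carrier Z"
  "ns_zero (quotient_space Z N) = N"
  "ns_norm (quotient_space Z N) A = (INF a\<in>A. ns_norm Z a)"
  unfolding quotient_space_def by simp_all

lemma quotient_add:
  assumes "x \<in> ns_carrier Z" "y \<in> ns_carrier Z"
  shows "ns_add (quotient_space Z N) (q x) (q y) = q (ns_add Z x y)"
proof -
  have "{ns_add Z a b |a b. a \<in> q x \<and> b \<in> q y} = q (ns_add Z x y)"
  proof (intro subset_antisym subsetI)
    fix z assume "z \<in> {ns_add Z a b |a b. a \<in> q x \<and> b \<in> q y}"
    then obtain m n where mn: "m \<in> N" "n \<in> N" "z = ns_add Z (ns_add Z x m) (ns_add Z y n)"
      using assms by (auto simp: q_eq)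
    moreover have "m \<in> ns_carrier Z" "n \<in> ns_carrier Z" using mn N_carrier by blast+
    ultimately have "z = ns_add Z (ns_add Z x y) (ns_add Z m n)"
      using ns_add_add[OF assms(1) _ assms(2)] by simp
    then show "z \<in> q (ns_add Z x y)" using mn N_add assms ns_add_closed by (simp add: q_eq)
  next
    fix z assume "z \<in> q (ns_add Z x y)"
    then obtain n where n: "n \<in> N" "z = ns_add Z (ns_add Z x y) n"
      using assms ns_add_closed by (auto simp: q_eq)
    then have "z = ns_add Z x (ns_add Z y n)" using assms N_carrier ns_add_assoc by auto
    moreover have "ns_add Z y n \<in> q y" using n assms by (simp add: q_eq)
    ultimately show "z \<in> {ns_add Z a b |a b. a \<in> q x \<and> b \<in> q y}"
      using self_in_q[OF assms(1)] by blast
  qed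
  then show ?thesis unfolding quotient_space_def by simp
qed

lemma quotient_scale:
  assumes "x \<in> ns_carrier Z"
  shows "ns_scale (quotient_space Z N) c (q x) = q (ns_scale Z c x)"
proof -
  have "{ns_add Z (ns_scale Z c a) n |a n. a \<in> q x \<and> n \<in> N} = q (ns_scale Z c x)"
  proof (intro subset_antisym subsetI)
    fix z assume "z \<in> {ns_add Z (ns_scale Z c a) n |a n. a \<in> q x \<and> n \<in> N}"
    then obtain m n where mn: "m \<in> N" "n \<in> N" "z = ns_add Z (ns_scale Z c (ns_add Z x m)) n"
      using assms by (auto simp: q_eq)
    then have "z = ns_add Z (ns_scale Z c x) (ns_add Z (ns_scale Z c m) n)"
      using assms N_carrier
        by (auto simp: ns_scale_add_right ns_scale_closed ns_add_assoc subset_iff)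
    then show "z \<in> q (ns_scale Z c x)"
      using mn N_add N_scale assms ns_scale_closed by (simp add: q_eq)
  next
    fix z assume "z \<in> q (ns_scale Z c x)"
    then show "z \<in> {ns_add Z (ns_scale Z c a) n |a n. a \<in> q x \<and> n \<in> N}"
      using self_in_q[OF assms] assms ns_scale_closed by (auto simp: q_eq[of "ns_scale Z c x"])
  qed
  then show ?thesis unfolding quotient_space_def by simp
qed

lemma quotient_norm_bdd: "x \<in> ns_carrier Z \<Longrightarrow> bdd_below (ns_norm Z ` q x)"
  using q_carrier ns_norm_nonneg by (intro bdd_belowI2[of _ 0]) auto

lemma quotient_norm_le:
  assumes "x \<in> ns_carrier Z"
  shows "ns_norm (quotient_space Z N) (q x) \<le> ns_norm Z x"
  using cINF_lower[OF quotient_norm_bdd[OF assms] self_in_q[OF assms]] by simp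

lemma quotient_norm_nonneg:
  assumes "x \<in> ns_carrier Z"
  shows "0 \<le> ns_norm (quotient_space Z N) (q x)"
proof -
  have "q x \<noteq> {}" using self_in_q[OF assms] by blast
  then show ?thesis using q_carrier[OF assms] ns_norm_nonneg by (auto intro!: cINF_greatest)
qed

lemma quotient_norm_approx:
  assumes "x \<in> ns_carrier Z" "ns_norm (quotient_space Z N) (q x) < r"
  obtains a where "a \<in> ns_carrier Z" "q a = q x" "ns_norm Z a < r"
proof -
  obtain a where "a \<in> q x" "ns_norm Z a < r"
    using assms cINF_less_iff[OF _ quotient_norm_bdd[OF assms(1)]] self_in_q by auto
  then show thesis using that q_memberD[OF assms(1)] by blast
qed

text \<open>This is where closedness of \<open>N\<close> enters: a point outside \<open>N\<close>
  has a ball around it that misses \<open>N\<close>, and its radius bounds the norms in the whole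
  coset from below.\<close>

lemma quotient_norm_eq_zero:
  assumes x: "x \<in> ns_carrier Z" and zero: "ns_norm (quotient_space Z N) (q x) = 0"
  shows "x \<in> N"
proof (rule ccontr)
  assume "x \<notin> N"
  interpret M: Metric_space "ns_carrier Z" "ns_dist Z" by (rule Metric_space_dist)
  have "closedin M.mtopology N" using closed unfolding closed_subspace_def by blast
  then obtain r where r: "r > 0" "disjnt N (M.mball x r)"
    using x \<open>x \<notin> N\<close> unfolding M.closedin_metric by blast
  have "r \<le> ns_norm Z a" if a: "a \<in> q x" for a
  proof -
    obtain n where n: "n \<in> N" "a = ns_add Z x n" using a x by (auto simp: q_eq)
    have n': "n \<in> ns_carrier Z" using n N_carrier by blast
    \<comment> \<open>The norm of a = x + n is the distance from \<open>x\<close> to the point -n of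
      \<open>N\<close>.\<close>
    have m: "ns_scale Z (- 1) n \<in> N" using N_scale n by blast
    then have "ns_scale Z (- 1) n \<notin> M.mball x r" using r(2) unfolding disjnt_def by blast
    then have "\<not> ns_dist Z x (ns_scale Z (- 1) n) < r"
      using x m N_carrier by (auto simp: M.in_mball)
    moreover have "ns_dist Z x (ns_scale Z (- 1) n) = ns_norm Z a"
      using x n n' ns_scale_closed unfolding ns_dist_def by (simp add: ns_minus_minus)
    ultimately show ?thesis by simp
  qed
  then have "r \<le> ns_norm (quotient_space Z N) (q x)"
    using self_in_q[OF x] by (auto intro!: cINF_greatest)
  then show False using zero r by simp
qed

lemma quotient_norm_scale_le:
  assumes "x \<in> ns_carrier Z"
  shows "ns_norm (quotient_space Z N) (q (ns_scale Z c x))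
    \<le> norm c * ns_norm (quotient_space Z N) (q x)"
proof (rule field_le_epsilon)
  fix e :: real assume e: "0 < e"
  \<comment> \<open>The infimum need not be attained, so a nearly minimal representative is scaled.
    The divisor is positive even for \<open>c = 0\<close>, and \<open>norm c\<close> times the slack
    is at most \<open>e\<close>.\<close>
  have "ns_norm (quotient_space Z N) (q x) < ns_norm (quotient_space Z N) (q x) + e / (norm c + 1)"
    using e by (simp add: add_nonneg_pos)
  then obtain a where a: "a \<in> ns_carrier Z" "q a = q x"
    "ns_norm Z a < ns_norm (quotient_space Z N) (q x) + e / (norm c + 1)"
    using quotient_norm_approx[OF assms] by blast
  have "q (ns_scale Z c x) = q (ns_scale Z c a)"
    using quotient_scale[OF assms, of c] quotient_scale[OF a(1), of c] a(2) by simp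
  then have "ns_norm (quotient_space Z N) (q (ns_scale Z c x)) \<le> norm c * ns_norm Z a"
    using quotient_norm_le[of "ns_scale Z c a"] a(1) ns_scale_closed ns_norm_scale by simp
  also have "\<dots> \<le> norm c * (ns_norm (quotient_space Z N) (q x) + e / (norm c + 1))"
    using a(3) by (intro mult_left_mono) auto
  also have "\<dots> \<le> norm c * ns_norm (quotient_space Z N) (q x) + e"
  proof -
    have "norm c / (norm c + 1) \<le> 1" by (simp add: divide_le_eq add_nonneg_pos)
    then have "e * (norm c / (norm c + 1)) \<le> e * 1" using e by (intro mult_left_mono) auto
    then show ?thesis by (simp add: distrib_left mult.commute)
  qed
  finally show "ns_norm (quotient_space Z N) (q (ns_scale Z c x))
    \<le> norm c * ns_norm (quotient_space Z N) (q x) + e" .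
qed

lemma quotient_norm_add_le:
  assumes "x \<in> ns_carrier Z" "y \<in> ns_carrier Z"
  shows "ns_norm (quotient_space Z N) (q (ns_add Z x y))
    \<le> ns_norm (quotient_space Z N) (q x) + ns_norm (quotient_space Z N) (q y)"
proof (rule field_le_epsilon)
  fix e :: real assume "0 < e"
  then obtain a b where a: "a \<in> ns_carrier Z" "q a
    = q x" "ns_norm Z a < ns_norm (quotient_space Z N) (q x) + e / 2"
    and b: "b \<in> ns_carrier Z" "q b = q y" "ns_norm Z b < ns_norm (quotient_space Z N) (q y) + e / 2"
    using quotient_norm_approx[OF assms(1), of "ns_norm (quotient_space Z N) (q x) + e / 2"]
      quotient_norm_approx[OF assms(2), of "ns_norm (quotient_space Z N) (q y) + e / 2"]
    by (metis half_gt_zero less_add_same_cancel1)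
  have "q (ns_add Z x y) = q (ns_add Z a b)"
    using quotient_add[OF assms] quotient_add[OF a(1) b(1)] a(2) b(2) by simp
  then have "ns_norm (quotient_space Z N) (q (ns_add Z x y)) \<le> ns_norm Z (ns_add Z a b)"
    using quotient_norm_le[OF ns_add_closed[OF a(1) b(1)]] by simp
  also have "\<dots> \<le> ns_norm Z a + ns_norm Z b" using ns_norm_triangle a(1) b(1) by blast
  finally show "ns_norm (quotient_space Z N) (q (ns_add Z x y))
    \<le> ns_norm (quotient_space Z N) (q x) + ns_norm (quotient_space Z N) (q y) + e"
    using a(3) b(3) by simp
qed

lemma normed_space_quotient: "normed_space (quotient_space Z N)"
proof
  note rep = quotient_space_simps(1)
  let ?Q = "quotient_space Z N"
  show "ns_zero ?Q \<in> ns_carrier ?Q" using q_zero ns_zero_closed by force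
  fix A B C c d
  assume "A \<in> ns_carrier ?Q"
  then obtain x where x: "x \<in> ns_carrier Z" and A: "A = q x" unfolding rep by blast
  show "ns_scale ?Q c A \<in> ns_carrier ?Q"
    unfolding A using quotient_scale x ns_scale_closed by simp
  show "ns_add ?Q A (ns_zero ?Q) = A"
    unfolding A using quotient_add[OF x ns_zero_closed] q_zero ns_add_zero[OF x] by simp
  show "\<exists>B\<in>ns_carrier ?Q. ns_add ?Q A B = ns_zero ?Q"
    unfolding A using quotient_add[OF x ns_scale_closed[OF x, of "- 1"]] ns_scale_closed[OF x] ns_add_minus[OF x] q_zero
    by (intro bexI[of _ "q (ns_scale Z (- 1) x)"]) simp_all
  show "ns_scale ?Q (c + d) A = ns_add ?Q (ns_scale ?Q c A) (ns_scale ?Q d A)"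
    unfolding A using x by (simp add: quotient_scale quotient_add ns_scale_closed ns_scale_add_left)
  show "ns_scale ?Q c (ns_scale ?Q d A) = ns_scale ?Q (c * d) A"
    unfolding A using x by (simp add: quotient_scale ns_scale_closed ns_scale_scale)
  show "ns_scale ?Q 1 A = A" unfolding A using x by (simp add: quotient_scale ns_scale_one)
  show "0 \<le> ns_norm ?Q A" unfolding A by (rule quotient_norm_nonneg[OF x])
  show "ns_norm ?Q A = 0 \<longleftrightarrow> A = ns_zero ?Q"
  proof
    show "ns_norm ?Q A = 0 \<Longrightarrow> A = ns_zero ?Q"
      unfolding A using quotient_norm_eq_zero[OF x] q_eq_N_iff[OF x] by simp
    assume "A = ns_zero ?Q"
    then have "A = q (ns_zero Z)" using q_zero by simp
    then show "ns_norm ?Q A = 0"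
      using quotient_norm_le[OF ns_zero_closed] quotient_norm_nonneg[OF ns_zero_closed] ns_norm_zero by simp
  qed
  show "ns_norm ?Q (ns_scale ?Q c A) = norm c * ns_norm ?Q A"
  proof (cases "c = 0")
    case True
    then show ?thesis
      unfolding A using quotient_scale[OF x] quotient_norm_scale_le[OF x, of c]
        quotient_norm_nonneg[OF ns_scale_closed[OF x, of c]] by simp
  next
    case False
    \<comment> \<open>The one-sided estimate, applied to c x with the factor \<open>1 / c\<close>,
      gives the reverse inequality.\<close>
    have "ns_norm ?Q (q x) \<le> norm (1 / c) * ns_norm ?Q (q (ns_scale Z c x))"
      using quotient_norm_scale_le[OF ns_scale_closed[OF x, of c], of "1 / c"] False x
      by (simp add: ns_scale_scale ns_scale_one)
    then have "norm c * ns_norm ?Q (q x) \<le> ns_norm ?Q (q (ns_scale Z c x))"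
      using False by (simp add: norm_divide field_simps del: quotient_space_simps)
    then show ?thesis
      unfolding A using quotient_scale[OF x] quotient_norm_scale_le[OF x, of c] by simp
  qed
  assume "B \<in> ns_carrier ?Q"
  then obtain y where y: "y \<in> ns_carrier Z" and B: "B = q y" unfolding rep by blast
  show "ns_add ?Q A B \<in> ns_carrier ?Q"
    unfolding A B using quotient_add x y ns_add_closed by simp
  show "ns_add ?Q A B = ns_add ?Q B A"
    unfolding A B using x y by (simp add: quotient_add ns_add_commute)
  show "ns_scale ?Q c (ns_add ?Q A B) = ns_add ?Q (ns_scale ?Q c A) (ns_scale ?Q c B)"
    unfolding A B using x y
    by (simp add: quotient_scale quotient_add ns_scale_closed ns_add_closed ns_scale_add_right)
  show "ns_norm ?Q (ns_add ?Q A B) \<le> ns_norm ?Q A + ns_norm ?Q B"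
    unfolding A B quotient_add[OF x y] by (rule quotient_norm_add_le[OF x y])
  assume "C \<in> ns_carrier ?Q"
  then obtain z where z: "z \<in> ns_carrier Z" and C: "C = q z" unfolding rep by blast
  show "ns_add ?Q (ns_add ?Q A B) C = ns_add ?Q A (ns_add ?Q B C)"
    unfolding A B C using x y z by (simp add: quotient_add ns_add_closed ns_add_assoc)
qed

end

lemma short_exact_closed_subspace:
  fixes Z :: "('k::conj_field, 'a) nspace"
  assumes "normed_space Z" "closed_subspace Z M"
  shows "short_exact (subspace_of Z M) Z (quotient_space Z M) (inclusion M) (quotient_map Z M)"
proof -
  interpret quotient Z M using assms by (simp add: quotient_def quotient_axioms_def)
  interpret Q: normed_space "quotient_space Z M" by (rule normed_space_quotient)
  interpret S: normed_space "subspace_of Z M"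
    using normed_space_subspace_of closed_subspace_linear[OF assms(2)] .
  show ?thesis
  proof
    show "bounded_operator (subspace_of Z M) Z (inclusion M)"
      unfolding bounded_operator_def inclusion_def
      using N_carrier N_add N_scale by (auto intro!: exI[of _ 1])
    show "bounded_operator Z (quotient_space Z M) q"
      unfolding bounded_operator_def
      using quotient_norm_le by (auto simp: quotient_add quotient_scale intro!: exI[of _ 1])
    show "\<exists>c\<ge>0. \<forall>x\<in>ns_carrier (subspace_of Z M). ns_norm (subspace_of Z M) x
      \<le> c * ns_norm Z (inclusion M x)"
      unfolding inclusion_def by (auto intro!: exI[of _ 1])
    \<comment> \<open>The quotient norm is an infimum that need not be attained, hence the lifting
      constant 2. A coset of norm 0 is treated apart, with representative zero.\<close>
    have "\<exists>z\<in>ns_carrier Z. q z = q x \<and> ns_norm Z z \<le> 2 * ns_norm (quotient_space Z M) (q x)"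
      if x: "x \<in> ns_carrier Z" for x
    proof (cases "ns_norm (quotient_space Z M) (q x) = 0")
      case True
      then have "q (ns_zero Z) = q x"
        using quotient_norm_eq_zero[OF x] q_eq_N_iff[OF x] q_zero by simp
      then show ?thesis
        using ns_zero_closed ns_norm_zero quotient_norm_nonneg[OF x]
          by (intro bexI[of _ "ns_zero Z"]) auto
    next
      case False
      then have "ns_norm (quotient_space Z M) (q x) < 2 * ns_norm (quotient_space Z M) (q x)"
        using quotient_norm_nonneg[OF x] by linarith
      then show ?thesis using quotient_norm_approx[OF x] less_imp_le by metis
    qed
    then show "\<exists>c\<ge>0. \<forall>y\<in>ns_carrier (quotient_space Z M). \<exists>z\<in>ns_carrier Z. q z = y \<and>
        ns_norm Z z \<le> c * ns_norm (quotient_space Z M) y"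
      by (intro exI[of _ 2]) auto
    show "inclusion M ` ns_carrier (subspace_of Z M) = {z \<in> ns_carrier Z. q z
      = ns_zero (quotient_space Z M)}"
      using N_carrier q_eq_N_iff unfolding inclusion_def by auto
  qed
qed

text \<open>Removes operators, quotients and the weak topology from the three classes; what remains
  is stated with annihilators in iterated duals of \<open>Z\<close>.\<close>

lemma closed_pairs_iffs:
  fixes Z :: "('k::conj_field, 'a) nspace"
  assumes "banach_space Z" "closed_subspace Z M" "closed_subspace Z N"
  shows "(Z, M, N) \<in> \<W>\<^sub>+ \<longleftrightarrow> tauberian_criterion Z M N"
    and "(Z, M, N) \<in> \<W>\<^sub>- \<longleftrightarrow> tauberian_criterion (dual Z) (annihilator Z N) (annihilator Z M)"
    and "(Z, M, N) \<in> \<W> \<longleftrightarrow> weakly_compact_criterion Z M N"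
proof -
  have Z: "normed_space Z" using assms(1) unfolding banach_space_def by blast
  interpret short_exact_pair "subspace_of Z M" Z "quotient_space Z M" "inclusion M" "quotient_map Z M"
      "subspace_of Z N" "quotient_space Z N" "inclusion N" "quotient_map Z N"
    using short_exact_closed_subspace[OF Z] assms(2,3) by (intro short_exact_pair.intro)
  have pair: "(Z, M, N) \<in> closed_pairs" using assms unfolding closed_pairs_def by simp
  have image: "inclusion L ` ns_carrier (subspace_of Z L) = L" for L unfolding inclusion_def by auto
  show "(Z, M, N) \<in> \<W>\<^sub>+ \<longleftrightarrow> tauberian_criterion Z M N"
    unfolding tauberian_pairs_def using pair tauberian_iff image by simp
  show "(Z, M, N) \<in> \<W>\<^sub>- \<longleftrightarrow> tauberian_criterion (dual Z) (annihilator Z N) (annihilator Z M)"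
    unfolding cotauberian_pairs_def using pair cotauberian_iff image by simp
  show "(Z, M, N) \<in> \<W> \<longleftrightarrow> weakly_compact_criterion Z M N"
    unfolding weakly_compact_pairs_def
    using pair gantmacher[OF A.X.normed_space_axioms B.Y.normed_space_axioms
        bounded_comp] second_conjugate_range_iff image by simp
qed

text \<open>A generalized limit: on the subspace of those \<open>f\<close> for which
  \<open>f (x n)\<close> converges, the limit is linear and bounded by the norm of \<open>f\<close>,
  and Hahn-Banach extends it to the whole dual. It stands in for a weak* cluster point of the
  sequence.\<close>

lemma limit_functional:
  fixes X :: "('k::conj_field, 'a) nspace"
  assumes "normed_space X" and x: "\<And>n. x n \<in> unit_ball X"
  shows "\<exists>F\<in>ns_carrier (bidual X). \<forall>f\<in>ns_carrier (dual X). \<forall>l. (\<lambda>n. f (x n)) \<longlonglongrightarrow> l \<longrightarrow> F f = l"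
proof -
  interpret normed_space X by fact
  interpret D: normed_space "dual X" by (rule normed_space_dual)
  have x': "x n \<in> ns_carrier X" for n using x[of n] unfolding unit_ball_def by simp
  define C where "C = {f \<in> ns_carrier (dual X). convergent (\<lambda>n. f (x n))}"
  have C: "linear_subspace (dual X) C"
    unfolding linear_subspace_def C_def
    using dual_zero_closed dual_add_closed dual_scale_closed x'
    by (auto intro: convergent_add convergent_mult convergent_const)
  have lim: "(\<lambda>n. f (x n)) \<longlonglongrightarrow> lim (\<lambda>n. f (x n))" if "f \<in> C" for f
    using that unfolding C_def by (simp add: convergent_LIMSEQ_iff)
  obtain F where F: "F \<in> ns_carrier (bidual X)" "\<And>f. f \<in> C \<Longrightarrow> F f = lim (\<lambda>n. f (x n))"
  proof (rule hahn_banach[OF D.normed_space_subspace_of[OF C] D.normed_space_axioms,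
        of "\<lambda>f. f" "\<lambda>f. lim (\<lambda>n. f (x n))" 1])
    fix f assume "f \<in> ns_carrier (subspace_of (dual X) C)"
    then have f: "f \<in> C" by simp
    then have f': "f \<in> ns_carrier (dual X)" unfolding C_def by simp
    show "lim (\<lambda>n. ns_scale (subspace_of (dual X) C) a f (x n)) = a * lim (\<lambda>n. f (x n))" for a
      using x' tendsto_mult[OF tendsto_const lim[OF f]] by (auto intro!: limI)
    show "norm (lim (\<lambda>n. f (x n))) \<le> 1 * ns_norm (dual X) f"
      using Lim_bounded[OF tendsto_norm[OF lim[OF f]]] dual_bound_unit_ball[OF f' x] by simp
    fix g assume "g \<in> ns_carrier (subspace_of (dual X) C)"
    then have g: "g \<in> C" by simp
    show "lim (\<lambda>n. ns_add (subspace_of (dual X) C) f g (x n))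
      = lim (\<lambda>n. f (x n)) + lim (\<lambda>n. g (x n))"
      using x' tendsto_add[OF lim[OF f] lim[OF g]] by (auto intro!: limI)
  qed (use linear_subspaceD(1)[OF C] in auto)
  have "F f = l" if "f \<in> ns_carrier (dual X)" "(\<lambda>n. f (x n)) \<longlonglongrightarrow> l" for f l
    using F(2)[of f] that limI[OF that(2)] unfolding C_def convergent_def by blast
  then show ?thesis using F(1) by blast
qed

section \<open>Null sequences\<close>

definition null_sequences :: "('k::real_normed_field, nat \<Rightarrow> 'k) nspace" where
  "null_sequences =
     \<lparr>ns_carrier = {x. x \<longlonglongrightarrow> 0}, ns_zero = (\<lambda>n. 0), ns_add = (\<lambda>x y n. x n + y n),
      ns_scale = (\<lambda>c x n. c * x n), ns_norm = (\<lambda>x. SUP n. norm (x n))\<rparr>"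

lemma null_sequences_simps [simp]:
  "ns_carrier null_sequences = {x. x \<longlonglongrightarrow> 0}" "ns_zero null_sequences = (\<lambda>n. 0)"
  "ns_add null_sequences x y = (\<lambda>n. x n + y n)" "ns_scale null_sequences c x = (\<lambda>n. c * x n)"
  "ns_norm null_sequences x = (SUP n. norm (x n))"
  unfolding null_sequences_def by simp_all

lemma norm_le_null_norm:
  fixes x :: "nat \<Rightarrow> 'k::real_normed_field"
  assumes "x \<longlonglongrightarrow> 0"
  shows "norm (x n) \<le> (SUP n. norm (x n))"
proof -
  have "Bseq x" using assms convergentI convergent_imp_Bseq by blast
  then obtain K where "\<And>n. norm (x n) \<le> K" unfolding Bseq_def by blast
  then have "bdd_above (range (\<lambda>n. norm (x n)))" by (intro bdd_aboveI2)
  then show ?thesis by (rule cSUP_upper2[OF _ _ order_refl]) simp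
qed

lemma null_norm_le: "(\<And>n. norm (x n) \<le> K) \<Longrightarrow> (SUP n. norm (x n)) \<le> K"
  by (rule cSUP_least) auto

lemma normed_space_null_sequences:
  "normed_space (null_sequences :: ('k::real_normed_field, nat \<Rightarrow> 'k) nspace)"
proof
  fix x y :: "nat \<Rightarrow> 'k" and c :: 'k
  assume "x \<in> ns_carrier null_sequences"
  then have x: "x \<longlonglongrightarrow> 0" by simp
  note x_le = norm_le_null_norm[OF x]
  show "\<exists>y\<in>ns_carrier null_sequences. ns_add null_sequences x y = ns_zero null_sequences"
    using tendsto_minus[OF x] by (intro bexI[of _ "\<lambda>n. - x n"]) auto
  show nonneg: "0 \<le> ns_norm null_sequences x"
    using order.trans[OF norm_ge_zero x_le] by simp
  show "ns_norm null_sequences x = 0 \<longleftrightarrow> x = ns_zero null_sequences"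
    using x_le by (auto simp: fun_eq_iff)
  show cx: "ns_scale null_sequences c x \<in> ns_carrier null_sequences"
    using tendsto_mult[OF tendsto_const x, of c] by simp
  show "ns_norm null_sequences (ns_scale null_sequences c x) = norm c * ns_norm null_sequences x"
  proof (rule antisym)
    show "ns_norm null_sequences (ns_scale null_sequences c x) \<le> norm c * ns_norm null_sequences x"
      unfolding null_sequences_simps
      by (rule null_norm_le) (simp add: norm_mult mult_left_mono x_le)
    show "norm c * ns_norm null_sequences x \<le> ns_norm null_sequences (ns_scale null_sequences c x)"
    proof (cases "c = 0")
      case False
      have "norm (x n) \<le> (SUP n. norm (c * x n)) / norm c" for n
        using norm_le_null_norm[of "\<lambda>n. c * x n" n] cx False by (simp add: norm_mult field_simps)
      then have "ns_norm null_sequences x \<le> (SUP n. norm (c * x n)) / norm c"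
        by (auto intro!: null_norm_le)
      then show ?thesis using False by (simp add: field_simps)
    qed simp
  qed
  assume "y \<in> ns_carrier null_sequences"
  then have y: "y \<longlonglongrightarrow> 0" by simp
  show "ns_add null_sequences x y \<in> ns_carrier null_sequences" using tendsto_add[OF x y] by simp
  show "ns_norm null_sequences (ns_add null_sequences x y)
      \<le> ns_norm null_sequences x + ns_norm null_sequences y"
    using norm_triangle_le[OF add_mono[OF x_le norm_le_null_norm[OF y]]]
    by (auto intro!: null_norm_le)
qed (auto simp: algebra_simps)

lemma banach_space_null_sequences:
  "banach_space (null_sequences :: ('k::{real_normed_field, banach}, nat \<Rightarrow> 'k) nspace)"
proof -
  let ?Z = "null_sequences :: ('k, nat \<Rightarrow> 'k) nspace"
  interpret normed_space ?Z by (rule normed_space_null_sequences)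
  interpret M: Metric_space "ns_carrier ?Z" "ns_dist ?Z" by (rule Metric_space_dist)
  have dist: "ns_dist ?Z x y = (SUP n. norm (x n - y n))" if "x \<longlonglongrightarrow> 0" "y \<longlonglongrightarrow> 0" for x y
    unfolding ns_dist_def using that by simp
  have "\<exists>y. limitin M.mtopology s y sequentially" if s: "M.MCauchy s" for s
  proof -
    have null: "s m \<longlonglongrightarrow> 0" for m using s unfolding M.MCauchy_def by auto
    have Cauchy: "\<exists>N. \<forall>m\<ge>N. \<forall>m'\<ge>N. \<forall>n. norm (s m n - s m' n) < e" if "0 < e" for e
    proof -
      have "\<exists>N. \<forall>m m'. N \<le> m \<longrightarrow> N \<le> m' \<longrightarrow> ns_dist ?Z (s m) (s m') < e"
        using s[unfolded M.MCauchy_def, THEN conjunct2, rule_format, OF that] .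
      then obtain N where "\<And>m m'. \<lbrakk>N \<le> m; N \<le> m'\<rbrakk> \<Longrightarrow> ns_dist ?Z (s m) (s m') < e"
        by blast
      moreover have "norm (s m n - s m' n) \<le> ns_dist ?Z (s m) (s m')" for m m' n
        unfolding dist[OF null null]
        using norm_le_null_norm[of "\<lambda>n. s m n - s m' n"] tendsto_diff[OF null[of m] null[of m']]
          by simp
      ultimately show ?thesis by (intro exI[of _ N]) (blast intro: le_less_trans)
    qed
    \<comment> \<open>Cauchy in the supremum norm means uniformly Cauchy on the index set, which
      provides a uniform limit.\<close>
    then have "uniformly_Cauchy_on UNIV s"
      unfolding uniformly_Cauchy_on_def dist_norm by (simp, fast)
    then obtain y where "uniform_limit UNIV s y sequentially"
      using Cauchy_uniformly_convergent unfolding uniformly_convergent_on_def by blast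
    then have unif: "\<exists>N. \<forall>m\<ge>N. \<forall>n. norm (s m n - y n) < e" if "0 < e" for e
      using that unfolding uniform_limit_sequentially_iff dist_norm by blast
    have y: "y \<longlonglongrightarrow> 0"
    proof (rule LIMSEQ_I)
      fix r :: real assume r: "0 < r"
      obtain m where m: "\<And>n. norm (s m n - y n) < r / 2" using unif[of "r / 2"] r by auto
      obtain N where N: "\<And>n. N \<le> n \<Longrightarrow> norm (s m n) < r / 2"
        using LIMSEQ_D[OF null[of m], of "r / 2"] r by auto
      have "norm (y n - 0) < r" if "N \<le> n" for n
        using N[OF that] m[of n] norm_triangle_ineq4[of "s m n" "s m n - y n"] by simp
      then show "\<exists>N. \<forall>n\<ge>N. norm (y n - 0) < r" by blast
    qed
    have "\<exists>N. \<forall>m\<ge>N. ns_dist ?Z (s m) y < e" if e: "0 < e" for e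
    proof -
      obtain N where N: "\<And>m n. N \<le> m \<Longrightarrow> norm (s m n - y n) < e / 2" using unif[of "e / 2"] e by auto
      \<comment> \<open>A supremum of numbers below \<open>e / 2\<close> may equal
        \<open>e / 2\<close>; the halving restores the strict inequality.\<close>
      have "ns_dist ?Z (s m) y \<le> e / 2" if "N \<le> m" for m
        unfolding dist[OF null y] using N[OF that] by (intro null_norm_le) (simp add: less_imp_le)
      moreover have "e / 2 < e" using e by simp
      ultimately show ?thesis by (intro exI[of _ N]) (blast intro: le_less_trans)
    qed
    then show ?thesis
      unfolding M.limit_metric_sequentially using y null by auto
  qed
  then show ?thesis
    unfolding banach_space_def M.mcomplete_def using normed_space_null_sequences by blast
qed

text \<open>Neither \<open>c\<^sub>0\<close> nor its dual is reflexive: a limit of the partial sums of the unit vectors takes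
  the value \<open>1\<close> at every coordinate functional, and a limit of the coordinate functionals
  annihilates \<open>c\<^sub>0\<close> but not the first one.\<close>

lemma null_sequences_not_reflexive:
  fixes Z :: "('k::conj_field, nat \<Rightarrow> 'k) nspace"
  assumes "Z = null_sequences"
  shows "\<exists>G\<in>ns_carrier (bidual Z). G \<notin> canonical_embedding Z ` ns_carrier Z"
    and "\<exists>P\<in>ns_carrier (bidual (dual Z)). P \<notin> canonical_embedding (dual Z) ` ns_carrier (dual Z)"
proof -
  interpret normed_space Z unfolding assms by (rule normed_space_null_sequences)
  \<comment> \<open>\<open>s N\<close> is 1 up to and including the index N, so the n-th coordinate
    functional is 1 on it as soon as n \<le> N, and it vanishes from \<open>Suc N\<close>
    on.\<close>
  define s :: "nat \<Rightarrow> nat \<Rightarrow> 'k" where "s N n = (if n \<le> N then 1 else 0)" for N n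
  have "s N \<longlonglongrightarrow> 0" for N
    by (rule tendsto_eventually) (auto simp: s_def eventually_sequentially intro!: exI[of _ "Suc N"])
  moreover have "(SUP n. norm (s N n)) \<le> 1" for N by (rule null_norm_le) (simp add: s_def)
  ultimately have s: "s N \<in> unit_ball Z" for N
    by (simp only: unit_ball_def assms null_sequences_simps mem_Collect_eq)
  obtain G where G: "G \<in> ns_carrier (bidual Z)"
    and G_lim: "\<forall>f\<in>ns_carrier (dual Z). \<forall>l. (\<lambda>n. f (s n)) \<longlonglongrightarrow> l \<longrightarrow> G f = l"
    by (rule limit_functional[of Z s, OF normed_space_axioms s, THEN bexE])
  define \<delta> where "\<delta> n = (\<lambda>x\<in>ns_carrier Z. x n)" for n
  have \<delta>: "\<delta> n \<in> ns_carrier (dual Z)" for n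
  proof (rule dualI[where K = 1])
    show "norm (\<delta> n x) \<le> 1 * ns_norm Z x" if "x \<in> ns_carrier Z" for x
      using that norm_le_null_norm unfolding \<delta>_def assms by simp
    show "\<delta> n (ns_add Z x y) = \<delta> n x + \<delta> n y" if "x \<in> ns_carrier Z" "y \<in> ns_carrier Z" for x y
      using that ns_add_closed[OF that] unfolding \<delta>_def by (simp add: assms)
    show "\<delta> n (ns_scale Z c x) = c * \<delta> n x" if "x \<in> ns_carrier Z" for c x
      using that ns_scale_closed[OF that, of c] unfolding \<delta>_def by (simp add: assms)
  qed (simp add: \<delta>_def)
  have \<delta>_ball: "\<delta> n \<in> unit_ball (dual Z)" for n
  proof -
    have "ns_norm (dual Z) (\<delta> n) \<le> 1"
      by (rule dual_norm_le) (use norm_le_null_norm in \<open>simp_all add: \<delta>_def assms\<close>)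
    then show ?thesis using \<delta> unfolding unit_ball_def by simp
  qed
  have G_\<delta>: "G (\<delta> n) = 1" for n
  proof (rule G_lim[rule_format, OF \<delta>], rule tendsto_eventually)
    show "\<forall>\<^sub>F N in sequentially. \<delta> n (s N) = 1"
      using s unfolding eventually_sequentially \<delta>_def unit_ball_def
      by (auto simp: s_def intro!: exI[of _ n])
  qed
  have "G \<notin> canonical_embedding Z ` ns_carrier Z"
  proof
    assume "G \<in> canonical_embedding Z ` ns_carrier Z"
    then obtain x where x: "x \<in> ns_carrier Z" "\<And>f. f \<in> ns_carrier (dual Z) \<Longrightarrow> G f = f x"
      using bidual_in_canonical_iff[OF normed_space_axioms G] by blast
    have "x n = 1" for n using x(2)[OF \<delta>, of n] G_\<delta>[of n] x(1) unfolding \<delta>_def by simp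
    then have "x = (\<lambda>n. 1)" by blast
    moreover have "x \<longlonglongrightarrow> 0" using x(1) unfolding assms by simp
    ultimately show False by (simp add: LIMSEQ_const_iff)
  qed
  then show "\<exists>G\<in>ns_carrier (bidual Z). G \<notin> canonical_embedding Z ` ns_carrier Z" using G by blast
  obtain P where P: "P \<in> ns_carrier (bidual (dual Z))"
    and P_lim: "\<forall>F\<in>ns_carrier (bidual Z). \<forall>l. (\<lambda>n. F (\<delta> n)) \<longlonglongrightarrow> l \<longrightarrow> P F = l"
    by (rule limit_functional[of "dual Z" \<delta>, OF normed_space_dual \<delta>_ball, THEN bexE])
  have "P \<notin> canonical_embedding (dual Z) ` ns_carrier (dual Z)"
  proof
    assume "P \<in> canonical_embedding (dual Z) ` ns_carrier (dual Z)"
    then obtain f where f: "f \<in> ns_carrier (dual Z)" "\<And>F. F \<in> ns_carrier (bidual Z) \<Longrightarrow> P F = F f"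
      using bidual_in_canonical_iff[OF normed_space_dual P] by blast
    \<comment> \<open>On points of Z the element \<open>P\<close> is the limit of the coordinates,
      hence 0, and \<open>f\<close> takes the same values there.\<close>
    have "f x = ns_zero (dual Z) x" if x: "x \<in> ns_carrier Z" for x
    proof -
      have "(\<lambda>n. canonical_embedding Z x (\<delta> n)) \<longlonglongrightarrow> 0"
        using x \<delta> by (simp add: \<delta>_def) (simp add: assms)
      then have "P (canonical_embedding Z x) = 0"
        by (rule P_lim[rule_format, OF canonical_embedding_closed[OF normed_space_axioms x]])
      then show ?thesis
        using f(2)[OF canonical_embedding_closed[OF normed_space_axioms x]] f(1) x by simp
    qed
    then have "f = ns_zero (dual Z)" using f(1) dual_zero_closed by (intro dual_eqI) auto
    then have "G f = 0" using normed_space.dual_zero[OF normed_space_dual G] by simp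
    moreover have "G f = 1" using f(2)[OF G] P_lim[rule_format, OF G, of 1] G_\<delta> by simp
    ultimately show False by simp
  qed
  then show "\<exists>P\<in>ns_carrier (bidual (dual Z)). P \<notin> canonical_embedding (dual Z) ` ns_carrier (dual Z)"
    using P by blast
qed

section \<open>Perturbation classes\<close>

lemma annihilator_zero: "normed_space Z \<Longrightarrow> annihilator Z {ns_zero Z} = ns_carrier (dual Z)"
  unfolding annihilator_def using normed_space.dual_zero by auto

lemma annihilator_carrier:
  assumes "normed_space Z"
  shows "annihilator Z (ns_carrier Z) = {ns_zero (dual Z)}"
  unfolding annihilator_def using normed_space.dual_zero_closed[OF assms]
  by (auto intro: dual_eqI)

text \<open>The annihilators of 0 and Z are the whole dual and 0, so each criterion either holds
  trivially or says that Z is reflexive. The lemma is applied to c_0 and to its dual.\<close>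

lemma criteria_zero_carrier:
  assumes "normed_space Z"
  shows "weakly_compact_criterion Z {ns_zero Z} (ns_carrier Z)"
    and "tauberian_criterion Z (ns_carrier Z) {ns_zero Z}"
    and "weakly_compact_criterion Z (ns_carrier Z) {ns_zero Z} \<longleftrightarrow>
      ns_carrier (bidual Z) \<subseteq> canonical_embedding Z ` ns_carrier Z"
    and "tauberian_criterion Z (ns_carrier Z) (ns_carrier Z) \<longleftrightarrow>
      ns_carrier (bidual Z) \<subseteq> canonical_embedding Z ` ns_carrier Z"
proof -
  interpret normed_space Z by fact
  note canonical = bidual_in_canonical_iff[OF assms]
  note zero = annihilator_zero[OF assms] and carrier = annihilator_carrier[OF assms]
    annihilator_zero[OF normed_space_dual]
  show "weakly_compact_criterion Z {ns_zero Z} (ns_carrier Z)"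
    unfolding weakly_compact_criterion_def carrier
  proof
    fix G assume "G \<in> biannihilator Z {ns_zero Z}"
    then have "G (ns_zero (dual Z)) = 0"
      unfolding annihilator_def[of "dual Z"]
        using normed_space.dual_zero[OF normed_space_dual] by blast
    then show "\<exists>z\<in>ns_carrier Z. \<forall>f\<in>{ns_zero (dual Z)}. G f = f z"
      using ns_zero_closed by (intro bexI[of _ "ns_zero Z"]) simp_all
  qed
  show "tauberian_criterion Z (ns_carrier Z) {ns_zero Z}"
    unfolding tauberian_criterion_def carrier zero using canonical by blast
  show "weakly_compact_criterion Z (ns_carrier Z) {ns_zero Z} \<longleftrightarrow>
      ns_carrier (bidual Z) \<subseteq> canonical_embedding Z ` ns_carrier Z"
    unfolding weakly_compact_criterion_def carrier zero using canonical by blast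
  have "G (ns_zero (dual Z)) = ns_zero (dual Z) z"
    if "G \<in> ns_carrier (bidual Z)" "z \<in> ns_carrier Z" for G z
    using normed_space.dual_zero[OF normed_space_dual that(1)] that(2) by simp
  then show "tauberian_criterion Z (ns_carrier Z) (ns_carrier Z) \<longleftrightarrow>
      ns_carrier (bidual Z) \<subseteq> canonical_embedding Z ` ns_carrier Z"
    unfolding tauberian_criterion_def carrier using ns_zero_closed by blast
qed

lemma weak_pairs_stable:
  "symmetric_class (\<W>\<^sub>+ :: ('k::conj_field, 'a) pair_class)"
  "symmetric_class (\<W>\<^sub>- :: ('k, 'a) pair_class)"
  "transitive_class (\<W> :: ('k, 'a) pair_class)"
  "left_stable (\<W>\<^sub>+ :: ('k, 'a) pair_class) \<W>"
  "right_stable (\<W>\<^sub>- :: ('k, 'a) pair_class) \<W>"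
proof -
  have Z: "normed_space Z" if "banach_space Z" for Z :: "('k, 'a) nspace"
    using that unfolding banach_space_def by blast
  show "symmetric_class (\<W>\<^sub>+ :: ('k, 'a) pair_class)"
    unfolding symmetric_class_def using tauberian_criterion_sym[OF Z]
    by (auto simp: closed_pairs_iffs)
  show "symmetric_class (\<W>\<^sub>- :: ('k, 'a) pair_class)"
    unfolding symmetric_class_def
      using tauberian_criterion_sym[OF normed_space.normed_space_dual[OF Z]]
    by (auto simp: closed_pairs_iffs)
  show "transitive_class (\<W> :: ('k, 'a) pair_class)"
    unfolding transitive_class_def using weakly_compact_criterion_trans[OF Z]
    by (auto simp: closed_pairs_iffs)
  show "left_stable (\<W>\<^sub>+ :: ('k, 'a) pair_class) \<W>"
    unfolding left_stable_def using tauberian_criterion_left_stable[OF Z]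
    by (auto simp: closed_pairs_iffs)
  show "right_stable (\<W>\<^sub>- :: ('k, 'a) pair_class) \<W>"
    unfolding right_stable_def
  proof (intro allI impI, elim conjE)
    fix Z :: "('k, 'a) nspace" and L M N
    assume *: "banach_space Z" "closed_subspace Z L" "closed_subspace Z M" "closed_subspace Z N"
      and LM: "(Z, L, M) \<in> \<W>\<^sub>-" and MN: "(Z, M, N) \<in> \<W>"
    have "N \<subseteq> ns_carrier Z" using *(4) unfolding closed_subspace_def by blast
    \<comment> \<open>Right stability of W_- is left stability of the tauberian criterion in the
      dual: (N^perp, M^perp) is the weakly compact pair, (M^perp, L^perp) the tauberian one, and
      (N^perp, L^perp) results.\<close>
    then have "weakly_compact_criterion (dual Z) (annihilator Z N) (annihilator Z M)"
      using weakly_compact_criterion_dual[OF Z] MN * by (simp add: closed_pairs_iffs)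
    then show "(Z, L, N) \<in> \<W>\<^sub>-"
      using tauberian_criterion_left_stable[OF normed_space.normed_space_dual[OF Z[OF *(1)]]] LM *
      by (simp add: closed_pairs_iffs)
  qed
qed

text \<open>The perturbing pair is (0, Z) throughout. For W_+ the triple (L, M, N) is (Z, 0, Z): (Z,
  0) is tauberian, but (Z, Z) yields the zero operator on a nonreflexive space. For W_- it is (0, Z,
  0): (Z, 0) is cotauberian, but (0, 0) yields an operator whose conjugate is zero on the
  nonreflexive dual.\<close>

lemma weak_pairs_not_stable:
  "\<not> symmetric_class (\<W> :: ('k::conj_field, nat \<Rightarrow> 'k) pair_class)"
  "\<not> right_stable (\<W>\<^sub>+ :: ('k, nat \<Rightarrow> 'k) pair_class) \<W>"
  "\<not> left_stable (\<W>\<^sub>- :: ('k, nat \<Rightarrow> 'k) pair_class) \<W>"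
proof -
  define Z :: "('k, nat \<Rightarrow> 'k) nspace" where "Z = null_sequences"
  let ?O = "{ns_zero Z}" and ?Z = "ns_carrier Z"
  have banach: "banach_space Z" unfolding Z_def by (rule banach_space_null_sequences)
  then interpret normed_space Z unfolding banach_space_def by blast
  note O = closed_subspace_zero and C = closed_subspace_carrier
  note iffs = closed_pairs_iffs[OF banach]
  note crit = criteria_zero_carrier[OF normed_space_axioms]
    and dual_crit = criteria_zero_carrier[OF normed_space_dual]
  note ann = annihilator_zero[OF normed_space_axioms] annihilator_carrier[OF normed_space_axioms]
  have not_reflexive: "\<not> ns_carrier (bidual Z) \<subseteq> canonical_embedding Z ` ns_carrier Z"
    "\<not> ns_carrier (bidual (dual Z)) \<subseteq> canonical_embedding (dual Z) ` ns_carrier (dual Z)"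
    using null_sequences_not_reflexive[OF Z_def] by blast+
  have OZ: "(Z, ?O, ?Z) \<in> \<W>" using iffs(3)[OF O C] crit(1) by blast
  have "(Z, ?Z, ?O) \<notin> \<W>" using iffs(3)[OF C O] crit(3) not_reflexive(1) by blast
  then show "\<not> symmetric_class (\<W> :: ('k, nat \<Rightarrow> 'k) pair_class)"
    unfolding symmetric_class_def using OZ banach O C by blast
  have "(Z, ?Z, ?O) \<in> \<W>\<^sub>+" using iffs(1)[OF C O] crit(2) by blast
  moreover have "(Z, ?Z, ?Z) \<notin> \<W>\<^sub>+" using iffs(1)[OF C C] crit(4) not_reflexive(1) by blast
  ultimately show "\<not> right_stable (\<W>\<^sub>+ :: ('k, nat \<Rightarrow> 'k) pair_class) \<W>"
    unfolding right_stable_def using OZ banach O C by blast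
  have "(Z, ?Z, ?O) \<in> \<W>\<^sub>-" using iffs(2)[OF C O] dual_crit(2) unfolding ann by blast
  moreover have "(Z, ?O, ?O) \<notin> \<W>\<^sub>-"
    using iffs(2)[OF O O] dual_crit(4) not_reflexive(2) unfolding ann by blast
  ultimately show "\<not> left_stable (\<W>\<^sub>- :: ('k, nat \<Rightarrow> 'k) pair_class) \<W>"
    unfolding left_stable_def using OZ banach O C by blast
qed

text \<open>The positive assertions concern ambient spaces over an arbitrary type \<open>'a\<close>.
  A negated one requires a type that can carry a counterexample, hence sequences, the type of c_0.
  The two halves are the two scalar fields.\<close>

theorem proposition3p11:
  "((symmetric_class (\<W>\<^sub>+ :: (real, 'a) pair_class) \<and>
      symmetric_class (\<W>\<^sub>- :: (real, 'a) pair_class)) \<and>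
     (transitive_class (\<W> :: (real, 'a) pair_class) \<and>
      \<not> symmetric_class (\<W> :: (real, nat \<Rightarrow> real) pair_class)) \<and>
     (left_stable (\<W>\<^sub>+ :: (real, 'a) pair_class) \<W> \<and>
      \<not> right_stable (\<W>\<^sub>+ :: (real, nat \<Rightarrow> real) pair_class) \<W>) \<and>
     (right_stable (\<W>\<^sub>- :: (real, 'a) pair_class) \<W> \<and>
      \<not> left_stable (\<W>\<^sub>- :: (real, nat \<Rightarrow> real) pair_class) \<W>)) \<and>
    ((symmetric_class (\<W>\<^sub>+ :: (complex, 'a) pair_class) \<and>
      symmetric_class (\<W>\<^sub>- :: (complex, 'a) pair_class)) \<and>
     (transitive_class (\<W> :: (complex, 'a) pair_class) \<and>
      \<not> symmetric_class (\<W> :: (complex, nat \<Rightarrow> complex) pair_class)) \<and>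
     (left_stable (\<W>\<^sub>+ :: (complex, 'a) pair_class) \<W> \<and>
      \<not> right_stable (\<W>\<^sub>+ :: (complex, nat \<Rightarrow> complex) pair_class) \<W>) \<and>
     (right_stable (\<W>\<^sub>- :: (complex, 'a) pair_class) \<W> \<and>
      \<not> left_stable (\<W>\<^sub>- :: (complex, nat \<Rightarrow> complex) pair_class) \<W>))"
  by (intro conjI weak_pairs_stable weak_pairs_not_stable)

end
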